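(* Let $X$ be a locally compact Hausdorff space and $\kappa$ a kernel on $X$ satisfying the energy, consistency, and domination principles. Suppose that both of the following hold: $(\mathcal A_1)$ the topology on $X$ has a countable base; $(\mathcal A_2)$ the set of all $f\in C_0(X)$ representable as potentials $f=\kappa\lambda$ with $\lambda\in\mathcal E$ is dense in $C_0(X)$ equipped with the inductive limit topology. Then for arbitrary $A\subset X$, there exists a $K_\sigma$-set $A_0\subset A$ such that, for every $Q$ with the property $A_0\subset Q\subset A$, \[\mu^A=\mu^{Q}=\mu^{A_0}\quad\text{for all }\mu\in\mathcal E.\] Furthermore, for every Borel set $B$ such that $A_0\subset B\subset A$, \[\mu^A=\mu^{*B}=\mu^{*A_0}\quad\text{for all }\mu\in\mathcal E.\] Here $\mu^A$ and $\mu^{*A}$ denote the inner and the outer balayage of $\mu$ to $A$, respectively.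
   Context: **Measures.** $X$ is a locally compact Hausdorff space. $C_0(X)$ is the space of continuous functions $f:X\to\mathbb R$ of compact support. Its inductive limit topology is the finest locally convex topology for which all inclusions $C_0(K;X)\to C_0(X)$, $K\subset X$ compact, are continuous, where $C_0(K;X)$ is the space of $f\in C_0(X)$ with support in $K$, with the topology of uniform convergence on $K$. $\mathfrak M$ is the linear space of (signed, real-valued) Radon measures on $X$, i.e. the dual of $C_0(X)$ with this topology (equivalently, differences of positive Radon measures, understood as functionals on $C_0(X)$). It carries the vague topology of pointwise convergence on $C_0(X)$. $\mathfrak M^+$ is the cone of positive measures; $\mu=\mu^+-\mu^-$ is the Hahn–Jordan decomposition. A $K_\sigma$-set is a countable union of compact subsets of $X$. **Kernels.** A kernel is a symmetric lower semicontinuous function $\kappa:X\times X\to[0,\infty]$. Put $\kappa\mu(x):=\int\kappa(x,y)\,d\mu(y)$ (potential) and $\kappa(\mu,\nu):=\int\kappa\,d(\mu\otimes\nu)$ (mutual energy; $\kappa(\mu,\mu)$ is the energy of $\mu$), whenever well defined as a finite number or $\pm\infty$. $\mathcal E$ is the set of $\mu\in\mathfrak M$ of finite energy, $\mathcal E^+:=\mathcal E\cap\mathfrak M^+$. - Energy principle: $\kappa(\mu,\mu)\geqslant0$ for all $\mu\in\mathfrak M$ for which the energy is defined, and $\kappa(\mu,\mu)=0$ implies $\mu=0$. Then $\mathcal E$ is a pre-Hilbert space with inner product $\kappa(\mu,\nu)$ and norm $\|\mu\|=\sqrt{\kappa(\mu,\mu)}$; the norm topology is called strong. - Consistency principle: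 every strong Cauchy net in $\mathcal E^+$ converges strongly to any of its vague limit (cluster) points. - Domination principle: if $\mu,\nu\in\mathcal E^+$ and $\kappa\mu\leqslant\kappa\nu$ $\mu$-a.e., then $\kappa\mu\leqslant\kappa\nu$ on all of $X$. **Capacity.** $\mathcal E^+_A$ is the set of $\mu\in\mathcal E^+$ concentrated on $A$, i.e. such that $X\setminus A$ is locally $\mu$-negligible ($(X\setminus A)\cap K$ is $\mu$-negligible for every compact $K$). Inner capacity: $c_*(A):=\bigl[\inf\{\kappa(\mu,\mu):\mu\in\mathcal E^+_A,\ \mu(X)=1\}\bigr]^{-1}$ ($\inf\varnothing=+\infty$). Outer capacity: $c^*(A):=\inf c_*(D)$ over open $D\supset A$. "N.e. on $A$" (resp. "q.e. on $A$") means: everywhere on $A$ except for a subset of $A$ of inner (resp. outer) capacity zero. **Balayage.** For $\mu\in\mathcal E^+$ and $A\subset X$, let $\Lambda_{A,\mu}$ be the set of $\nu\in\mathcal E^+$ with $\kappa\nu\geqslant\kappa\mu$ n.e. on $A$. The inner balayage $\mu^A$ is the unique measure in $\Lambda_{A,\mu}$ with $\kappa\mu^A=\min_{\nu\in\Lambda_{A,\mu}}\kappa\nu$ everywhere on $X$ (under the three principles it is known to exist and be unique). The outer balayage $\mu^{*A}$ is defined in the same way with "n.e." replaced by "q.e."; it is unique if it exists, and an equality involving it includes its existence. For signed $\mu\in\mathcal E$ (then $\mu^\pm\in\mathcal E^+$), $\mu^A:=(\mu^+)^A-(\mu^-)^A$ and $\mu^{*A}:=(\mu^+)^{*A}-(\mu^-)^{*A}$.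 *)

theory Defs
  imports "HOL-Analysis.Analysis"
begin

section \<open>Compactly supported functions and the inductive limit topology\<close>

definition Cc :: "('a::topological_space \<Rightarrow> real) set" where
  "Cc = {f. continuous_on UNIV f \<and> compact (closure {x. f x \<noteq> 0})}"

definition Cc_in :: "'a::topological_space set \<Rightarrow> ('a \<Rightarrow> real) set" where
  "Cc_in K = {f \<in> Cc. closure {x. f x \<noteq> 0} \<subseteq> K}"

definition uniform_topology :: "'a::topological_space set \<Rightarrow> ('a \<Rightarrow> real) topology" where
  "uniform_topology K = topology (\<lambda>U. U \<subseteq> Cc_in K \<and>
     (\<forall>f\<in>U. \<exists>e>0. \<forall>g\<in>Cc_in K. (\<forall>x\<in>K. \<bar>g x - f x\<bar> < e) \<longrightarrow> g \<in> U))"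

lemma openin_uniform_topology:
  "openin (uniform_topology K) U \<longleftrightarrow> U \<subseteq> Cc_in K \<and>
     (\<forall>f\<in>U. \<exists>e>0. \<forall>g\<in>Cc_in K. (\<forall>x\<in>K. \<bar>g x - f x\<bar> < e) \<longrightarrow> g \<in> U)"
proof -
  let ?P = "\<lambda>U. U \<subseteq> Cc_in K \<and>
     (\<forall>f\<in>U. \<exists>e>0. \<forall>g\<in>Cc_in K. (\<forall>x\<in>K. \<bar>g x - f x\<bar> < e) \<longrightarrow> g \<in> U)"
  have "istopology ?P"
    unfolding istopology_def
  proof (intro conjI allI impI)
    fix S T assume S: "?P S" and T: "?P T"
    show "S \<inter> T \<subseteq> Cc_in K" using S by blast
    show "\<forall>f\<in>S \<inter> T. \<exists>e>0. \<forall>g\<in>Cc_in K. (\<forall>x\<in>K. \<bar>g x - f x\<bar> < e) \<longrightarrow> g \<in> S \<inter> T"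
    proof
      fix f assume f: "f \<in> S \<inter> T"
      obtain d where d: "d > 0" "\<forall>g\<in>Cc_in K. (\<forall>x\<in>K. \<bar>g x - f x\<bar> < d) \<longrightarrow> g \<in> S"
        using S f by blast
      obtain e where e: "e > 0" "\<forall>g\<in>Cc_in K. (\<forall>x\<in>K. \<bar>g x - f x\<bar> < e) \<longrightarrow> g \<in> T"
        using T f by blast
      show "\<exists>e>0. \<forall>g\<in>Cc_in K. (\<forall>x\<in>K. \<bar>g x - f x\<bar> < e) \<longrightarrow> g \<in> S \<inter> T"
        using d e by (intro exI[of _ "min d e"]) auto
    qed
  next
    fix \<K> assume *: "\<forall>U\<in>\<K>. ?P U"
    show "\<Union>\<K> \<subseteq> Cc_in K" using * by blast
    show "\<forall>f\<in>\<Union>\<K>. \<exists>e>0. \<forall>g\<in>Cc_in K. (\<forall>x\<in>K. \<bar>g x - f x\<bar> < e) \<longrightarrow> g \<in> \<Union>\<K>"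
      using * by (meson Union_iff)
  qed
  then show ?thesis
    unfolding uniform_topology_def by simp
qed

definition locally_convex_topology :: "('a::topological_space \<Rightarrow> real) topology \<Rightarrow> bool" where
  "locally_convex_topology T \<longleftrightarrow>
     topspace T = Cc \<and>
     continuous_map (prod_topology T T) T (\<lambda>(f, g). \<lambda>x. f x + g x) \<and>
     continuous_map (prod_topology euclideanreal T) T (\<lambda>(c, f). \<lambda>x. c * f x) \<and>
     (\<forall>U. openin T U \<and> (\<lambda>x. 0) \<in> U \<longrightarrow>
       (\<exists>V. openin T V \<and> (\<lambda>x. 0) \<in> V \<and> V \<subseteq> U \<and>
         (\<forall>f\<in>V. \<forall>g\<in>V. \<forall>t\<in>{0..1}. (\<lambda>x. (1 - t) * f x + t * g x) \<in> V)))"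

text \<open>The join of locally convex topologies is locally convex, and a map into a join is continuous
  iff it is continuous into each member. Hence the finest locally convex topology making all
  inclusions continuous is the join of all locally convex topologies that do so.\<close>

definition inductive_limit_topology :: "('a::topological_space \<Rightarrow> real) topology" where
  "inductive_limit_topology = topology_generated_by
     {U. \<exists>T. locally_convex_topology T \<and>
             (\<forall>K. compact K \<longrightarrow> continuous_map (uniform_topology K) T (\<lambda>f. f)) \<and>
             openin T U}"


section \<open>Radon measures\<close>

definition radon_measure :: "'a::topological_space measure \<Rightarrow> bool" where
  "radon_measure M \<longleftrightarrow>
     sets M = sets borel \<and>
     (\<forall>K. compact K \<longrightarrow> emeasure M K < \<infinity>) \<and>
     (\<forall>B\<in>sets borel. emeasure M B = (INF U\<in>{U. open U \<and> B \<subseteq> U}. emeasure M U)) \<and>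
     (\<forall>U. open U \<longrightarrow> emeasure M U = (SUP K\<in>{K. compact K \<and> K \<subseteq> U}. emeasure M K))"

text \<open>A signed Radon measure is the functional \<open>f \<mapsto> \<integral>f dP - \<integral>f dN\<close> on \<^const>\<open>Cc\<close>. It is given the
  value 0 outside \<^const>\<open>Cc\<close>, so that equality of functionals on \<^const>\<open>Cc\<close> is equality of functions.\<close>

type_synonym 'a functional = "('a \<Rightarrow> real) \<Rightarrow> real"

definition difference_functional ::
    "'a::topological_space measure \<Rightarrow> 'a measure \<Rightarrow> 'a functional" where
  "difference_functional P N =
     (\<lambda>f. if f \<in> Cc then (\<integral>x. f x \<partial>P) - (\<integral>x. f x \<partial>N) else 0)"

definition signed_measures :: "'a::topological_space functional set" where
  "signed_measures =
     {difference_functional P N | P N. radon_measure P \<and> radon_measure N}"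

definition positive_measures :: "'a::topological_space functional set" where
  "positive_measures =
     {\<mu> \<in> signed_measures. \<forall>f\<in>Cc. (\<forall>x. 0 \<le> f x) \<longrightarrow> 0 \<le> \<mu> f}"

definition mutually_singular :: "'a::topological_space measure \<Rightarrow> 'a measure \<Rightarrow> bool" where
  "mutually_singular P N \<longleftrightarrow>
     (\<exists>H\<in>sets borel. emeasure P (- H) = 0 \<and> emeasure N H = 0)"

text \<open>The unique pair of mutually singular Radon measures representing the functional. On a
  second countable locally compact Hausdorff space all Radon measures are sigma-finite, so
  Hahn's theorem provides it. For a positive functional, the second component is the zero measure
  and the first one is the representing measure.\<close>

definition hahn_jordan ::
    "'a::topological_space functional \<Rightarrow> 'a measure \<times> 'a measure" where
  "hahn_jordan \<mu> = (THE (P, N). radon_measure P \<and> radon_measure N \<and>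
     mutually_singular P N \<and> \<mu> = difference_functional P N)"

definition pos_measure :: "'a::topological_space functional \<Rightarrow> 'a measure" where
  "pos_measure \<mu> = fst (hahn_jordan \<mu>)"

definition neg_measure :: "'a::topological_space functional \<Rightarrow> 'a measure" where
  "neg_measure \<mu> = snd (hahn_jordan \<mu>)"

definition pos_part :: "'a::topological_space functional \<Rightarrow> 'a functional" where
  "pos_part \<mu> = difference_functional (pos_measure \<mu>) (null_measure borel)"

definition neg_part :: "'a::topological_space functional \<Rightarrow> 'a functional" where
  "neg_part \<mu> = difference_functional (neg_measure \<mu>) (null_measure borel)"

text \<open>All functionals in \<^const>\<open>signed_measures\<close> vanish outside \<^const>\<open>Cc\<close>, so the topology of
  pointwise convergence, which is the topology of the function type, induces the vague topology on
  them.\<close>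

definition vague_cluster_point ::
    "'a::topological_space functional filter \<Rightarrow> 'a functional \<Rightarrow> bool" where
  "vague_cluster_point F \<nu> \<longleftrightarrow> inf (nhds \<nu>) F \<noteq> bot"


section \<open>Kernels, potentials and energies\<close>

definition potential_kernel :: "('a::topological_space \<Rightarrow> 'a \<Rightarrow> ennreal) \<Rightarrow> bool" where
  "potential_kernel \<kappa> \<longleftrightarrow>
     (\<forall>x y. \<kappa> x y = \<kappa> y x) \<and> (\<forall>a. open {(x, y). a < \<kappa> x y})"

text \<open>In \<^typ>\<open>ereal\<close>, subtracting infinity from infinity gives infinity. Therefore
  \<open>potential\<close> and \<open>mutual_energy\<close> are meaningful only where \<open>potential_defined\<close> and
  \<open>energy_defined\<close> hold, which is always the case for positive measures.\<close>

definition pos_potential :: "('a \<Rightarrow> 'a \<Rightarrow> ennreal) \<Rightarrow> 'a measure \<Rightarrow> 'a \<Rightarrow> ennreal" where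
  "pos_potential \<kappa> M x = (\<integral>\<^sup>+ y. \<kappa> x y \<partial>M)"

definition potential_defined ::
    "('a::topological_space \<Rightarrow> 'a \<Rightarrow> ennreal) \<Rightarrow> 'a functional \<Rightarrow> 'a \<Rightarrow> bool" where
  "potential_defined \<kappa> \<mu> x \<longleftrightarrow>
     pos_potential \<kappa> (pos_measure \<mu>) x \<noteq> \<infinity> \<or> pos_potential \<kappa> (neg_measure \<mu>) x \<noteq> \<infinity>"

definition potential ::
    "('a::topological_space \<Rightarrow> 'a \<Rightarrow> ennreal) \<Rightarrow> 'a functional \<Rightarrow> 'a \<Rightarrow> ereal" where
  "potential \<kappa> \<mu> x =
     enn2ereal (pos_potential \<kappa> (pos_measure \<mu>) x) - enn2ereal (pos_potential \<kappa> (neg_measure \<mu>) x)"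

definition product_integral ::
    "('a \<Rightarrow> 'a \<Rightarrow> ennreal) \<Rightarrow> 'a measure \<Rightarrow> 'a measure \<Rightarrow> ennreal" where
  "product_integral \<kappa> M N = (\<integral>\<^sup>+ (x, y). \<kappa> x y \<partial>(M \<Otimes>\<^sub>M N))"

text \<open>The integrals of the kernel over the positive and the negative part of the product of two
  signed measures.\<close>

definition pos_energy ::
    "('a::topological_space \<Rightarrow> 'a \<Rightarrow> ennreal) \<Rightarrow> 'a functional \<Rightarrow> 'a functional \<Rightarrow> ennreal" where
  "pos_energy \<kappa> \<mu> \<nu> =
     product_integral \<kappa> (pos_measure \<mu>) (pos_measure \<nu>) +
     product_integral \<kappa> (neg_measure \<mu>) (neg_measure \<nu>)"

definition neg_energy ::
    "('a::topological_space \<Rightarrow> 'a \<Rightarrow> ennreal) \<Rightarrow> 'a functional \<Rightarrow> 'a functional \<Rightarrow> ennreal" where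
  "neg_energy \<kappa> \<mu> \<nu> =
     product_integral \<kappa> (pos_measure \<mu>) (neg_measure \<nu>) +
     product_integral \<kappa> (neg_measure \<mu>) (pos_measure \<nu>)"

definition energy_defined ::
    "('a::topological_space \<Rightarrow> 'a \<Rightarrow> ennreal) \<Rightarrow> 'a functional \<Rightarrow> 'a functional \<Rightarrow> bool" where
  "energy_defined \<kappa> \<mu> \<nu> \<longleftrightarrow> pos_energy \<kappa> \<mu> \<nu> \<noteq> \<infinity> \<or> neg_energy \<kappa> \<mu> \<nu> \<noteq> \<infinity>"

definition mutual_energy ::
    "('a::topological_space \<Rightarrow> 'a \<Rightarrow> ennreal) \<Rightarrow> 'a functional \<Rightarrow> 'a functional \<Rightarrow> ereal" where
  "mutual_energy \<kappa> \<mu> \<nu> = enn2ereal (pos_energy \<kappa> \<mu> \<nu>) - enn2ereal (neg_energy \<kappa> \<mu> \<nu>)"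

definition finite_energy ::
    "('a::topological_space \<Rightarrow> 'a \<Rightarrow> ennreal) \<Rightarrow> 'a functional set" where
  "finite_energy \<kappa> =
     {\<mu> \<in> signed_measures. energy_defined \<kappa> \<mu> \<mu> \<and> \<bar>mutual_energy \<kappa> \<mu> \<mu>\<bar> \<noteq> \<infinity>}"

definition finite_energy_pos ::
    "('a::topological_space \<Rightarrow> 'a \<Rightarrow> ennreal) \<Rightarrow> 'a functional set" where
  "finite_energy_pos \<kappa> = finite_energy \<kappa> \<inter> positive_measures"

definition energy_norm ::
    "('a::topological_space \<Rightarrow> 'a \<Rightarrow> ennreal) \<Rightarrow> 'a functional \<Rightarrow> real" where
  "energy_norm \<kappa> \<mu> = sqrt (real_of_ereal (mutual_energy \<kappa> \<mu> \<mu>))"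

definition energy_principle :: "('a::topological_space \<Rightarrow> 'a \<Rightarrow> ennreal) \<Rightarrow> bool" where
  "energy_principle \<kappa> \<longleftrightarrow>
     (\<forall>\<mu>\<in>signed_measures. energy_defined \<kappa> \<mu> \<mu> \<longrightarrow>
        0 \<le> mutual_energy \<kappa> \<mu> \<mu> \<and> (mutual_energy \<kappa> \<mu> \<mu> = 0 \<longrightarrow> \<mu> = (\<lambda>f. 0)))"

text \<open>Nets over arbitrary directed sets are rendered by proper filters: a net gives rise to its filter
  of eventually visited sets, and every proper filter arises in this way.\<close>

definition strong_cauchy ::
    "('a::topological_space \<Rightarrow> 'a \<Rightarrow> ennreal) \<Rightarrow> 'a functional filter \<Rightarrow> bool" where
  "strong_cauchy \<kappa> F \<longleftrightarrow>
     (\<forall>e>0. eventually (\<lambda>(\<mu>, \<nu>). energy_norm \<kappa> (\<mu> - \<nu>) < e) (F \<times>\<^sub>F F))"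

definition consistency_principle :: "('a::topological_space \<Rightarrow> 'a \<Rightarrow> ennreal) \<Rightarrow> bool" where
  "consistency_principle \<kappa> \<longleftrightarrow>
     (\<forall>F. F \<noteq> bot \<and> F \<le> principal (finite_energy_pos \<kappa>) \<and> strong_cauchy \<kappa> F \<longrightarrow>
        (\<forall>\<nu>\<in>signed_measures. vague_cluster_point F \<nu> \<longrightarrow>
           \<nu> \<in> finite_energy \<kappa> \<and> ((\<lambda>\<mu>. energy_norm \<kappa> (\<mu> - \<nu>)) \<longlongrightarrow> 0) F))"

definition domination_principle :: "('a::topological_space \<Rightarrow> 'a \<Rightarrow> ennreal) \<Rightarrow> bool" where
  "domination_principle \<kappa> \<longleftrightarrow>
     (\<forall>\<mu>\<in>finite_energy_pos \<kappa>. \<forall>\<nu>\<in>finite_energy_pos \<kappa>.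
        (AE x in pos_measure \<mu>. potential \<kappa> \<mu> x \<le> potential \<kappa> \<nu> x) \<longrightarrow>
        (\<forall>x. potential \<kappa> \<mu> x \<le> potential \<kappa> \<nu> x))"

definition continuous_potentials ::
    "('a::topological_space \<Rightarrow> 'a \<Rightarrow> ennreal) \<Rightarrow> ('a \<Rightarrow> real) set" where
  "continuous_potentials \<kappa> =
     {f \<in> Cc. \<exists>\<nu>\<in>finite_energy \<kappa>.
        \<forall>x. potential_defined \<kappa> \<nu> x \<and> potential \<kappa> \<nu> x = ereal (f x)}"


section \<open>Capacities\<close>

definition concentrated_on :: "'a::topological_space functional \<Rightarrow> 'a set \<Rightarrow> bool" where
  "concentrated_on \<mu> A \<longleftrightarrow>
     (\<forall>K. compact K \<longrightarrow> (\<exists>N\<in>null_sets (pos_measure \<mu>). (- A) \<inter> K \<subseteq> N))"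

definition inner_capacity ::
    "('a::topological_space \<Rightarrow> 'a \<Rightarrow> ennreal) \<Rightarrow> 'a set \<Rightarrow> ereal" where
  "inner_capacity \<kappa> A =
     inverse (INF \<mu>\<in>{\<mu> \<in> finite_energy_pos \<kappa>. concentrated_on \<mu> A \<and> emeasure (pos_measure \<mu>) UNIV = 1}.
       mutual_energy \<kappa> \<mu> \<mu>)"

definition outer_capacity ::
    "('a::topological_space \<Rightarrow> 'a \<Rightarrow> ennreal) \<Rightarrow> 'a set \<Rightarrow> ereal" where
  "outer_capacity \<kappa> A = (INF D\<in>{D. open D \<and> A \<subseteq> D}. inner_capacity \<kappa> D)"

text \<open>\<open>cap\<close> is instantiated with the inner capacity (``nearly everywhere'') or with the outer
  capacity (``quasi-everywhere'').\<close>

definition holds_outside_cap_zero ::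
    "('a set \<Rightarrow> ereal) \<Rightarrow> 'a set \<Rightarrow> ('a \<Rightarrow> bool) \<Rightarrow> bool" where
  "holds_outside_cap_zero cap A P \<longleftrightarrow> (\<exists>N\<subseteq>A. cap N = 0 \<and> (\<forall>x\<in>A - N. P x))"


section \<open>Balayage\<close>

definition balayage_class ::
    "('a::topological_space \<Rightarrow> 'a \<Rightarrow> ennreal) \<Rightarrow> ('a set \<Rightarrow> ereal) \<Rightarrow> 'a set \<Rightarrow> 'a functional
      \<Rightarrow> 'a functional set" where
  "balayage_class \<kappa> cap A \<mu> =
     {\<nu> \<in> finite_energy_pos \<kappa>.
        holds_outside_cap_zero cap A (\<lambda>x. potential \<kappa> \<mu> x \<le> potential \<kappa> \<nu> x)}"

definition is_balayage ::
    "('a::topological_space \<Rightarrow> 'a \<Rightarrow> ennreal) \<Rightarrow> ('a set \<Rightarrow> ereal) \<Rightarrow> 'a set \<Rightarrow> 'a functional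
      \<Rightarrow> 'a functional \<Rightarrow> bool" where
  "is_balayage \<kappa> cap A \<mu> \<nu> \<longleftrightarrow>
     \<nu> \<in> balayage_class \<kappa> cap A \<mu> \<and>
     (\<forall>\<nu>'\<in>balayage_class \<kappa> cap A \<mu>. \<forall>x. potential \<kappa> \<nu> x \<le> potential \<kappa> \<nu>' x)"

definition balayage ::
    "('a::topological_space \<Rightarrow> 'a \<Rightarrow> ennreal) \<Rightarrow> ('a set \<Rightarrow> ereal) \<Rightarrow> 'a set \<Rightarrow> 'a functional
      \<Rightarrow> 'a functional" where
  "balayage \<kappa> cap A \<mu> =
     (THE \<nu>. is_balayage \<kappa> cap A (pos_part \<mu>) \<nu>) - (THE \<nu>. is_balayage \<kappa> cap A (neg_part \<mu>) \<nu>)"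

definition balayage_exists ::
    "('a::topological_space \<Rightarrow> 'a \<Rightarrow> ennreal) \<Rightarrow> ('a set \<Rightarrow> ereal) \<Rightarrow> 'a set \<Rightarrow> 'a functional
      \<Rightarrow> bool" where
  "balayage_exists \<kappa> cap A \<mu> \<longleftrightarrow>
     (\<exists>!\<nu>. is_balayage \<kappa> cap A (pos_part \<mu>) \<nu>) \<and> (\<exists>!\<nu>. is_balayage \<kappa> cap A (neg_part \<mu>) \<nu>)"

abbreviation inner_balayage ::
    "('a::topological_space \<Rightarrow> 'a \<Rightarrow> ennreal) \<Rightarrow> 'a set \<Rightarrow> 'a functional \<Rightarrow> 'a functional" where
  "inner_balayage \<kappa> \<equiv> balayage \<kappa> (inner_capacity \<kappa>)"

abbreviation outer_balayage ::
    "('a::topological_space \<Rightarrow> 'a \<Rightarrow> ennreal) \<Rightarrow> 'a set \<Rightarrow> 'a functional \<Rightarrow> 'a functional" where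
  "outer_balayage \<kappa> \<equiv> balayage \<kappa> (outer_capacity \<kappa>)"

abbreviation outer_balayage_exists ::
    "('a::topological_space \<Rightarrow> 'a \<Rightarrow> ennreal) \<Rightarrow> 'a set \<Rightarrow> 'a functional \<Rightarrow> bool" where
  "outer_balayage_exists \<kappa> \<equiv> balayage_exists \<kappa> (outer_capacity \<kappa>)"

definition K_sigma :: "'a::topological_space set \<Rightarrow> bool" where
  "K_sigma A \<longleftrightarrow> (\<exists>K::nat \<Rightarrow> 'a set. (\<forall>n. compact (K n)) \<and> A = (\<Union>n. K n))"

end

theory Submission
  imports Defs
begin

text \<open>All positive measures of finite energy form a cone \<open>E\<close> on which the mutual energy is a positive
  definite form, by the energy principle. By the consistency principle this cone is strongly complete:
  energies bound the masses of compact sets, so a strong Cauchy sequence is vaguely relatively compact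
  (Tychonoff and the Riesz representation theorem), and it converges strongly to its vague cluster
  points (\<open>strongly_complete\<close>). Convex minimization is therefore available in \<open>E\<close>, although
  the space of signed measures of finite energy is in general incomplete.

  A set has inner capacity zero iff it carries no nonzero measure of finite energy. Hence the
  inequality \<open>\<kappa>\<nu> \<ge> \<kappa>\<mu>\<close> holds nearly everywhere on \<open>A\<close> iff \<open>\<kappa>(\<nu>, \<tau>) \<ge> \<kappa>(\<mu>, \<tau>)\<close> for all \<open>\<tau>\<close> in the cone
  \<open>E\<^sub>A\<close> of the measures in \<open>E\<close> carried by \<open>A\<close> (\<open>inner_exception_iff\<close>). So the class in
  which the inner balayage is minimal depends only on the strong closure of \<open>E\<^sub>A\<close>.

  This closure is already determined by a countable union of compact sets. Over a second countable
  space the vague topology on measures is second countable, so each bounded part of \<open>E\<^sub>A\<close> has a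
  vaguely dense countable subset. Suitable convex combinations of a bounded, vaguely convergent sequence
  are strongly Cauchy, and by completeness they converge strongly to the vague limit. Thus convex
  combinations of countably many measures are strongly dense in \<open>E\<^sub>A\<close>; each of these measures is carried
  by a countable union of compact subsets of \<open>A\<close>, and \<open>A0\<close> is the union of all these sets
  (\<open>strongly_dense_K_sigma\<close>). For \<open>A0 \<subseteq> Q \<subseteq> A\<close> the cones of \<open>A0\<close>, \<open>Q\<close> and \<open>A\<close> have the same strong closure,
  which gives the equality of the inner balayages. The minimal measure exists as the strong limit of the
  projections of \<open>\<mu>\<close> onto the cones of an exhausting sequence of compact subsets of \<open>A0\<close>; the domination
  principle turns inequalities almost everywhere into inequalities everywhere (\<open>minimal_sweep\<close>).

  For the outer balayage to a Borel set \<open>B\<close> it remains to see that the Borel set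
  \<open>{x \<in> B. \<kappa>\<nu>(x) < \<kappa>\<mu>(x)}\<close> of inner capacity zero has outer capacity zero. To this end the proof uses
  the capacity \<open>sweep_capacity \<mu>\<close>, the infimum of the energies of those \<open>\<nu>\<close> that satisfy \<open>\<kappa>\<nu> \<ge> \<kappa>\<mu>\<close> nearly
  everywhere on some open set containing the given set. It is continuous along increasing sequences of
  sets, its value at a compact set is approached along open neighbourhoods, and it vanishes on compact sets
  of inner capacity zero. Choquet's capacitability theorem (\<open>capacitability\<close>, proved with Dellacherie's
  scrapers) extends the last property to Borel sets. A set on which \<open>\<kappa>\<mu> > 0\<close> and
  whose \<open>sweep_capacity \<mu>\<close> is zero has outer capacity zero (\<open>outer_capacity_zero\<close>).\<close>

section \<open>Compactly supported functions\<close>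

lemma compact_closure_subset: "compact K \<Longrightarrow> closure S \<subseteq> K \<Longrightarrow> compact (closure S)"
  by (metis closed_closure compact_Int_closed inf.absorb_iff2)

lemma CcI:
  assumes "continuous_on UNIV f" "compact K" "\<And>x. x \<notin> K \<Longrightarrow> f x = 0"
  shows "f \<in> (Cc :: ('a::t2_space \<Rightarrow> real) set)"
proof -
  have "closure {x. f x \<noteq> 0} \<subseteq> K"
    using assms(3) by (intro closure_minimal compact_imp_closed[OF assms(2)]) blast
  then have "compact (closure {x. f x \<noteq> 0})"
    by (rule compact_closure_subset[OF assms(2)])
  then show ?thesis using assms(1) by (simp add: Cc_def)
qed

lemma Cc_continuous: "f \<in> Cc \<Longrightarrow> continuous_on UNIV f"
  and Cc_support: "f \<in> Cc \<Longrightarrow> compact (closure {x. f x \<noteq> 0})"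
  by (auto simp: Cc_def)

lemma Cc_obtain_compact:
  assumes "f \<in> Cc"
  obtains K where "compact K" "\<And>x. x \<notin> K \<Longrightarrow> f x = 0"
  using Cc_support[OF assms] closure_subset by (metis (mono_tags, lifting) mem_Collect_eq subsetD)

lemma Cc_bounded:
  fixes f :: "'a::t2_space \<Rightarrow> real"
  assumes "f \<in> Cc"
  obtains C where "C > 0" "\<And>x. \<bar>f x\<bar> \<le> C"
proof -
  obtain K where K: "compact K" "\<And>x. x \<notin> K \<Longrightarrow> f x = 0"
    using Cc_obtain_compact[OF assms] by blast
  have "compact (f ` K)"
    using K(1) Cc_continuous[OF assms] by (meson compact_continuous_image continuous_on_subset top_greatest)
  then obtain B where B: "\<And>x. x \<in> K \<Longrightarrow> \<bar>f x\<bar> \<le> B"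
    using compact_imp_bounded bounded_iff by (metis imageI real_norm_def)
  have "\<bar>f x\<bar> \<le> max 1 B" for x
    using K(2)[of x] B[of x] by (cases "x \<in> K") auto
  then show thesis using that[of "max 1 B"] by auto
qed

lemma Cc_zero: "(\<lambda>x. 0) \<in> (Cc :: ('a::t2_space \<Rightarrow> real) set)"
  by (rule CcI[of _ "{}"]) auto

lemma Cc_binop:
  fixes f g :: "'a::t2_space \<Rightarrow> real"
  assumes "f \<in> Cc" "g \<in> Cc" "continuous_on UNIV (\<lambda>x. h (f x) (g x))" "h 0 0 = 0"
  shows "(\<lambda>x. h (f x) (g x)) \<in> Cc"
proof -
  obtain K where K: "compact K" "\<And>x. x \<notin> K \<Longrightarrow> f x = 0"
    using Cc_obtain_compact[OF assms(1)] by blast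
  obtain L where L: "compact L" "\<And>x. x \<notin> L \<Longrightarrow> g x = 0"
    using Cc_obtain_compact[OF assms(2)] by blast
  show ?thesis
    by (rule CcI[of _ "K \<union> L"]) (use K L assms in auto)
qed

lemma Cc_add: "f \<in> Cc \<Longrightarrow> g \<in> Cc \<Longrightarrow> (\<lambda>x. f x + g x) \<in> (Cc :: ('a::t2_space \<Rightarrow> real) set)"
  using Cc_binop[of f g "(+)"] by (simp add: continuous_on_add Cc_continuous)

lemma Cc_max: "f \<in> Cc \<Longrightarrow> g \<in> Cc \<Longrightarrow> (\<lambda>x. max (f x) (g x)) \<in> (Cc :: ('a::t2_space \<Rightarrow> real) set)"
  using Cc_binop[of f g max] by (simp add: continuous_on_max Cc_continuous)

lemma Cc_cmult: "f \<in> Cc \<Longrightarrow> (\<lambda>x. c * f x) \<in> (Cc :: ('a::t2_space \<Rightarrow> real) set)"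
  by (rule CcI[of _ "closure {x. f x \<noteq> 0}"])
    (use closure_subset[of "{x. f x \<noteq> 0}"] in \<open>auto intro: continuous_on_mult_left Cc_continuous Cc_support\<close>)

lemma Cc_measurable: "f \<in> Cc \<Longrightarrow> f \<in> borel_measurable borel"
  by (simp add: Cc_continuous borel_measurable_continuous_onI)

lemma Hausdorff_euclidean: "Hausdorff_space (euclidean :: 'a::t2_space topology)"
  using hausdorff by (auto simp: Hausdorff_space_def disjnt_def)

text \<open>The type argument only selects the space; it lets facts about it be stated without further data.\<close>

locale lcsc_space =
  fixes ty :: "'a::{t2_space, second_countable_topology} itself"
  assumes locally_compact: "locally_compact_space (euclidean :: 'a topology)"
begin

lemma relatively_compact_neighbourhood:
  fixes K U :: "'a set"
  assumes "compact K" "open U" "K \<subseteq> U"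
  obtains V where "open V" "K \<subseteq> V" "compact (closure V)" "closure V \<subseteq> U"
proof -
  have nb: "neighbourhood_base_of (\<lambda>C. compactin euclidean C \<and> closedin euclidean C) (euclidean::'a topology)"
    using locally_compact locally_compact_space_neighbourhood_base_closedin[of "euclidean :: 'a topology"]
    using Hausdorff_euclidean[where 'a = 'a] by blast
  have "\<forall>x\<in>K. \<exists>W C. open W \<and> compact C \<and> x \<in> W \<and> W \<subseteq> C \<and> C \<subseteq> U"
    using nb assms(2,3) unfolding neighbourhood_base_of
    by (metis compactin_euclidean_iff open_openin subsetD)
  then obtain W C where W: "\<And>x. x \<in> K \<Longrightarrow> open (W x) \<and> compact (C x) \<and> x \<in> W x \<and> W x \<subseteq> C x \<and> C x \<subseteq> U"
    by metis
  have "K \<subseteq> (\<Union>x\<in>K. W x)" using W by blast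
  then obtain T where T: "T \<subseteq> K" "finite T" "K \<subseteq> (\<Union>x\<in>T. W x)"
    by (rule compactE_image[OF assms(1), of K W, rotated]) (use W in auto)
  define V where "V = (\<Union>x\<in>T. W x)"
  have comp: "compact (\<Union>x\<in>T. C x)" using T W by (intro compact_UN) auto
  have sub: "closure V \<subseteq> (\<Union>x\<in>T. C x)"
    unfolding V_def using T W by (intro closure_minimal compact_imp_closed[OF comp]) blast
  show thesis
  proof (rule that[of V])
    show "open V" unfolding V_def using T W by auto
    show "K \<subseteq> V" using T V_def by blast
    show "compact (closure V)"
      by (rule compact_closure_subset[OF comp sub])
    show "closure V \<subseteq> U" using sub T W by blast
  qed
qed

text \<open>Urysohn's lemma, applied to a relatively compact open set between \<open>K\<close> and \<open>U\<close>.\<close>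

lemma bump_function:
  fixes K U :: "'a set"
  assumes "compact K" "open U" "K \<subseteq> U"
  obtains g where "g \<in> Cc" "\<And>x. 0 \<le> g x" "\<And>x. g x \<le> 1" "\<And>x. x \<in> K \<Longrightarrow> g x = 1"
    "compact (closure {x. g x \<noteq> 0})" "closure {x. g x \<noteq> 0} \<subseteq> U"
proof -
  obtain V where V: "open V" "K \<subseteq> V" "compact (closure V)" "closure V \<subseteq> U"
    using relatively_compact_neighbourhood[OF assms] .
  have cr: "completely_regular_space (euclidean :: 'a topology)"
    using locally_compact Hausdorff_euclidean
    by (intro locally_compact_regular_imp_completely_regular_space) auto
  obtain g where g: "continuous_map (euclidean :: 'a topology) (top_of_set {0..1::real}) g"
    "g ` (- V) \<subseteq> {0}" "g ` K \<subseteq> {1}"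
    using Urysohn_completely_regular_compact_closed[OF _ cr, of 0 1 K "- V"] assms(1) V(1,2)
    by (auto simp: disjnt_def)
  have cont: "continuous_on UNIV g" "\<And>x. 0 \<le> g x" "\<And>x. g x \<le> 1"
    using g(1) by (auto simp: continuous_map_in_subtopology image_subset_iff)
  have supp: "closure {x. g x \<noteq> 0} \<subseteq> closure V"
    using g(2) by (intro closure_mono) auto
  show thesis
  proof (rule that[of g])
    show "compact (closure {x. g x \<noteq> 0})"
      by (rule compact_closure_subset[OF V(3) supp])
    then show "g \<in> Cc" using cont by (simp add: Cc_def)
  qed (use cont supp V g in auto)
qed

lemma compact_exhaustion:
  obtains K :: "nat \<Rightarrow> 'a set" where "\<And>n. compact (K n)" "incseq K"
    "\<And>L. compact L \<Longrightarrow> \<exists>n. L \<subseteq> K n" "(\<Union>n. K n) = UNIV"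
proof -
  obtain B :: "'a set set" where B: "countable B" "topological_basis B"
    using ex_countable_basis by blast
  define B' where "B' = insert {} {V \<in> B. compact (closure V)}"
  have "countable B'" using B(1) by (simp add: B'_def)
  define V where "V = from_nat_into B'"
  have V: "V n \<in> B'" for n
    unfolding V_def by (rule from_nat_into) (simp add: B'_def)
  have Vop: "open (V n)" and Vc: "compact (closure (V n))" for n
    using V[of n] B(2) by (auto simp: B'_def topological_basis_open)
  have cover: "\<exists>n. x \<in> V n" for x
  proof -
    obtain W where W: "open W" "{x} \<subseteq> W" "compact (closure W)"
      by (rule relatively_compact_neighbourhood[OF compact_sing[of x] open_UNIV subset_UNIV])
    obtain b where b: "b \<in> B" "x \<in> b" "b \<subseteq> W"
      using W by (meson B(2) insert_subset topological_basisE)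
    have "compact (closure b)"
      by (rule compact_closure_subset[OF W(3) closure_mono[OF b(3)]])
    then have "b \<in> B'" using b by (simp add: B'_def)
    then show ?thesis using b(2) \<open>countable B'\<close> unfolding V_def by (metis from_nat_into_surj)
  qed
  define K where "K n = (\<Union>i\<le>n. closure (V i))" for n
  show thesis
  proof (rule that[of K])
    show "compact (K n)" for n unfolding K_def using Vc by (intro compact_UN) auto
    show "incseq K" unfolding K_def by (intro incseq_SucI UN_mono) auto
    show "(\<Union>n. K n) = UNIV"
      using cover closure_subset unfolding K_def by fastforce
    show "\<exists>n. L \<subseteq> K n" if L: "compact L" for L
    proof -
      have "L \<subseteq> (\<Union>n\<in>UNIV. V n)" using cover by blast
      then obtain T where T: "finite T" "L \<subseteq> (\<Union>n\<in>T. V n)"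
        by (rule compactE_image[OF L, of UNIV V, rotated]) (use Vop in auto)
      obtain m where m: "\<forall>n\<in>T. n \<le> m" using T(1) finite_nat_set_iff_bounded_le by blast
      have "V n \<subseteq> K m" if "n \<in> T" for n
        using closure_subset[of "V n"] m that unfolding K_def by blast
      then have "L \<subseteq> K m" using T(2) by blast
      then show ?thesis ..
    qed
  qed
qed

text \<open>The bumps are indexed by pairs of basic open sets, one relatively compact in the other, and lists
  of such pairs index their finite maxima.\<close>

lemma countable_bump_family:
  obtains G :: "('a \<Rightarrow> real) set" where "countable G" "G \<subseteq> Cc" "(\<lambda>x. 0) \<in> G"
    "\<And>g x. g \<in> G \<Longrightarrow> 0 \<le> g x \<and> g x \<le> 1"
    "\<And>g h. g \<in> G \<Longrightarrow> h \<in> G \<Longrightarrow> (\<lambda>x. max (g x) (h x)) \<in> G"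
    "\<And>U x. open U \<Longrightarrow> x \<in> U \<Longrightarrow> \<exists>g\<in>G. g x = 1 \<and> {x. g x \<noteq> 0} \<subseteq> U"
proof -
  obtain B :: "'a set set" where B: "countable B" "topological_basis B"
    using ex_countable_basis by blast
  define P where "P = {(V, W) \<in> B \<times> B. compact (closure V) \<and> closure V \<subseteq> W}"
  have "countable P" unfolding P_def
    by (rule countable_subset[of _ "B \<times> B"]) (use B(1) in auto)
  have "\<exists>g. g \<in> Cc \<and> (\<forall>x. 0 \<le> g x \<and> g x \<le> 1) \<and> (\<forall>x\<in>closure (fst p). g x = 1) \<and> {x. g x \<noteq> 0} \<subseteq> snd p"
    if "p \<in> P" for p
  proof -
    have p: "compact (closure (fst p))" "open (snd p)" "closure (fst p) \<subseteq> snd p"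
      using that B(2) by (auto simp: P_def topological_basis_open)
    obtain g where "g \<in> Cc" "\<And>x. 0 \<le> g x" "\<And>x. g x \<le> 1" "\<And>x. x \<in> closure (fst p) \<Longrightarrow> g x = 1"
      "closure {x. g x \<noteq> 0} \<subseteq> snd p"
      using bump_function[OF p] by metis
    then show ?thesis using closure_subset[of "{x. g x \<noteq> 0}"] by (intro exI[of _ g]) auto
  qed
  then obtain b where b: "\<And>p. p \<in> P \<Longrightarrow> b p \<in> Cc" "\<And>p x. p \<in> P \<Longrightarrow> 0 \<le> b p x \<and> b p x \<le> 1"
    "\<And>p x. p \<in> P \<Longrightarrow> x \<in> closure (fst p) \<Longrightarrow> b p x = 1" "\<And>p. p \<in> P \<Longrightarrow> {x. b p x \<noteq> 0} \<subseteq> snd p"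
    by metis
  \<comment> \<open>the value 0 for the empty list is harmless because all bumps are nonnegative\<close>
  define h where "h ps x = foldr max (map (\<lambda>p. b p x) ps) (0::real)" for ps x
  define G where "G = h ` lists P"
  have h_simps: "h [] = (\<lambda>x. 0)" "h (p # ps) = (\<lambda>x. max (b p x) (h ps x))" for p ps
    by (auto simp: h_def)
  have range: "0 \<le> h ps x \<and> h ps x \<le> 1" if "ps \<in> lists P" for ps x
    using that by (induction ps) (use b(2) in \<open>auto simp: h_simps max_def\<close>)
  have hCc: "h ps \<in> Cc" if "ps \<in> lists P" for ps
    using that by (induction ps) (auto simp: h_simps intro: Cc_zero Cc_max b)
  have app: "h (ps @ qs) = (\<lambda>x. max (h ps x) (h qs x))" if "ps \<in> lists P" "qs \<in> lists P" for ps qs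
    using that by (induction ps) (auto simp: h_simps range max_absorb2 max.assoc)
  show thesis
  proof (rule that[of G])
    show "countable G" unfolding G_def using \<open>countable P\<close> by (intro countable_image countable_lists)
    show "G \<subseteq> Cc" using hCc G_def by auto
    show "(\<lambda>x. 0) \<in> G" unfolding G_def by (rule image_eqI[of _ _ "[]"]) (simp_all add: h_simps)
    show "0 \<le> g x \<and> g x \<le> 1" if "g \<in> G" for g x using that range unfolding G_def by blast
    show "(\<lambda>x. max (g x) (g' x)) \<in> G" if gG: "g \<in> G" "g' \<in> G" for g g'
    proof -
      obtain ps qs where "ps \<in> lists P" "qs \<in> lists P" "g = h ps" "g' = h qs"
        using gG unfolding G_def by blast
      then show ?thesis unfolding G_def by (intro image_eqI[of _ _ "ps @ qs"]) (simp_all add: app)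
    qed
    show "\<exists>g\<in>G. g x = 1 \<and> {x. g x \<noteq> 0} \<subseteq> U" if U: "open U" "x \<in> U" for U x
    proof -
      obtain W where W: "W \<in> B" "x \<in> W" "W \<subseteq> U"
        using U by (meson B(2) topological_basisE)
      obtain Y where Y: "open Y" "{x} \<subseteq> Y" "compact (closure Y)" "closure Y \<subseteq> W"
        by (rule relatively_compact_neighbourhood[OF compact_sing[of x], of W])
          (use W(1,2) topological_basis_open[OF B(2)] in simp_all)
      obtain V where V: "V \<in> B" "x \<in> V" "V \<subseteq> Y"
        using Y by (meson B(2) insert_subset topological_basisE)
      have cl: "closure V \<subseteq> closure Y" by (rule closure_mono[OF V(3)])
      have "compact (closure V)"
        using Y(3) cl by (rule compact_closure_subset)
      then have VW: "(V, W) \<in> P"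
        using V(1) W(1) Y(4) cl by (auto simp: P_def)
      have "h [(V, W)] = b (V, W)"
        using b(2)[OF VW] by (auto simp: h_simps max_absorb1 fun_eq_iff)
      then have "b (V, W) \<in> G"
        unfolding G_def using VW by (intro image_eqI[of _ _ "[(V, W)]"]) simp_all
      moreover have "x \<in> closure V" using V(2) closure_subset[of V] by blast
      ultimately show ?thesis using b(3,4)[OF VW] W(3) by (intro bexI[of _ "b (V, W)"]) auto
    qed
  qed
qed

end

section \<open>Locally finite Borel measures\<close>

definition locally_finite_measure :: "'a::topological_space measure \<Rightarrow> bool" where
  "locally_finite_measure M \<longleftrightarrow> sets M = sets borel \<and> (\<forall>K. compact K \<longrightarrow> emeasure M K < \<infinity>)"

lemma locally_finite_sets: "locally_finite_measure M \<Longrightarrow> sets M = sets borel"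
  and locally_finite_space: "locally_finite_measure M \<Longrightarrow> space M = UNIV"
  and locally_finite_compact: "locally_finite_measure M \<Longrightarrow> compact K \<Longrightarrow> emeasure M K < \<infinity>"
  by (auto simp: locally_finite_measure_def dest: sets_eq_imp_space_eq)

lemma compact_borel: "compact K \<Longrightarrow> K \<in> sets (borel :: 'a::t2_space measure)"
  by (simp add: compact_imp_closed borel_closed)

lemma Cc_integrable:
  fixes f :: "'a::t2_space \<Rightarrow> real"
  assumes "locally_finite_measure M" "f \<in> Cc"
  shows "integrable M f"
proof -
  obtain K where K: "compact K" "\<And>x. x \<notin> K \<Longrightarrow> f x = 0"
    using Cc_obtain_compact[OF assms(2)] by blast
  obtain C where C: "\<And>x. \<bar>f x\<bar> \<le> C" using Cc_bounded[OF assms(2)] by blast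
  have "f \<in> borel_measurable M"
    using Cc_measurable[OF assms(2)] measurable_cong_sets[OF locally_finite_sets[OF assms(1)] refl]
    by blast
  then show ?thesis
    by (intro integrableI_bounded_set[of K M f C])
      (use K C assms(1) in \<open>auto simp: locally_finite_measure_def compact_borel\<close>)
qed

lemma integral_Cc_eq_nn:
  fixes f :: "'a::t2_space \<Rightarrow> real"
  assumes "locally_finite_measure M" "f \<in> Cc" "\<And>x. 0 \<le> f x"
  shows "(\<integral>\<^sup>+x. ennreal (f x) \<partial>M) = ennreal (\<integral>x. f x \<partial>M)"
  using Cc_integrable[OF assms(1,2)] assms(3) by (intro nn_integral_eq_integral) auto

lemma radon_imp_locally_finite: "radon_measure M \<Longrightarrow> locally_finite_measure M"
  by (simp add: radon_measure_def locally_finite_measure_def)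

context lcsc_space
begin

lemma open_exhaustion:
  obtains V :: "nat \<Rightarrow> 'a set" where "\<And>n. open (V n)" "\<And>n. compact (closure (V n))" "incseq V"
    "(\<Union>n. V n) = UNIV"
proof -
  obtain K :: "nat \<Rightarrow> 'a set" where K: "\<And>n. compact (K n)" "incseq K"
    "\<And>L. compact L \<Longrightarrow> \<exists>n. L \<subseteq> K n"
    using compact_exhaustion by metis
  show thesis
  proof (rule that[of "\<lambda>n. interior (K n)"])
    show "compact (closure (interior (K n)))" for n
      by (rule compact_closure_subset[OF K(1)[of n]])
        (simp add: closure_minimal compact_imp_closed K(1) interior_subset)
    show "incseq (\<lambda>n. interior (K n))" using K(2) by (simp add: incseq_def interior_mono)
    have "\<exists>n. x \<in> interior (K n)" for x
    proof -
      obtain W where W: "open W" "{x} \<subseteq> W" "compact (closure W)" "closure W \<subseteq> UNIV"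
        by (rule relatively_compact_neighbourhood[OF compact_sing[of x] open_UNIV subset_UNIV])
      obtain n where "closure W \<subseteq> K n" using K(3) W(3) by blast
      then have "W \<subseteq> interior (K n)" using W(1) closure_subset[of W] by (intro interior_maximal) auto
      then show ?thesis using W(2) by auto
    qed
    then show "(\<Union>n. interior (K n)) = UNIV" by auto
  qed auto
qed

lemma locally_finite_sigma_finite:
  fixes M :: "'a measure"
  assumes "locally_finite_measure M"
  shows "sigma_finite_measure M"
proof
  obtain K :: "nat \<Rightarrow> 'a set" where K: "\<And>n. compact (K n)" "(\<Union>n. K n) = UNIV"
    using compact_exhaustion by metis
  show "\<exists>A. countable A \<and> A \<subseteq> sets M \<and> \<Union> A = space M \<and> (\<forall>a\<in>A. emeasure M a \<noteq> \<infinity>)"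
    using K assms by (intro exI[of _ "range K"])
      (auto simp: locally_finite_measure_def compact_borel locally_finite_space[OF assms] less_top)
qed

lemma measure_eq_of_open:
  fixes M N :: "'a measure"
  assumes M: "locally_finite_measure M" and N: "locally_finite_measure N"
    and eq: "\<And>U. open U \<Longrightarrow> emeasure M U = emeasure N U"
  shows "M = N"
proof -
  obtain V :: "nat \<Rightarrow> 'a set" where V: "\<And>n. open (V n)" "\<And>n. compact (closure (V n))" "(\<Union>n. V n) = UNIV"
    using open_exhaustion by metis
  have fin: "emeasure M (V n) \<noteq> \<infinity>" for n
    using emeasure_mono[OF closure_subset, of "V n" M] locally_finite_compact[OF M V(2)[of n]]
      locally_finite_sets[OF M] by (auto simp: less_top[symmetric] top_unique)
  show ?thesis
    by (rule measure_eqI_generator_eq[where E = "Collect open" and \<Omega> = UNIV and A = V])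
      (use V fin eq locally_finite_sets[OF M] locally_finite_sets[OF N] in \<open>auto simp: Int_stable_def borel_def\<close>)
qed

text \<open>A countable family of bump functions, closed under maxima, separates Borel measures: the
  members with support in an open set \<open>U\<close> increase, after passing to maxima, to the indicator of \<open>U\<close>.\<close>

lemma countable_determining_family:
  obtains G :: "('a \<Rightarrow> real) set" where "countable G" "G \<subseteq> Cc" "\<And>g x. g \<in> G \<Longrightarrow> 0 \<le> g x"
    "\<And>M N. locally_finite_measure M \<Longrightarrow> locally_finite_measure N \<Longrightarrow>
      (\<And>g. g \<in> G \<Longrightarrow> (\<integral>x. g x \<partial>M) = (\<integral>x. g x \<partial>N)) \<Longrightarrow> M = N"
proof -
  obtain G :: "('a \<Rightarrow> real) set" where G: "countable G" "G \<subseteq> Cc" "(\<lambda>x. 0) \<in> G"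
    "\<And>g x. g \<in> G \<Longrightarrow> 0 \<le> g x \<and> g x \<le> 1"
    "\<And>g h. g \<in> G \<Longrightarrow> h \<in> G \<Longrightarrow> (\<lambda>x. max (g x) (h x)) \<in> G"
    "\<And>U x. open U \<Longrightarrow> x \<in> U \<Longrightarrow> \<exists>g\<in>G. g x = 1 \<and> {x. g x \<noteq> 0} \<subseteq> U"
    by (rule countable_bump_family) blast
  have approx: "\<exists>f. (\<forall>n. f n \<in> G) \<and> incseq f \<and> (\<forall>x. (SUP n. ennreal (f n x)) = indicator U x)"
    if U: "open U" for U
  proof -
    define GU where "GU = {g \<in> G. {x. g x \<noteq> 0} \<subseteq> U}"
    have cGU: "countable GU" using G(1) by (simp add: GU_def)
    have z: "(\<lambda>x. 0) \<in> GU" using G(3) by (simp add: GU_def)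
    have mx: "(\<lambda>x. max (g x) (h x)) \<in> GU" if "g \<in> GU" "h \<in> GU" for g h
      using that G(5)[of g h] by (auto simp: GU_def subset_iff max_def)
    define e where "e = from_nat_into GU"
    have e: "e n \<in> GU" for n unfolding e_def using z by (intro from_nat_into) auto
    define f where "f = rec_nat (e 0) (\<lambda>n h x. max (h x) (e (Suc n) x))"
    have f0: "f 0 = e 0" and fS: "f (Suc n) = (\<lambda>x. max (f n x) (e (Suc n) x))" for n
      by (auto simp: f_def)
    have fGU: "f n \<in> GU" for n
      by (induction n) (auto simp: f0 fS e intro: mx)
    have ef: "e n x \<le> f n x" for n x by (cases n) (auto simp: f0 fS)
    have "(SUP n. ennreal (f n x)) = indicator U x" for x
    proof (cases "x \<in> U")
      case True
      then obtain g where g: "g \<in> GU" "g x = 1" using G(6)[OF U True] by (auto simp: GU_def)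
      then obtain n where n: "e n = g" unfolding e_def using cGU by (metis from_nat_into_surj)
      show ?thesis
      proof (rule antisym)
        show "(SUP n. ennreal (f n x)) \<le> indicator U x"
          using True fGU G(4) by (intro SUP_least) (auto simp: GU_def)
        have "1 \<le> f n x" using ef[of n x] n g by simp
        then have "1 \<le> ennreal (f n x)" using ennreal_leI[of 1 "f n x"] by simp
        also have "\<dots> \<le> (SUP n. ennreal (f n x))" by (rule SUP_upper) simp
        finally show "indicator U x \<le> (SUP n. ennreal (f n x))" using True by simp
      qed
    next
      case False
      then have "f n x = 0" for n using fGU[of n] by (auto simp: GU_def)
      then show ?thesis using False by simp
    qed
    moreover have "incseq f" by (rule incseq_SucI) (auto simp: fS le_fun_def)
    ultimately show ?thesis using fGU by (auto simp: GU_def)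
  qed
  show thesis
  proof (rule that[OF G(1,2)])
    show "0 \<le> g x" if "g \<in> G" for g x using G(4)[OF that] by simp
  next
    fix M N :: "'a measure"
    assume M: "locally_finite_measure M" and N: "locally_finite_measure N"
      and eq: "\<And>g. g \<in> G \<Longrightarrow> (\<integral>x. g x \<partial>M) = (\<integral>x. g x \<partial>N)"
    show "M = N"
    proof (rule measure_eq_of_open[OF M N])
      fix U :: "'a set" assume U: "open U"
      obtain f where f: "\<And>n. f n \<in> G" "incseq f" "\<And>x. (SUP n. ennreal (f n x)) = indicator U x"
        using approx[OF U] by metis
      have "emeasure L U = (SUP n. ennreal (\<integral>x. f n x \<partial>L))" if L: "locally_finite_measure L" for L
      proof -
        have [measurable]: "f n \<in> borel_measurable L" for n
          using f(1) G(2) Cc_measurable measurable_cong_sets[OF locally_finite_sets[OF L] refl] by blast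
        have "emeasure L U = (\<integral>\<^sup>+x. indicator U x \<partial>L)"
          using U locally_finite_sets[OF L] by simp
        also have "\<dots> = (\<integral>\<^sup>+x. (SUP n. ennreal (f n x)) \<partial>L)" by (simp add: f(3))
        also have "\<dots> = (SUP n. \<integral>\<^sup>+x. ennreal (f n x) \<partial>L)"
          using f(2) by (intro nn_integral_monotone_convergence_SUP)
            (auto simp: incseq_def le_fun_def intro: ennreal_leI)
        also have "\<dots> = (SUP n. ennreal (\<integral>x. f n x \<partial>L))"
          using f(1) G(2,4) by (subst integral_Cc_eq_nn[OF L]) auto
        finally show ?thesis .
      qed
      then show "emeasure M U = emeasure N U" using M N eq f(1) by simp
    qed
  qed
qed

lemma measure_eq_of_Cc:
  fixes M N :: "'a measure"
  assumes "locally_finite_measure M" "locally_finite_measure N"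
    "\<And>f. f \<in> Cc \<Longrightarrow> (\<And>x. 0 \<le> f x) \<Longrightarrow> (\<integral>x. f x \<partial>M) = (\<integral>x. f x \<partial>N)"
  shows "M = N"
proof -
  obtain G :: "('a \<Rightarrow> real) set" where G: "countable G" "G \<subseteq> Cc" "\<And>g x. g \<in> G \<Longrightarrow> 0 \<le> g x"
    "\<And>M N. locally_finite_measure M \<Longrightarrow> locally_finite_measure N \<Longrightarrow>
      (\<And>g. g \<in> G \<Longrightarrow> (\<integral>x. g x \<partial>M) = (\<integral>x. g x \<partial>N)) \<Longrightarrow> M = N"
    by (rule countable_determining_family) blast
  show ?thesis by (rule G(4)[OF assms(1,2)]) (use G(2,3) assms(3) in blast)
qed

end

section \<open>The representation theorem for positive functionals\<close>

locale positive_functional = lcsc_space ty for ty :: "'a::{t2_space, second_countable_topology} itself" +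
  fixes \<phi> :: "('a \<Rightarrow> real) \<Rightarrow> real"
  assumes positive: "\<And>f. f \<in> Cc \<Longrightarrow> (\<And>x. 0 \<le> f x) \<Longrightarrow> 0 \<le> \<phi> f"
    and add: "\<And>f g. f \<in> Cc \<Longrightarrow> g \<in> Cc \<Longrightarrow> \<phi> (\<lambda>x. f x + g x) = \<phi> f + \<phi> g"
    and cmult: "\<And>c f. f \<in> Cc \<Longrightarrow> \<phi> (\<lambda>x. c * f x) = c * \<phi> f"
begin

lemma diff: "f \<in> Cc \<Longrightarrow> g \<in> Cc \<Longrightarrow> \<phi> (\<lambda>x. f x - g x) = \<phi> f - \<phi> g"
  using add[of f "\<lambda>x. - 1 * g x"] cmult[of g "- 1"] Cc_cmult[of g "- 1"] by simp

lemma Cc_diff: "f \<in> Cc \<Longrightarrow> g \<in> Cc \<Longrightarrow> (\<lambda>x. f x - g x) \<in> (Cc :: ('a \<Rightarrow> real) set)"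
  using Cc_add[of f "\<lambda>x. - 1 * g x"] Cc_cmult[of g "- 1"] by simp

lemma zero: "\<phi> (\<lambda>x. 0) = 0"
  using cmult[OF Cc_zero, of 0] by simp

lemma mono: "f \<in> Cc \<Longrightarrow> g \<in> Cc \<Longrightarrow> (\<And>x. f x \<le> g x) \<Longrightarrow> \<phi> f \<le> \<phi> g"
  using positive[of "\<lambda>x. g x - f x"] diff[of g f] Cc_diff[of g f] by simp

lemma Cc_sum: "finite I \<Longrightarrow> (\<And>i. i \<in> I \<Longrightarrow> f i \<in> Cc) \<Longrightarrow> (\<lambda>x. \<Sum>i\<in>I. f i x) \<in> (Cc :: ('a \<Rightarrow> real) set)"
  by (induction I rule: finite_induct) (auto intro: Cc_zero Cc_add)

lemma sum: "finite I \<Longrightarrow> (\<And>i. i \<in> I \<Longrightarrow> f i \<in> Cc) \<Longrightarrow> \<phi> (\<lambda>x. \<Sum>i\<in>I. f i x) = (\<Sum>i\<in>I. \<phi> (f i))"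
  by (induction I rule: finite_induct) (auto simp: zero add Cc_sum)

text \<open>The functions usually written \<open>f \<prec> U\<close>.\<close>

definition below :: "'a set \<Rightarrow> ('a \<Rightarrow> real) set" where
  "below U = {f \<in> Cc. (\<forall>x. 0 \<le> f x \<and> f x \<le> 1) \<and> closure {x. f x \<noteq> 0} \<subseteq> U}"

definition open_content :: "'a set \<Rightarrow> ennreal" where
  "open_content U = (SUP f\<in>below U. ennreal (\<phi> f))"

definition outer_content :: "'a set \<Rightarrow> ennreal" where
  "outer_content E = (INF U\<in>{U. open U \<and> E \<subseteq> U}. open_content U)"

lemma zero_below: "(\<lambda>x. 0) \<in> below U"
  by (simp add: below_def Cc_zero)

lemma open_content_mono: "U \<subseteq> V \<Longrightarrow> open_content U \<le> open_content V"
  unfolding open_content_def by (rule SUP_subset_mono) (auto simp: below_def)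

lemma outer_content_open: "open U \<Longrightarrow> outer_content U = open_content U"
  unfolding outer_content_def
  by (rule antisym) (auto intro: INF_lower INF_greatest open_content_mono)

lemma outer_content_mono: "E \<subseteq> F \<Longrightarrow> outer_content E \<le> outer_content F"
  unfolding outer_content_def by (rule INF_superset_mono) auto

lemma outer_content_empty: "outer_content {} = 0"
proof -
  have "f = (\<lambda>x. 0)" if "f \<in> below {}" for f
    using that closure_subset[of "{x. f x \<noteq> 0}"] by (auto simp: below_def)
  then have "ennreal (\<phi> f) \<le> 0" if "f \<in> below {}" for f using that zero by fastforce
  then have "open_content {} \<le> 0" unfolding open_content_def by (rule SUP_least)
  then show ?thesis using outer_content_open[of "{}"] by simp
qed

lemma below_le: "f \<in> below U \<Longrightarrow> ennreal (\<phi> f) \<le> open_content U"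
  unfolding open_content_def by (rule SUP_upper)

text \<open>A function below \<open>U \<union> V\<close> is split with a bump supported in \<open>U\<close> that equals 1 near the part of the
  support outside \<open>V\<close>.\<close>

lemma open_content_Un:
  assumes "open U" "open V"
  shows "open_content (U \<union> V) \<le> open_content U + open_content V"
  unfolding open_content_def[of "U \<union> V"]
proof (rule SUP_least)
  fix f assume f: "f \<in> below (U \<union> V)"
  define K where "K = closure {x. f x \<noteq> 0}"
  have K: "compact K" "K \<subseteq> U \<union> V" and fC: "f \<in> Cc" and f01: "\<And>x. 0 \<le> f x" "\<And>x. f x \<le> 1"
    using f by (auto simp: below_def K_def Cc_def)
  have fK: "{x. f x \<noteq> 0} \<subseteq> K" unfolding K_def by (rule closure_subset)
  have "compact (K - V)" using K(1) assms(2) by (rule compact_diff)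
  moreover have "K - V \<subseteq> U" using K(2) by blast
  ultimately obtain W where W: "open W" "K - V \<subseteq> W" "compact (closure W)" "closure W \<subseteq> U"
    using relatively_compact_neighbourhood[of "K - V" U] assms(1) by blast
  obtain g where g: "g \<in> Cc" "\<And>x. 0 \<le> g x" "\<And>x. g x \<le> 1" "\<And>x. x \<in> closure W \<Longrightarrow> g x = 1"
    "closure {x. g x \<noteq> 0} \<subseteq> U"
    using bump_function[OF W(3) assms(1) W(4)] by metis
  define f1 where "f1 = (\<lambda>x. f x * g x)"
  define f2 where "f2 = (\<lambda>x. f x - f1 x)"
  have f1C: "f1 \<in> Cc" unfolding f1_def
    by (rule CcI[of _ K]) (use fK K(1) in \<open>auto intro!: continuous_on_mult simp: Cc_continuous fC g(1)\<close>)
  have f2C: "f2 \<in> Cc" unfolding f2_def by (rule Cc_diff[OF fC f1C])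
  have b1: "f1 \<in> below U"
  proof -
    have "closure {x. f1 x \<noteq> 0} \<subseteq> closure {x. g x \<noteq> 0}" by (rule closure_mono) (auto simp: f1_def)
    then show ?thesis using f1C g f01 by (auto simp: below_def f1_def intro: mult_le_one)
  qed
  have b2: "f2 \<in> below V"
  proof -
    have "closure {x. f2 x \<noteq> 0} \<subseteq> K \<inter> - W"
    proof (rule closure_minimal)
      show "{x. f2 x \<noteq> 0} \<subseteq> K \<inter> - W"
        using fK g(4) closure_subset[of W] by (auto simp: f2_def f1_def)
      show "closed (K \<inter> - W)" using K(1) W(1) by (intro closed_Int compact_imp_closed closed_Compl)
    qed
    moreover have "0 \<le> f2 x" "f2 x \<le> 1" for x
      using f01[of x] g(2,3)[of x] mult_left_le[of "g x" "f x"] mult_nonneg_nonneg[of "f x" "g x"]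
      unfolding f2_def f1_def by linarith+
    ultimately show ?thesis using f2C W(2) by (auto simp: below_def)
  qed
  have "\<phi> f = \<phi> f1 + \<phi> f2" using diff[OF fC f1C] by (simp add: f2_def)
  moreover have "0 \<le> \<phi> f1" "0 \<le> \<phi> f2" using b1 b2 by (auto intro!: positive simp: below_def)
  ultimately have "ennreal (\<phi> f) = ennreal (\<phi> f1) + ennreal (\<phi> f2)" by (simp add: ennreal_plus)
  also have "\<dots> \<le> open_content U + open_content V" by (intro add_mono below_le b1 b2)
  finally show "ennreal (\<phi> f) \<le> open_content U + open_content V" .
qed

lemma open_content_UN:
  assumes U: "\<And>n. open (U n)"
  shows "open_content (\<Union>n. U n) \<le> (\<Sum>n. open_content (U (n::nat)))"
  unfolding open_content_def[of "\<Union>n. U n"]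
proof (rule SUP_least)
  fix f assume f: "f \<in> below (\<Union>n. U n)"
  have fin: "open_content (\<Union>i<n. U i) \<le> (\<Sum>i<n. open_content (U i))" for n
  proof (induction n)
    case 0
    then show ?case using outer_content_empty outer_content_open[of "{}"] by simp
  next
    case (Suc n)
    have "open_content (\<Union>i<Suc n. U i) = open_content ((\<Union>i<n. U i) \<union> U n)"
      by (simp add: lessThan_Suc Un_commute)
    also have "\<dots> \<le> open_content (\<Union>i<n. U i) + open_content (U n)"
      by (intro open_content_Un) (use U in auto)
    finally show ?case using Suc by (simp add: add_mono order_trans)
  qed
  have c: "compact (closure {x. f x \<noteq> 0})" "closure {x. f x \<noteq> 0} \<subseteq> (\<Union>n\<in>UNIV. U n)"
    using f by (auto simp: below_def Cc_def)
  obtain T where T: "finite T" "closure {x. f x \<noteq> 0} \<subseteq> (\<Union>n\<in>T. U n)"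
    using compactE_image[OF c(1), of UNIV U] U c(2) by metis
  obtain n where n: "\<forall>i\<in>T. i < n" using T(1) finite_nat_set_iff_bounded by blast
  have "(\<Union>n\<in>T. U n) \<subseteq> (\<Union>i<n. U i)" using n by blast
  then have "f \<in> below (\<Union>i<n. U i)" using f T(2) by (auto simp: below_def)
  then have "ennreal (\<phi> f) \<le> open_content (\<Union>i<n. U i)" by (rule below_le)
  also have "\<dots> \<le> (\<Sum>i<n. open_content (U i))" by (rule fin)
  also have "\<dots> \<le> (\<Sum>i. open_content (U i))" by (rule sum_le_suminf) auto
  finally show "ennreal (\<phi> f) \<le> (\<Sum>i. open_content (U i))" .
qed

lemma outer_content_countably_subadditive:
  "outer_content (\<Union>n. A n) \<le> (\<Sum>n. outer_content (A (n::nat)))"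
proof (rule ennreal_le_epsilon)
  fix e :: real assume e: "0 < e" "(\<Sum>n. outer_content (A n)) < top"
  then have *: "outer_content (A n) < outer_content (A n) + e * (1/2)^Suc n" for n
    by (auto simp add: less_top dest!: ennreal_suminf_lessD)
  have "\<exists>U. open U \<and> A n \<subseteq> U \<and> open_content U \<le> outer_content (A n) + e * (1/2)^Suc n" for n
    using *[of n] unfolding outer_content_def[of "A n"] INF_less_iff by (auto intro: less_imp_le)
  then obtain U where U: "\<And>n. open (U n)" "\<And>n. A n \<subseteq> U n"
    "\<And>n. open_content (U n) \<le> outer_content (A n) + e * (1/2)^Suc n" by metis
  have "outer_content (\<Union>n. A n) \<le> outer_content (\<Union>n. U n)"
    using U(2) by (intro outer_content_mono) blast
  also have "\<dots> = open_content (\<Union>n. U n)" using U(1) by (intro outer_content_open) auto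
  also have "\<dots> \<le> (\<Sum>n. open_content (U n))" by (rule open_content_UN[OF U(1)])
  also have "\<dots> \<le> (\<Sum>n. outer_content (A n) + e * (1/2)^Suc n)"
    by (intro suminf_le U(3)) auto
  also have "\<dots> = (\<Sum>n. outer_content (A n)) + (\<Sum>n. ennreal e * ennreal ((1/2) ^ Suc n))"
    using \<open>0 < e\<close> by (subst suminf_add[symmetric])
      (auto simp del: ennreal_suminf_cmult simp add: ennreal_mult[symmetric])
  also have "\<dots> = (\<Sum>n. outer_content (A n)) + e"
    unfolding ennreal_suminf_cmult
    by (subst suminf_ennreal_eq[OF zero_le_power power_half_series]) auto
  finally show "outer_content (\<Union>n. A n) \<le> (\<Sum>n. outer_content (A n)) + e" .
qed

lemma outer_content_Un: "outer_content (A \<union> B) \<le> outer_content A + outer_content B"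
proof -
  have "outer_content (\<Union>n. binaryset A B n) \<le> (\<Sum>n. outer_content (binaryset A B n))"
    by (rule outer_content_countably_subadditive)
  also have "\<dots> = outer_content A + outer_content B"
    by (subst suminf_binaryset_eq) (auto simp: outer_content_empty)
  finally show ?thesis by (simp add: UN_binaryset_eq)
qed

text \<open>A function below \<open>V \<inter> U\<close> with support \<open>K\<close> and a function below \<open>V - K\<close> have disjoint supports, so their
  sum is still below \<open>V\<close>.\<close>

lemma open_caratheodory:
  assumes "open U"
  shows "outer_content (E \<inter> U) + outer_content (E - U) = outer_content E"
proof (rule antisym)
  have "outer_content ((E \<inter> U) \<union> (E - U)) \<le> outer_content (E \<inter> U) + outer_content (E - U)"
    by (rule outer_content_Un)
  moreover have "(E \<inter> U) \<union> (E - U) = E" by blast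
  ultimately show "outer_content E \<le> outer_content (E \<inter> U) + outer_content (E - U)" by simp
  show "outer_content (E \<inter> U) + outer_content (E - U) \<le> outer_content E"
    unfolding outer_content_def[of E]
  proof (rule INF_greatest)
    fix V assume "V \<in> {V. open V \<and> E \<subseteq> V}"
    then have V: "open V" "E \<subseteq> V" by auto
    have step: "ennreal (\<phi> f) + outer_content (V - U) \<le> open_content V" if f: "f \<in> below (V \<inter> U)" for f
    proof -
      define K where "K = closure {x. f x \<noteq> 0}"
      have K: "compact K" "K \<subseteq> V \<inter> U" and fC: "f \<in> Cc" and f01: "\<And>x. 0 \<le> f x" "\<And>x. f x \<le> 1"
        using f by (auto simp: below_def K_def Cc_def)
      have fK: "{x. f x \<noteq> 0} \<subseteq> K" unfolding K_def by (rule closure_subset)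
      have oVK: "open (V - K)" using V(1) K(1) by (simp add: open_Diff compact_imp_closed)
      have "ennreal (\<phi> f) + ennreal (\<phi> g) \<le> open_content V" if g: "g \<in> below (V - K)" for g
      proof -
        have gC: "g \<in> Cc" and g01: "\<And>x. 0 \<le> g x" "\<And>x. g x \<le> 1"
          and gV: "closure {x. g x \<noteq> 0} \<subseteq> V - K"
          using g by (auto simp: below_def)
        have disj: "f x = 0 \<or> g x = 0" for x
          using fK gV closure_subset[of "{x. g x \<noteq> 0}"] by auto
        have "f x + g x \<le> 1" "0 \<le> f x + g x" for x using disj[of x] f01[of x] g01[of x] by auto
        moreover have "closure {x. f x + g x \<noteq> 0} \<subseteq> V"
        proof -
          have "closure {x. f x + g x \<noteq> 0} \<subseteq> closure ({x. f x \<noteq> 0} \<union> {x. g x \<noteq> 0})"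
            by (rule closure_mono) auto
          then show ?thesis using K gV by (auto simp: K_def)
        qed
        ultimately have "(\<lambda>x. f x + g x) \<in> below V" using Cc_add[OF fC gC] by (auto simp: below_def)
        then have "ennreal (\<phi> (\<lambda>x. f x + g x)) \<le> open_content V" by (rule below_le)
        moreover have "0 \<le> \<phi> f" "0 \<le> \<phi> g" using f01 g01 by (auto intro!: positive fC gC)
        ultimately show ?thesis by (simp add: add[OF fC gC] ennreal_plus)
      qed
      then have "ennreal (\<phi> f) + open_content (V - K) \<le> open_content V"
        unfolding open_content_def[of "V - K"]
        using zero_below by (subst ennreal_SUP_add_right) (auto intro!: SUP_least)
      moreover have "outer_content (V - U) \<le> open_content (V - K)"
        using outer_content_mono[of "V - U" "V - K"] outer_content_open[OF oVK] K by auto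
      ultimately show ?thesis by (meson add_left_mono order_trans)
    qed
    have "outer_content (E \<inter> U) + outer_content (E - U) \<le> outer_content (V \<inter> U) + outer_content (V - U)"
      using V(2) by (intro add_mono outer_content_mono) auto
    also have "\<dots> = (SUP f\<in>below (V \<inter> U). ennreal (\<phi> f)) + outer_content (V - U)"
      using V(1) assms by (subst outer_content_open) (auto simp: open_content_def)
    also have "\<dots> \<le> open_content V"
      using zero_below step by (subst ennreal_SUP_add_left[symmetric]) (auto intro!: SUP_least)
    finally show "outer_content (E \<inter> U) + outer_content (E - U) \<le> open_content V" .
  qed
qed

definition riesz_measure :: "'a measure" where
  "riesz_measure = measure_of UNIV (sets borel) outer_content"

lemma emeasure_riesz: "B \<in> sets borel \<Longrightarrow> emeasure riesz_measure B = outer_content B"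
proof -
  assume B: "B \<in> sets borel"
  have oms: "outer_measure_space (Pow UNIV) outer_content"
    unfolding outer_measure_space_def
    by (auto simp: positive_def outer_content_empty increasing_def outer_content_mono
        countably_subadditive_def outer_content_countably_subadditive)
  define L where "L = lambda_system UNIV (Pow UNIV) outer_content"
  have ms: "measure_space UNIV L outer_content"
    unfolding L_def by (rule sigma_algebra.caratheodory_lemma[OF sigma_algebra_Pow oms])
  have "U \<in> L" if "open U" for U
    using open_caratheodory[OF that] by (auto simp: L_def lambda_system_def Int_commute Diff_eq)
  then have "Collect open \<subseteq> L" by blast
  then have "sigma_sets UNIV (Collect open) \<subseteq> L"
    using ms by (intro sigma_algebra.sigma_sets_subset) (auto simp: measure_space_def)
  then have "sets borel \<subseteq> L" by (simp add: borel_def)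
  then have "measure_space UNIV (sets borel) outer_content"
    using measure_down[OF ms _ \<open>sets borel \<subseteq> L\<close>] sets.sigma_algebra_axioms[of borel] by simp
  then show ?thesis
    unfolding riesz_measure_def measure_space_def
    using B by (intro emeasure_measure_of_sigma) auto
qed

lemma sets_riesz [simp]: "sets riesz_measure = sets borel"
  unfolding riesz_measure_def using sets.sigma_algebra_axioms[of borel]
  by (subst sigma_algebra.sets_measure_of_eq) auto

text \<open>For \<open>a < 1\<close> the superlevel set \<open>{x. a < g x}\<close> is an open neighbourhood of \<open>K\<close>, and \<open>g\<close> dominates \<open>a h\<close> for
  every \<open>h\<close> below it.\<close>

lemma outer_content_le:
  assumes K: "compact K" and g: "g \<in> Cc" "\<And>x. 0 \<le> g x" "\<And>x. x \<in> K \<Longrightarrow> 1 \<le> g x"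
  shows "outer_content K \<le> ennreal (\<phi> g)"
proof -
  have bound: "outer_content K \<le> ennreal (\<phi> g / a)" if a: "0 < a" "a < 1" for a
  proof -
    have op: "open {x. a < g x}"
      using Cc_continuous[OF g(1)] by (intro open_Collect_less) auto
    have "outer_content K \<le> outer_content {x. a < g x}"
      using g(3) a by (intro outer_content_mono) force
    also have "\<dots> = open_content {x. a < g x}" by (rule outer_content_open[OF op])
    also have "\<dots> \<le> ennreal (\<phi> g / a)"
      unfolding open_content_def
    proof (intro SUP_least ennreal_leI)
      fix h assume h: "h \<in> below {x. a < g x}"
      have "a * h x \<le> g x" for x
      proof (cases "h x = 0")
        case False
        then have "a < g x" using h closure_subset[of "{x. h x \<noteq> 0}"] by (auto simp: below_def)
        moreover have "a * h x \<le> a * 1" using h a by (intro mult_left_mono) (auto simp: below_def)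
        ultimately show ?thesis by simp
      qed (simp add: g(2))
      then have "\<phi> (\<lambda>x. a * h x) \<le> \<phi> g" using h g(1) by (intro mono Cc_cmult) (auto simp: below_def)
      then have "a * \<phi> h \<le> \<phi> g" using h by (simp add: cmult below_def)
      then show "\<phi> h \<le> \<phi> g / a" using a by (simp add: field_simps)
    qed
    finally show ?thesis .
  qed
  have fin: "outer_content K < top"
    using bound[of "1/2"] by (simp add: le_less_trans)
  then obtain r where r: "outer_content K = ennreal r" "0 \<le> r" by (cases "outer_content K") auto
  have pos: "0 \<le> \<phi> g" using g by (intro positive)
  have "a * r \<le> \<phi> g" if a: "0 < a" "a < 1" for a
  proof -
    have "r \<le> \<phi> g / a" using bound[OF a] r pos a by simp
    then show ?thesis using a by (simp add: field_simps)
  qed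
  then have "r \<le> \<phi> g" by (rule field_le_mult_one_interval)
  then show ?thesis using r by (simp add: ennreal_leI)
qed

lemma outer_content_ge:
  assumes "g \<in> Cc" "\<And>x. 0 \<le> g x" "\<And>x. g x \<le> 1" "closure {x. g x \<noteq> 0} \<subseteq> K"
  shows "ennreal (\<phi> g) \<le> outer_content K"
  unfolding outer_content_def
  by (rule INF_greatest) (use assms in \<open>auto simp: below_def intro!: below_le\<close>)

lemma outer_content_compact: "compact K \<Longrightarrow> outer_content K < \<infinity>"
proof -
  assume K: "compact K"
  obtain g where g: "g \<in> Cc" "\<And>x. 0 \<le> g x" "\<And>x. x \<in> K \<Longrightarrow> g x = 1"
    using bump_function[OF K open_UNIV subset_UNIV] by metis
  have "outer_content K \<le> ennreal (\<phi> g)" using outer_content_le[OF K g(1,2)] g(3) by simp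
  then show ?thesis by (simp add: le_less_trans)
qed

lemma radon_riesz: "radon_measure riesz_measure"
  unfolding radon_measure_def
proof (intro conjI allI impI ballI)
  show "emeasure riesz_measure K < \<infinity>" if "compact K" for K
    using that outer_content_compact by (simp add: emeasure_riesz compact_borel)
  show "emeasure riesz_measure B = (INF U\<in>{U. open U \<and> B \<subseteq> U}. emeasure riesz_measure U)"
    if "B \<in> sets borel" for B
    unfolding emeasure_riesz[OF that] outer_content_def
    by (rule INF_cong) (auto simp: emeasure_riesz outer_content_open)
  show "emeasure riesz_measure U = (SUP K\<in>{K. compact K \<and> K \<subseteq> U}. emeasure riesz_measure K)"
    if U: "open U" for U
  proof (rule antisym)
    show "(SUP K\<in>{K. compact K \<and> K \<subseteq> U}. emeasure riesz_measure K) \<le> emeasure riesz_measure U"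
      using U by (intro SUP_least emeasure_mono) auto
    show "emeasure riesz_measure U \<le> (SUP K\<in>{K. compact K \<and> K \<subseteq> U}. emeasure riesz_measure K)"
      using U unfolding emeasure_riesz[OF borel_open[OF U]] outer_content_open[OF U] open_content_def
    proof (intro SUP_least)
      fix f assume f: "f \<in> below U"
      define K where "K = closure {x. f x \<noteq> 0}"
      have K: "compact K" "K \<subseteq> U" using f by (auto simp: below_def K_def Cc_def)
      have "ennreal (\<phi> f) \<le> emeasure riesz_measure K"
        using f by (auto simp: emeasure_riesz compact_borel[OF K(1)] below_def K_def intro!: outer_content_ge)
      also have "\<dots> \<le> (SUP K\<in>{K. compact K \<and> K \<subseteq> U}. emeasure riesz_measure K)"
        using K by (intro SUP_upper) auto
      finally show "ennreal (\<phi> f) \<le> (SUP K\<in>{K. compact K \<and> K \<subseteq> U}. emeasure riesz_measure K)" .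
    qed
  qed
qed simp

lemma layer_sum: "0 \<le> t \<Longrightarrow> (\<Sum>i<n. min (max (t - real i) 0) 1) = min t (real n)"
  by (induction n) auto

text \<open>Cut \<open>n f\<close> into the layers \<open>h i\<close> between the levels \<open>i\<close> and \<open>i + 1\<close>. The functional and the integral of a
  layer lie between the measures of the same two superlevel sets, so the two values for \<open>n f\<close> differ by
  at most the measure of the support.\<close>

lemma riesz_unit:
  assumes f: "f \<in> Cc" "\<And>x. 0 \<le> f x" "\<And>x. f x \<le> 1"
  shows "\<phi> f = (\<integral>x. f x \<partial>riesz_measure)"
proof -
  let ?R = "riesz_measure"
  have lf: "locally_finite_measure ?R" by (rule radon_imp_locally_finite[OF radon_riesz])
  define I where "I g = (\<integral>x. g x \<partial>?R)" for g :: "'a \<Rightarrow> real"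
  interpret I: positive_functional ty I
    by unfold_locales
      (auto simp: I_def integral_nonneg Bochner_Integration.integral_add[OF Cc_integrable[OF lf] Cc_integrable[OF lf]])
  define K where "K = closure {x. f x \<noteq> 0}"
  have K: "compact K" using f by (simp add: K_def Cc_def)
  have fK: "x \<notin> K \<Longrightarrow> f x = 0" for x using closure_subset[of "{x. f x \<noteq> 0}"] by (auto simp: K_def)
  have main: "\<bar>real n * (\<phi> f - I f)\<bar> \<le> measure ?R K" if n: "n > 0" for n :: nat
  proof -
    define S where "S i = {x \<in> K. real i \<le> real n * f x}" for i
    have S: "compact (S i)" for i
    proof -
      have "closed {x. real i \<le> real n * f x}"
        using Cc_continuous[OF f(1)] by (intro closed_Collect_le continuous_intros) auto
      then have "compact (K \<inter> {x. real i \<le> real n * f x})" using K by (rule compact_Int_closed[rotated])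
      then show ?thesis by (simp add: S_def Int_def)
    qed
    define h where "h i x = min (max (real n * f x - real i) 0) 1" for i x
    have hC: "h i \<in> Cc" for i unfolding h_def
    proof (rule CcI[OF _ K])
      show "continuous_on UNIV (\<lambda>x. min (max (real n * f x - real i) 0) 1)"
        using Cc_continuous[OF f(1)] by (intro continuous_intros) auto
    qed (simp add: fK)
    have h01: "0 \<le> h i x" "h i x \<le> 1" for i x by (auto simp: h_def)
    have h1: "1 \<le> h i x" if "x \<in> S (Suc i)" for i x using that by (auto simp: S_def h_def)
    have hsupp: "closure {x. h i x \<noteq> 0} \<subseteq> S i" for i
    proof (rule closure_minimal[OF _ compact_imp_closed[OF S]], rule subsetI)
      fix x assume "x \<in> {x. h i x \<noteq> 0}"
      then have ne: "h i x \<noteq> 0" by simp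
      then have "real i \<le> real n * f x" by (auto simp: h_def min_def max_def split: if_splits)
      moreover have "x \<in> K"
      proof (rule ccontr)
        assume "x \<notin> K"
        then have "h i x = 0" by (simp add: h_def fK)
        then show False using ne by simp
      qed
      ultimately show "x \<in> S i" by (simp add: S_def)
    qed
    have Rm: "emeasure ?R (S i) = ennreal (measure ?R (S i))" for i
      using locally_finite_compact[OF lf S] by (intro emeasure_eq_ennreal_measure) (simp add: less_top)
    have \<phi>h: "measure ?R (S (Suc i)) \<le> \<phi> (h i)" "\<phi> (h i) \<le> measure ?R (S i)" for i
    proof -
      have pos: "0 \<le> \<phi> (h i)" using hC h01 by (intro positive)
      have "emeasure ?R (S (Suc i)) \<le> ennreal (\<phi> (h i))"
        using outer_content_le[OF S hC h01(1) h1] by (simp add: emeasure_riesz compact_borel[OF S])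
      then show "measure ?R (S (Suc i)) \<le> \<phi> (h i)" using pos Rm by simp
      have "ennreal (\<phi> (h i)) \<le> emeasure ?R (S i)"
        using outer_content_ge[OF hC h01 hsupp] by (simp add: emeasure_riesz compact_borel[OF S])
      then show "\<phi> (h i) \<le> measure ?R (S i)" using pos Rm by simp
    qed
    have Ih: "measure ?R (S (Suc i)) \<le> I (h i)" "I (h i) \<le> measure ?R (S i)" for i
    proof -
      have sS: "S j \<in> sets ?R" for j by (simp add: compact_borel[OF S])
      have nn: "ennreal (I (h i)) = (\<integral>\<^sup>+x. ennreal (h i x) \<partial>?R)"
        unfolding I_def using integral_Cc_eq_nn[OF lf hC h01(1)] by simp
      have pos: "0 \<le> I (h i)" using hC h01 by (intro I.positive)
      have "emeasure ?R (S (Suc i)) = (\<integral>\<^sup>+x. indicator (S (Suc i)) x \<partial>?R)" using sS by simp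
      also have "\<dots> \<le> (\<integral>\<^sup>+x. ennreal (h i x) \<partial>?R)"
      proof (intro nn_integral_mono)
        fix x show "indicator (S (Suc i)) x \<le> ennreal (h i x)"
          using ennreal_leI[OF h1[of x i]] by (auto simp: indicator_def)
      qed
      finally show "measure ?R (S (Suc i)) \<le> I (h i)" using pos by (simp add: nn[symmetric] Rm)
      have "(\<integral>\<^sup>+x. ennreal (h i x) \<partial>?R) \<le> (\<integral>\<^sup>+x. indicator (S i) x \<partial>?R)"
      proof (intro nn_integral_mono)
        fix x show "ennreal (h i x) \<le> indicator (S i) x"
          using hsupp[of i] closure_subset[of "{x. h i x \<noteq> 0}"] h01[where i = i and x = x]
          by (cases "h i x = 0") (auto simp: indicator_def)
      qed
      also have "\<dots> = emeasure ?R (S i)" using sS by simp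
      finally show "I (h i) \<le> measure ?R (S i)" by (simp add: nn[symmetric] Rm)
    qed
    have hsum: "(\<lambda>x. \<Sum>i<n. h i x) = (\<lambda>x. real n * f x)"
    proof
      fix x
      have "real n * f x \<le> real n * 1" using f by (intro mult_left_mono) auto
      then show "(\<Sum>i<n. h i x) = real n * f x"
        unfolding h_def using f by (subst layer_sum) auto
    qed
    have "real n * \<phi> f = (\<Sum>i<n. \<phi> (h i))"
      using sum[of "{..<n}" h] hC hsum cmult[OF f(1)] by simp
    moreover have "real n * I f = (\<Sum>i<n. I (h i))"
      using I.sum[of "{..<n}" h] hC hsum I.cmult[OF f(1)] by simp
    ultimately have "\<bar>real n * (\<phi> f - I f)\<bar> = \<bar>\<Sum>i<n. \<phi> (h i) - I (h i)\<bar>"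
      by (simp add: sum_subtractf right_diff_distrib)
    also have "\<dots> \<le> (\<Sum>i<n. \<bar>\<phi> (h i) - I (h i)\<bar>)" by (rule sum_abs)
    also have "\<dots> \<le> (\<Sum>i<n. measure ?R (S i) - measure ?R (S (Suc i)))"
      using \<phi>h Ih by (intro sum_mono) (smt (verit))
    also have "\<dots> = measure ?R (S 0) - measure ?R (S n)" by (rule sum_lessThan_telescope')
    also have "\<dots> \<le> measure ?R K" using f(2) by (simp add: S_def)
    finally show ?thesis .
  qed
  have "\<phi> f - I f = 0"
  proof (rule ccontr)
    assume ne: "\<phi> f - I f \<noteq> 0"
    obtain n :: nat where n: "measure ?R K < real n * \<bar>\<phi> f - I f\<bar>"
      using ne reals_Archimedean3[of "\<bar>\<phi> f - I f\<bar>"] by auto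
    then have "n > 0" using measure_nonneg[of ?R K] by (cases n) auto
    then show False using main[of n] n by (simp add: abs_mult)
  qed
  then show ?thesis by (simp add: I_def)
qed

theorem riesz_representation:
  assumes f: "f \<in> Cc"
  shows "\<phi> f = (\<integral>x. f x \<partial>riesz_measure)"
proof -
  have lf: "locally_finite_measure riesz_measure" by (rule radon_imp_locally_finite[OF radon_riesz])
  have nonneg: "\<phi> g = (\<integral>x. g x \<partial>riesz_measure)" if g: "g \<in> Cc" "\<And>x. 0 \<le> g x" for g
  proof -
    obtain C where C: "C > 0" "\<And>x. \<bar>g x\<bar> \<le> C" using Cc_bounded[OF g(1)] by blast
    have "\<phi> (\<lambda>x. (1 / C) * g x) = (\<integral>x. (1 / C) * g x \<partial>riesz_measure)"
      using C g by (intro riesz_unit Cc_cmult) (auto simp: field_simps abs_le_iff)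
    moreover have "\<phi> (\<lambda>x. (1 / C) * g x) = (1 / C) * \<phi> g" by (rule cmult[OF g(1)])
    ultimately show ?thesis using C(1) by simp
  qed
  define p where "p = (\<lambda>x. max (f x) 0)"
  define n where "n = (\<lambda>x. max (- 1 * f x) 0)"
  have pC: "p \<in> Cc" unfolding p_def by (rule Cc_max[OF f Cc_zero])
  have nC: "n \<in> Cc" unfolding n_def by (rule Cc_max[OF Cc_cmult[OF f] Cc_zero])
  have f_eq: "f = (\<lambda>x. p x - n x)" by (auto simp: p_def n_def)
  have "\<phi> f = \<phi> p - \<phi> n" by (subst f_eq) (rule diff[OF pC nC])
  also have "\<dots> = (\<integral>x. p x \<partial>riesz_measure) - (\<integral>x. n x \<partial>riesz_measure)"
    using nonneg[OF pC] nonneg[OF nC] by (simp add: p_def n_def)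
  also have "\<dots> = (\<integral>x. p x - n x \<partial>riesz_measure)"
    using Cc_integrable[OF lf] pC nC by simp
  finally show ?thesis by (subst f_eq)
qed

end

text \<open>Regularity comes for free: a locally finite measure agrees with the regular measure that represents
  its own integral.\<close>

lemma (in lcsc_space) radon_measure_iff:
  fixes M :: "'a measure"
  shows "radon_measure M \<longleftrightarrow> locally_finite_measure M"
proof
  assume lf: "locally_finite_measure M"
  interpret positive_functional ty "\<lambda>f. \<integral>x. f x \<partial>M"
    by unfold_locales
      (auto simp: integral_nonneg Bochner_Integration.integral_add[OF Cc_integrable[OF lf] Cc_integrable[OF lf]])
  have "M = riesz_measure"
    using lf radon_imp_locally_finite[OF radon_riesz] riesz_representation by (rule measure_eq_of_Cc)
  then show "radon_measure M" using radon_riesz by simp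
qed (rule radon_imp_locally_finite)

section \<open>Sums, restrictions and Jordan decompositions\<close>

definition add_measure :: "'a::topological_space measure \<Rightarrow> 'a measure \<Rightarrow> 'a measure" where
  "add_measure M N = measure_of UNIV (sets borel) (\<lambda>A. emeasure M A + emeasure N A)"

abbreviation restrict_to :: "'a measure \<Rightarrow> 'a set \<Rightarrow> 'a measure" where
  "restrict_to M B \<equiv> density M (indicator B)"

abbreviation functional_of :: "'a::topological_space measure \<Rightarrow> 'a functional" where
  "functional_of M \<equiv> difference_functional M (null_measure borel)"

lemma sets_add_measure [simp]: "sets (add_measure M N) = sets borel"
  unfolding add_measure_def using sets.sigma_algebra_axioms[of borel]
  by (subst sigma_algebra.sets_measure_of_eq) auto

lemma emeasure_add_measure:
  assumes "sets M = sets borel" "sets N = sets borel" "A \<in> sets borel"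
  shows "emeasure (add_measure M N) A = emeasure M A + emeasure N A"
  unfolding add_measure_def
proof (rule emeasure_measure_of_sigma)
  show "sigma_algebra UNIV (sets borel)" using sets.sigma_algebra_axioms[of borel] by simp
  show "countably_additive (sets borel) (\<lambda>A. emeasure M A + emeasure N A)"
    unfolding countably_additive_def using assms(1,2)
    by (auto simp: suminf_add[symmetric] suminf_emeasure)
qed (auto simp: positive_def assms)

lemma nn_integral_add_measure:
  assumes "sets M = sets borel" "sets N = sets borel" "f \<in> borel_measurable borel"
  shows "(\<integral>\<^sup>+x. f x \<partial>add_measure M N) = (\<integral>\<^sup>+x. f x \<partial>M) + (\<integral>\<^sup>+x. f x \<partial>N)"
  using assms(3)
proof (induction f rule: borel_measurable_induct)
  case (cong f g)
  have "f = g" using cong(3) by auto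
  then show ?case using cong by simp
next
  case (set A)
  then show ?case using assms(1,2) by (simp add: emeasure_add_measure)
next
  case (mult u c)
  have "u \<in> borel_measurable M" "u \<in> borel_measurable N" "u \<in> borel_measurable (add_measure M N)"
    using mult(1,2) measurable_cong_sets[OF assms(1) refl] measurable_cong_sets[OF assms(2) refl]
      measurable_cong_sets[OF sets_add_measure refl] by blast+
  then show ?case using mult by (simp add: nn_integral_cmult distrib_left)
next
  case (add u v)
  have "w \<in> borel_measurable M \<and> w \<in> borel_measurable N \<and> w \<in> borel_measurable (add_measure M N)"
    if "w \<in> borel_measurable borel" for w :: "'a \<Rightarrow> ennreal"
    using that measurable_cong_sets[OF assms(1) refl] measurable_cong_sets[OF assms(2) refl]
      measurable_cong_sets[OF sets_add_measure refl] by blast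
  then show ?case using add by (simp add: nn_integral_add ac_simps)
next
  case (seq U)
  have *: "w \<in> borel_measurable M \<and> w \<in> borel_measurable N \<and> w \<in> borel_measurable (add_measure M N)"
    if "w \<in> borel_measurable borel" for w :: "'a \<Rightarrow> ennreal"
    using that measurable_cong_sets[OF assms(1) refl] measurable_cong_sets[OF assms(2) refl]
      measurable_cong_sets[OF sets_add_measure refl] by blast
  have SUP: "(\<integral>\<^sup>+x. (SUP i. U i x) \<partial>L) = (SUP i. \<integral>\<^sup>+x. U i x \<partial>L)"
    if "\<And>i. U i \<in> borel_measurable L" for L
    using seq that by (intro nn_integral_monotone_convergence_SUP) auto
  have inc: "incseq (\<lambda>i. \<integral>\<^sup>+x. U i x \<partial>L)" for L
    using seq(3) by (auto simp: incseq_def le_fun_def intro!: nn_integral_mono)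
  show ?case
    using seq * by (simp add: SUP image_comp ennreal_SUP_add[OF inc inc])
qed

lemma locally_finite_null: "locally_finite_measure (null_measure borel)"
  by (simp add: locally_finite_measure_def)

lemma locally_finite_add:
  fixes M N :: "'a::t2_space measure"
  shows "locally_finite_measure M \<Longrightarrow> locally_finite_measure N \<Longrightarrow> locally_finite_measure (add_measure M N)"
  by (auto simp: locally_finite_measure_def emeasure_add_measure compact_borel)

lemma locally_finite_mono:
  assumes "locally_finite_measure M" "sets N = sets borel" "\<And>A. A \<in> sets borel \<Longrightarrow> emeasure N A \<le> emeasure M A"
  shows "locally_finite_measure (N :: 'a::t2_space measure)"
  using assms unfolding locally_finite_measure_def by (meson compact_borel le_less_trans)

lemma emeasure_restrict:
  assumes "sets M = sets borel" "A \<in> sets borel" "B \<in> sets borel"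
  shows "emeasure (restrict_to M B) A = emeasure M (A \<inter> B)"
  using assms by (subst emeasure_density) (auto simp: indicator_inter_arith[symmetric] Int_commute mult.commute)

lemma locally_finite_restrict:
  fixes M :: "'a::t2_space measure"
  assumes "locally_finite_measure M" "B \<in> sets borel"
  shows "locally_finite_measure (restrict_to M B)"
  using assms(1)
proof (rule locally_finite_mono)
  show "emeasure (restrict_to M B) A \<le> emeasure M A" if "A \<in> sets borel" for A
    using assms that locally_finite_sets[OF assms(1)] by (subst emeasure_restrict) (auto intro!: emeasure_mono)
qed (simp add: locally_finite_sets[OF assms(1)])

lemma locally_finite_scale:
  assumes "locally_finite_measure M"
  shows "locally_finite_measure (scale_measure (ennreal c) M)"
  using assms by (auto simp: locally_finite_measure_def ennreal_mult_less_top)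

lemma integral_add_measure:
  fixes f :: "'a::t2_space \<Rightarrow> real"
  assumes M: "locally_finite_measure M" and N: "locally_finite_measure N" and f: "f \<in> Cc"
  shows "(\<integral>x. f x \<partial>add_measure M N) = (\<integral>x. f x \<partial>M) + (\<integral>x. f x \<partial>N)"
proof -
  have I: "integrable M f" "integrable N f" "integrable (add_measure M N) f"
    using Cc_integrable f M N locally_finite_add by blast+
  have [measurable]: "f \<in> borel_measurable borel" by (rule Cc_measurable[OF f])
  have fin: "(\<integral>\<^sup>+x. ennreal (f x) \<partial>L) < top" "(\<integral>\<^sup>+x. ennreal (- f x) \<partial>L) < top"
    if "integrable L f" for L
    using that by (auto simp: real_integrable_def less_top)
  show ?thesis
    using I fin[OF I(1)] fin[OF I(2)] locally_finite_sets[OF M] locally_finite_sets[OF N]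
    by (simp add: real_lebesgue_integral_def nn_integral_add_measure enn2real_plus)
qed

lemma integral_null_measure: "(\<integral>x. f x \<partial>null_measure M) = (0::real)"
proof (rule integral_eq_zero_AE)
  have "space M \<in> null_sets (null_measure M)" by (simp add: null_sets_def)
  then show "AE x in null_measure M. f x = 0" by (rule AE_I') simp
qed

lemma functional_of_apply: "f \<in> Cc \<Longrightarrow> functional_of M f = (\<integral>x. f x \<partial>M)"
  by (simp add: difference_functional_def integral_null_measure)

context lcsc_space
begin

text \<open>With densities \<open>m\<close> and \<open>n\<close> with respect to \<open>M + N\<close>, the common part has the density \<open>min m n\<close>.\<close>

lemma jordan_decomposition_exists:
  fixes M N :: "'a measure"
  assumes M: "locally_finite_measure M" and N: "locally_finite_measure N"
  obtains P Q R where "locally_finite_measure P" "locally_finite_measure Q" "locally_finite_measure R"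
    "mutually_singular P Q" "M = add_measure P R" "N = add_measure Q R"
proof -
  define W where "W = add_measure M N"
  have sM: "sets M = sets borel" and sN: "sets N = sets borel" and sW: "sets W = sets borel"
    using M N by (auto simp: locally_finite_measure_def W_def)
  have W: "locally_finite_measure W" unfolding W_def by (rule locally_finite_add[OF M N])
  interpret W: sigma_finite_measure W by (rule locally_finite_sigma_finite[OF W])
  have ac: "absolutely_continuous W M" "absolutely_continuous W N"
    using emeasure_add_measure[OF sM sN] by (auto simp: absolutely_continuous_def null_sets_def W_def sM sN)
  define m where "m = RN_deriv W M"
  define n where "n = RN_deriv W N"
  have mW: "m \<in> borel_measurable W" and nW: "n \<in> borel_measurable W" by (auto simp: m_def n_def)
  have [measurable]: "m \<in> borel_measurable borel" "n \<in> borel_measurable borel"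
    using mW nW measurable_cong_sets[OF sW refl] by blast+
  have dm: "density W m = M" and dn: "density W n = N"
    unfolding m_def n_def using ac sM sN sW by (auto intro!: W.density_RN_deriv)
  have fin: "AE x in W. m x \<noteq> \<infinity>" "AE x in W. n x \<noteq> \<infinity>"
    unfolding m_def n_def using W.RN_deriv_finite ac sM sN sW
      locally_finite_sigma_finite[OF M] locally_finite_sigma_finite[OF N] by auto
  define P where "P = density W (\<lambda>x. m x - n x)"
  define Q where "Q = density W (\<lambda>x. n x - m x)"
  define R where "R = density W (\<lambda>x. min (m x) (n x))"
  have sP: "sets P = sets borel" and sQ: "sets Q = sets borel" and sR: "sets R = sets borel"
    by (auto simp: P_def Q_def R_def sW)
  have em: "emeasure (density W h) A = (\<integral>\<^sup>+x. h x * indicator A x \<partial>W)"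
    if "h \<in> borel_measurable borel" "A \<in> sets borel" for h A
    using that measurable_cong_sets[OF sW refl, of borel] by (subst emeasure_density) (auto simp: sW)
  have split: "density W h = add_measure (density W h1) (density W h2)"
    if [measurable]: "h \<in> borel_measurable borel" "h1 \<in> borel_measurable borel" "h2 \<in> borel_measurable borel"
      and ae: "AE x in W. h x = h1 x + h2 x" for h h1 h2
  proof (rule measure_eqI)
    fix A assume "A \<in> sets (density W h)"
    then have A [measurable]: "A \<in> sets borel" by (simp add: sW)
    have [measurable]: "h1 \<in> borel_measurable W" "h2 \<in> borel_measurable W" "A \<in> sets W"
      using that(2,3) measurable_cong_sets[OF sW refl, of borel] A sW by auto
    have "emeasure (density W h) A = (\<integral>\<^sup>+x. h1 x * indicator A x + h2 x * indicator A x \<partial>W)"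
      unfolding em[OF that(1) A] using ae by (intro nn_integral_cong_AE) (auto simp: distrib_right)
    also have "\<dots> = (\<integral>\<^sup>+x. h1 x * indicator A x \<partial>W) + (\<integral>\<^sup>+x. h2 x * indicator A x \<partial>W)"
      by (rule nn_integral_add) auto
    also have "\<dots> = emeasure (add_measure (density W h1) (density W h2)) A"
      using A sW by (simp add: emeasure_add_measure em[OF that(2)] em[OF that(3)])
    finally show "emeasure (density W h) A = emeasure (add_measure (density W h1) (density W h2)) A" .
  qed (simp add: sW)
  have arith: "a = (a - b) + min a b" if "a \<noteq> \<infinity>" "b \<noteq> \<infinity>" for a b :: ennreal
  proof (cases "b \<le> a")
    case True
    then show ?thesis using that by (simp add: min_absorb2 diff_add_cancel_ennreal)
  next
    case False
    then show ?thesis using that by (simp add: min_absorb1 diff_eq_0_iff_ennreal less_imp_le less_top)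
  qed
  have MPR: "M = add_measure P R"
  proof -
    have "AE x in W. m x = (m x - n x) + min (m x) (n x)"
      using fin by eventually_elim (rule arith)
    then show ?thesis unfolding P_def R_def dm[symmetric] by (intro split) auto
  qed
  have NQR: "N = add_measure Q R"
  proof -
    have "AE x in W. n x = (n x - m x) + min (m x) (n x)"
      using fin by eventually_elim (metis arith min.commute)
    then show ?thesis unfolding Q_def R_def dn[symmetric] by (intro split) auto
  qed
  have lfP: "locally_finite_measure P" by (rule locally_finite_mono[OF M sP]) (simp add: MPR emeasure_add_measure sP sR)
  have lfR: "locally_finite_measure R" by (rule locally_finite_mono[OF M sR]) (simp add: MPR emeasure_add_measure sP sR)
  have lfQ: "locally_finite_measure Q" by (rule locally_finite_mono[OF N sQ]) (simp add: NQR emeasure_add_measure sQ sR)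
  have sing: "mutually_singular P Q"
    unfolding mutually_singular_def
  proof (intro bexI conjI)
    let ?H = "{x. n x < m x}"
    show H [measurable]: "?H \<in> sets borel" by measurable
    have "emeasure P (- ?H) = (\<integral>\<^sup>+x. (m x - n x) * indicator (- ?H) x \<partial>W)"
      unfolding P_def by (intro em) auto
    also have "\<dots> = (\<integral>\<^sup>+x. 0 \<partial>W)"
      using fin(1) by (intro nn_integral_cong_AE)
        (auto simp: indicator_def not_less diff_eq_0_iff_ennreal less_top elim!: eventually_mono)
    finally show "emeasure P (- ?H) = 0" by simp
    have "emeasure Q ?H = (\<integral>\<^sup>+x. (n x - m x) * indicator ?H x \<partial>W)"
      unfolding Q_def by (intro em) auto
    also have "\<dots> = (\<integral>\<^sup>+x. 0 \<partial>W)"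
      using fin(2) by (intro nn_integral_cong_AE)
        (auto simp: indicator_def diff_eq_0_iff_ennreal less_top elim!: eventually_mono)
    finally show "emeasure Q ?H = 0" by simp
  qed
  show thesis by (rule that[OF lfP lfQ lfR sing MPR NQR])
qed

text \<open>On the intersection of the two separating sets only \<open>P\<close> and \<open>P'\<close> live, and they agree there; off this
  intersection both vanish.\<close>

lemma jordan_decomposition_unique:
  fixes P Q P' Q' :: "'a measure"
  assumes lf: "locally_finite_measure P" "locally_finite_measure Q" "locally_finite_measure P'" "locally_finite_measure Q'"
    and ms: "mutually_singular P Q" "mutually_singular P' Q'"
    and eq: "add_measure P Q' = add_measure P' Q"
  shows "P = P'"
proof (rule measure_eqI)
  note s = lf[THEN locally_finite_sets]
  obtain H where H: "H \<in> sets borel" "emeasure P (- H) = 0" "emeasure Q H = 0"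
    using ms(1) by (auto simp: mutually_singular_def)
  obtain H' where H': "H' \<in> sets borel" "emeasure P' (- H') = 0" "emeasure Q' H' = 0"
    using ms(2) by (auto simp: mutually_singular_def)
  show "sets P = sets P'" using s by simp
  fix A assume "A \<in> sets P"
  then have A: "A \<in> sets borel" using s by simp
  have e: "emeasure P B + emeasure Q' B = emeasure P' B + emeasure Q B" if "B \<in> sets borel" for B
    using arg_cong[OF eq, of "\<lambda>M. emeasure M B"] that s by (simp add: emeasure_add_measure)
  have z: "emeasure L B = 0" if "emeasure L C = 0" "B \<subseteq> C" "C \<in> sets borel" "sets L = sets borel" for L :: "'a measure" and B C
    using emeasure_mono[OF that(2), of L] that by simp
  have sp: "emeasure L A = emeasure L (A \<inter> H \<inter> H') + emeasure L (A - (H \<inter> H'))" if "sets L = sets borel" for L :: "'a measure"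
    using that A H(1) H'(1) by (subst plus_emeasure) (auto intro!: arg_cong[where f = "emeasure L"])
  have 1: "emeasure P (A \<inter> H \<inter> H') = emeasure P' (A \<inter> H \<inter> H')"
  proof -
    have "emeasure Q (A \<inter> H \<inter> H') = 0" by (rule z[OF H(3)]) (use H s in auto)
    moreover have "emeasure Q' (A \<inter> H \<inter> H') = 0" by (rule z[OF H'(3)]) (use H' s in auto)
    ultimately show ?thesis using e[of "A \<inter> H \<inter> H'"] A H(1) H'(1) by simp
  qed
  have PP: "emeasure P (A \<inter> H - H') = 0" "emeasure P' (A \<inter> H' - H) = 0"
  proof -
    have "emeasure P' (A \<inter> H - H') = 0" by (rule z[OF H'(2)]) (use H' s in auto)
    moreover have "emeasure Q (A \<inter> H - H') = 0" by (rule z[OF H(3)]) (use H s in auto)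
    ultimately show "emeasure P (A \<inter> H - H') = 0" using e[of "A \<inter> H - H'"] A H(1) H'(1) by simp
    have "emeasure P (A \<inter> H' - H) = 0" by (rule z[OF H(2)]) (use H s in auto)
    moreover have "emeasure Q' (A \<inter> H' - H) = 0" by (rule z[OF H'(3)]) (use H' s in auto)
    ultimately show "emeasure P' (A \<inter> H' - H) = 0" using e[of "A \<inter> H' - H"] A H(1) H'(1) by simp
  qed
  have 2: "emeasure P (A - (H \<inter> H')) = 0"
  proof -
    have "emeasure P ((A \<inter> H - H') \<union> (A - H)) \<le> emeasure P (A \<inter> H - H') + emeasure P (A - H)"
      using A H(1) H'(1) s by (intro emeasure_subadditive) auto
    also have "\<dots> = 0" using PP z[of P "- H" "A - H"] H s by auto
    also have "(A \<inter> H - H') \<union> (A - H) = A - (H \<inter> H')" by blast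
    finally show ?thesis by simp
  qed
  have 3: "emeasure P' (A - (H \<inter> H')) = 0"
  proof -
    have "emeasure P' ((A \<inter> H' - H) \<union> (A - H')) \<le> emeasure P' (A \<inter> H' - H) + emeasure P' (A - H')"
      using A H(1) H'(1) s by (intro emeasure_subadditive) auto
    also have "\<dots> = 0" using PP z[of P' "- H'" "A - H'"] H' s by auto
    also have "(A \<inter> H' - H) \<union> (A - H') = A - (H \<inter> H')" by blast
    finally show ?thesis by simp
  qed
  show "emeasure P A = emeasure P' A" using sp[OF s(1)] sp[OF s(3)] 1 2 3 by simp
qed

lemma difference_functional_eq_iff:
  fixes P N P' N' :: "'a measure"
  assumes lf: "locally_finite_measure P" "locally_finite_measure N" "locally_finite_measure P'" "locally_finite_measure N'"
  shows "difference_functional P N = difference_functional P' N' \<longleftrightarrow> add_measure P N' = add_measure P' N"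
proof
  assume eq: "difference_functional P N = difference_functional P' N'"
  show "add_measure P N' = add_measure P' N"
  proof (rule measure_eq_of_Cc)
    fix f :: "'a \<Rightarrow> real" assume f: "f \<in> Cc"
    then show "(\<integral>x. f x \<partial>add_measure P N') = (\<integral>x. f x \<partial>add_measure P' N)"
      using fun_cong[OF eq, of f] lf by (simp add: integral_add_measure difference_functional_def)
  qed (use lf locally_finite_add in auto)
next
  assume eq: "add_measure P N' = add_measure P' N"
  show "difference_functional P N = difference_functional P' N'"
  proof
    fix f :: "'a \<Rightarrow> real"
    show "difference_functional P N f = difference_functional P' N' f"
    proof (cases "f \<in> Cc")
      case True
      then show ?thesis using arg_cong[OF eq, of "\<lambda>M. \<integral>x. f x \<partial>M"] lf
        by (simp add: integral_add_measure difference_functional_def)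
    qed (simp add: difference_functional_def)
  qed
qed

lemma mutually_singular_sym:
  assumes "mutually_singular P Q" shows "mutually_singular Q P"
proof -
  obtain H where "H \<in> sets borel" "emeasure P (- H) = 0" "emeasure Q H = 0"
    using assms by (auto simp: mutually_singular_def)
  then show ?thesis unfolding mutually_singular_def by (intro bexI[of _ "- H"]) auto
qed

lemma add_measure_commute: "add_measure M N = add_measure N M"
  by (simp add: add_measure_def add.commute)

lemma hahn_jordan_difference_functional:
  fixes P Q :: "'a measure"
  assumes P: "locally_finite_measure P" and Q: "locally_finite_measure Q" and ms: "mutually_singular P Q"
  shows "hahn_jordan (difference_functional P Q) = (P, Q)"
  unfolding hahn_jordan_def
proof (rule the_equality)
  show "case (P, Q) of (P', N') \<Rightarrow> radon_measure P' \<and> radon_measure N' \<and> mutually_singular P' N' \<and>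
      difference_functional P Q = difference_functional P' N'"
    using assms by (simp add: radon_measure_iff)
next
  fix p assume "case p of (P', N') \<Rightarrow> radon_measure P' \<and> radon_measure N' \<and> mutually_singular P' N' \<and>
      difference_functional P Q = difference_functional P' N'"
  moreover obtain P' Q' where p: "p = (P', Q')" by (cases p)
  ultimately have *: "locally_finite_measure P'" "locally_finite_measure Q'" "mutually_singular P' Q'"
    "difference_functional P Q = difference_functional P' Q'" by (auto simp: radon_measure_iff)
  have eq: "add_measure P Q' = add_measure P' Q"
    using difference_functional_eq_iff[OF P Q *(1,2)] *(4) by blast
  then have eq': "add_measure Q P' = add_measure Q' P" by (metis add_measure_commute)
  have "P = P'" by (rule jordan_decomposition_unique[OF P Q *(1,2) ms *(3) eq])
  moreover have "Q = Q'"
    by (rule jordan_decomposition_unique[OF Q P *(2,1) mutually_singular_sym[OF ms] mutually_singular_sym[OF *(3)] eq'])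
  ultimately show "p = (P, Q)" by (simp add: p)
qed

lemma difference_functional_jordan:
  fixes M N :: "'a measure"
  assumes "locally_finite_measure M" "locally_finite_measure N"
  obtains P Q R where "locally_finite_measure P" "locally_finite_measure Q" "locally_finite_measure R"
    "M = add_measure P R" "N = add_measure Q R"
    "hahn_jordan (difference_functional M N) = (P, Q)" "mutually_singular P Q"
    "difference_functional M N = difference_functional P Q"
proof -
  obtain P Q R where d: "locally_finite_measure P" "locally_finite_measure Q" "locally_finite_measure R"
    "mutually_singular P Q" "M = add_measure P R" "N = add_measure Q R"
    by (rule jordan_decomposition_exists[OF assms])
  note s = d(1-3)[THEN locally_finite_sets]
  have "add_measure M Q = add_measure P N"
    by (rule measure_eqI) (auto simp: d(5,6) emeasure_add_measure s ac_simps)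
  then have eq: "difference_functional M N = difference_functional P Q"
    using difference_functional_eq_iff[OF assms d(1,2)] by blast
  show thesis
    by (rule that[OF d(1-3,5,6) _ d(4) eq]) (simp only: eq hahn_jordan_difference_functional[OF d(1,2,4)])
qed

lemma signed_measure_parts:
  fixes \<mu> :: "'a functional"
  assumes "\<mu> \<in> signed_measures"
  shows "locally_finite_measure (pos_measure \<mu>)" "locally_finite_measure (neg_measure \<mu>)"
    "\<mu> = difference_functional (pos_measure \<mu>) (neg_measure \<mu>)"
proof -
  obtain M N where MN: "\<mu> = difference_functional M N" "locally_finite_measure M" "locally_finite_measure N"
    using assms by (auto simp: signed_measures_def radon_measure_iff)
  obtain P Q R where "locally_finite_measure P" "locally_finite_measure Q"
    "hahn_jordan \<mu> = (P, Q)" "\<mu> = difference_functional P Q"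
    unfolding MN(1) by (rule difference_functional_jordan[OF MN(2,3)])
  then show "locally_finite_measure (pos_measure \<mu>)" "locally_finite_measure (neg_measure \<mu>)"
    "\<mu> = difference_functional (pos_measure \<mu>) (neg_measure \<mu>)"
    by (simp_all add: pos_measure_def neg_measure_def)
qed

lemma parts_functional_of:
  fixes M :: "'a measure"
  assumes "locally_finite_measure M"
  shows "pos_measure (functional_of M) = M" "neg_measure (functional_of M) = null_measure borel"
proof -
  have "mutually_singular M (null_measure borel)"
    unfolding mutually_singular_def by (intro bexI[of _ UNIV]) auto
  then have "hahn_jordan (functional_of M) = (M, null_measure borel)"
    by (intro hahn_jordan_difference_functional assms locally_finite_null)
  then show "pos_measure (functional_of M) = M" "neg_measure (functional_of M) = null_measure borel"
    by (simp_all add: pos_measure_def neg_measure_def)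
qed

lemma functional_of_positive:
  fixes M :: "'a measure"
  assumes "locally_finite_measure M"
  shows "functional_of M \<in> positive_measures"
  using assms locally_finite_null radon_measure_iff
  by (auto simp: positive_measures_def signed_measures_def functional_of_apply)

lemma positive_functional_radon:
  fixes \<phi> :: "'a functional"
  assumes "\<And>f. f \<in> Cc \<Longrightarrow> (\<And>x. 0 \<le> f x) \<Longrightarrow> 0 \<le> \<phi> f"
    "\<And>f g. f \<in> Cc \<Longrightarrow> g \<in> Cc \<Longrightarrow> \<phi> (\<lambda>x. f x + g x) = \<phi> f + \<phi> g"
    "\<And>c f. f \<in> Cc \<Longrightarrow> \<phi> (\<lambda>x. c * f x) = c * \<phi> f"
    "\<And>f. f \<notin> Cc \<Longrightarrow> \<phi> f = 0"
  obtains M where "locally_finite_measure M" "\<phi> = functional_of M"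
proof -
  interpret positive_functional ty \<phi>
    by unfold_locales (use assms in auto)
  show thesis
  proof (rule that[OF radon_imp_locally_finite[OF radon_riesz]])
    show "\<phi> = functional_of riesz_measure"
    proof
      fix f show "\<phi> f = functional_of riesz_measure f"
        by (cases "f \<in> Cc")
          (auto simp: functional_of_apply riesz_representation assms(4) difference_functional_def)
    qed
  qed
qed

lemma positive_measure_obtain:
  fixes \<mu> :: "'a functional"
  assumes "\<mu> \<in> positive_measures"
  obtains M where "locally_finite_measure M" "\<mu> = functional_of M"
proof -
  obtain P N where PN: "\<mu> = difference_functional P N" "locally_finite_measure P" "locally_finite_measure N"
    and pos: "\<And>f. f \<in> Cc \<Longrightarrow> (\<And>x. 0 \<le> f x) \<Longrightarrow> 0 \<le> \<mu> f"
    using assms by (auto simp: positive_measures_def signed_measures_def radon_measure_iff)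
  show thesis
  proof (rule positive_functional_radon[OF pos _ _ _ that])
    show "\<mu> (\<lambda>x. f x + g x) = \<mu> f + \<mu> g" if "f \<in> Cc" "g \<in> Cc" for f g
      using that Cc_add[OF that]
        Bochner_Integration.integral_add[OF Cc_integrable[OF PN(2) that(1)] Cc_integrable[OF PN(2) that(2)]]
        Bochner_Integration.integral_add[OF Cc_integrable[OF PN(3) that(1)] Cc_integrable[OF PN(3) that(2)]]
      by (simp add: PN(1) difference_functional_def)
    show "\<mu> (\<lambda>x. c * f x) = c * \<mu> f" if "f \<in> Cc" for c f
      using that Cc_cmult[OF that, of c] PN by (simp add: difference_functional_def right_diff_distrib)
    show "\<mu> f = 0" if "f \<notin> Cc" for f
      using that by (simp add: PN(1) difference_functional_def)
  qed
qed

end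

section \<open>Mutual energies\<close>

locale kernel_space = lcsc_space ty for ty :: "'a::{t2_space, second_countable_topology} itself" +
  fixes \<kappa> :: "'a \<Rightarrow> 'a \<Rightarrow> ennreal"
  assumes kernel: "potential_kernel \<kappa>"
    and energy_principle: "energy_principle \<kappa>"
    and consistency_principle: "consistency_principle \<kappa>"
    and domination_principle: "domination_principle \<kappa>"
begin

abbreviation pint :: "'a measure \<Rightarrow> 'a measure \<Rightarrow> ennreal" where
  "pint \<equiv> product_integral \<kappa>"

lemma kernel_measurable: "(\<lambda>(x, y). \<kappa> x y) \<in> borel_measurable (borel \<Otimes>\<^sub>M borel)"
proof (rule borel_measurableI_greater)
  fix a
  have "open {p. a < (case p of (x, y) \<Rightarrow> \<kappa> x y)}"
    using kernel by (simp add: potential_kernel_def case_prod_unfold)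
  then show "{p \<in> space (borel \<Otimes>\<^sub>M borel). a < (case p of (x, y) \<Rightarrow> \<kappa> x y)} \<in> sets (borel \<Otimes>\<^sub>M borel)"
    unfolding borel_prod by simp
qed

lemma kernel_sym: "\<kappa> x y = \<kappa> y x"
  using kernel by (simp add: potential_kernel_def)

lemma kernel_measurable_pair:
  assumes "locally_finite_measure M" "locally_finite_measure N"
  shows "(\<lambda>(x, y). \<kappa> x y) \<in> borel_measurable (M \<Otimes>\<^sub>M N)"
  using kernel_measurable
    measurable_cong_sets[OF sets_pair_measure_cong[OF assms[THEN locally_finite_sets]] refl] by blast

lemma kernel_section_measurable [measurable]: "\<kappa> x \<in> borel_measurable borel"
  using measurable_Pair2[OF kernel_measurable, of x] by simp

lemma potential_measurable [measurable]:
  assumes "locally_finite_measure M"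
  shows "pos_potential \<kappa> M \<in> borel_measurable borel"
proof -
  interpret sigma_finite_measure M by (rule locally_finite_sigma_finite[OF assms])
  have "(\<lambda>(x, y). \<kappa> x y) \<in> borel_measurable (borel \<Otimes>\<^sub>M M)"
    using kernel_measurable
      measurable_cong_sets[OF sets_pair_measure_cong[OF refl locally_finite_sets[OF assms]] refl] by blast
  then show ?thesis unfolding pos_potential_def
    by (rule borel_measurable_nn_integral)
qed

lemma pint_iterated:
  assumes M: "locally_finite_measure M" and N: "locally_finite_measure N"
  shows "pint M N = (\<integral>\<^sup>+x. pos_potential \<kappa> N x \<partial>M)"
proof -
  interpret sigma_finite_measure N by (rule locally_finite_sigma_finite[OF N])
  show ?thesis
    unfolding product_integral_def pos_potential_def
    using nn_integral_fst[OF kernel_measurable_pair[OF M N]] by simp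
qed

lemma pint_commute:
  assumes M: "locally_finite_measure M" and N: "locally_finite_measure N"
  shows "pint M N = pint N M"
proof -
  interpret pair_sigma_finite M N
    by (intro pair_sigma_finite.intro locally_finite_sigma_finite M N)
  have "(\<integral>\<^sup>+y. \<integral>\<^sup>+x. \<kappa> x y \<partial>M \<partial>N) = (\<integral>\<^sup>+x. \<integral>\<^sup>+y. \<kappa> x y \<partial>N \<partial>M)"
    using Fubini'[OF kernel_measurable_pair[OF M N]] by simp
  then show ?thesis
    using kernel_sym by (simp add: pint_iterated[OF M N] pint_iterated[OF N M] pos_potential_def)
qed

lemma pint_add_left:
  assumes "locally_finite_measure M" "locally_finite_measure M'" "locally_finite_measure N"
  shows "pint (add_measure M M') N = pint M N + pint M' N"
  using assms
  by (simp add: pint_iterated locally_finite_add nn_integral_add_measure locally_finite_sets)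

lemma pint_add_right:
  assumes "locally_finite_measure M" "locally_finite_measure N" "locally_finite_measure N'"
  shows "pint M (add_measure N N') = pint M N + pint M N'"
  using assms pint_add_left[of N N' M]
  by (simp add: pint_commute[of M] locally_finite_add)

lemma pint_scale_left:
  assumes "locally_finite_measure M" "locally_finite_measure N"
  shows "pint (scale_measure (ennreal c) M) N = ennreal c * pint M N"
proof -
  have "pos_potential \<kappa> N \<in> borel_measurable M"
    using measurable_cong_sets[OF locally_finite_sets[OF assms(1)] refl] potential_measurable[OF assms(2)] by blast
  then show ?thesis
    using assms by (simp add: pint_iterated locally_finite_scale nn_integral_scale_measure)
qed

lemma pint_restrict_left:
  assumes "locally_finite_measure M" "locally_finite_measure N" "B \<in> sets borel"
  shows "pint (restrict_to M B) N = (\<integral>\<^sup>+x. pos_potential \<kappa> N x * indicator B x \<partial>M)"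
proof -
  have m: "pos_potential \<kappa> N \<in> borel_measurable M" "B \<in> sets M"
    using assms(3) measurable_cong_sets[OF locally_finite_sets[OF assms(1)] refl] potential_measurable[OF assms(2)]
      locally_finite_sets[OF assms(1)] by auto
  show ?thesis
    using assms m by (simp add: pint_iterated locally_finite_restrict nn_integral_density mult.commute)
qed

lemma pint_null: "locally_finite_measure M \<Longrightarrow> pint (null_measure borel) M = 0"
  by (simp add: pint_iterated locally_finite_null)

definition energy_cone :: "'a measure set" where
  "energy_cone = {M. locally_finite_measure M \<and> pint M M < \<infinity>}"

lemma cone_locally_finite: "M \<in> energy_cone \<Longrightarrow> locally_finite_measure M"
  by (simp add: energy_cone_def)

lemmas cone_sets = locally_finite_sets[OF cone_locally_finite]

definition ip :: "'a measure \<Rightarrow> 'a measure \<Rightarrow> real" where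
  "ip M N = enn2real (pint M N)"

text \<open>The energy of the signed measure \<open>M - N\<close>. Expressing it by measures in the cone avoids computing with
  Jordan decompositions.\<close>

definition dist2 :: "'a measure \<Rightarrow> 'a measure \<Rightarrow> real" where
  "dist2 M N = ip M M - 2 * ip M N + ip N N"

lemma energies_of_difference:
  assumes M: "locally_finite_measure M" and N: "locally_finite_measure N"
    and PQ: "hahn_jordan (difference_functional M N) = (P, Q)"
    and P: "locally_finite_measure P" and Q: "locally_finite_measure Q"
  shows "pos_energy \<kappa> (difference_functional M N) (difference_functional M N) = pint P P + pint Q Q"
    "neg_energy \<kappa> (difference_functional M N) (difference_functional M N) = 2 * pint P Q"
  using PQ pint_commute[OF Q P] by (simp_all add: pos_energy_def neg_energy_def pos_measure_def neg_measure_def mult_2)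

lemma difference_signed:
  fixes M N :: "'a measure"
  assumes "locally_finite_measure M" "locally_finite_measure N"
  shows "difference_functional M N \<in> signed_measures"
  using assms by (auto simp: signed_measures_def radon_measure_iff)

text \<open>The energy principle, applied to the difference of two measures of finite energy, bounds the
  mutual energy of the singular parts; the common part contributes only finite terms. This is what
  makes the mutual energy a finite, positive definite form.\<close>

lemma energy_cone_pint:
  assumes "M \<in> energy_cone" "N \<in> energy_cone"
  shows "pint M N < \<infinity>" "0 \<le> dist2 M N" "dist2 M N = 0 \<Longrightarrow> M = N"
    "energy_norm \<kappa> (difference_functional M N) = sqrt (dist2 M N)"
proof -
  have M: "locally_finite_measure M" "pint M M < \<infinity>" and N: "locally_finite_measure N" "pint N N < \<infinity>"
    using assms by (auto simp: energy_cone_def)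
  obtain P Q R where P: "locally_finite_measure P" and Q: "locally_finite_measure Q" and R: "locally_finite_measure R"
    and MPR: "M = add_measure P R" and NQR: "N = add_measure Q R"
    and hj: "hahn_jordan (difference_functional M N) = (P, Q)" and ms: "mutually_singular P Q"
    and eq: "difference_functional M N = difference_functional P Q"
    by (rule difference_functional_jordan[OF M(1) N(1)])
  let ?\<sigma> = "difference_functional M N"
  note en = energies_of_difference[OF M(1) N(1) hj P Q]
  have MM: "pint M M = pint P P + 2 * pint P R + pint R R"
    unfolding MPR using P R by (simp add: pint_add_left pint_add_right locally_finite_add pint_commute[OF R P] mult_2 ac_simps)
  have NN: "pint N N = pint Q Q + 2 * pint Q R + pint R R"
    unfolding NQR using Q R by (simp add: pint_add_left pint_add_right locally_finite_add pint_commute[OF R Q] mult_2 ac_simps)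
  have MN: "pint M N = pint P Q + pint P R + pint Q R + pint R R"
    unfolding MPR NQR using P Q R by (simp add: pint_add_left pint_add_right locally_finite_add pint_commute[OF R Q] ac_simps)
  have fin: "pint P P < top" "pint P R < top" "pint R R < top" "pint Q Q < top" "pint Q R < top"
    using M(2) N(2) unfolding MM NN by (auto simp: ennreal_mult_less_top mult_2)
  have def: "energy_defined \<kappa> ?\<sigma> ?\<sigma>"
    using fin by (simp add: energy_defined_def en less_top[symmetric])
  have ep: "0 \<le> mutual_energy \<kappa> ?\<sigma> ?\<sigma>" "mutual_energy \<kappa> ?\<sigma> ?\<sigma> = 0 \<Longrightarrow> ?\<sigma> = (\<lambda>f. 0)"
    using energy_principle difference_signed[OF M(1) N(1)] def by (auto simp: energy_principle_def)
  obtain p where p: "pint P P + pint Q Q = ennreal p" "0 \<le> p"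
    using fin(1,4) by (cases "pint P P + pint Q Q") auto
  have PQ: "pint P Q < top"
  proof (rule ccontr)
    assume "\<not> pint P Q < top"
    then have "pint P Q = top" by (simp add: less_top[symmetric])
    then have "mutual_energy \<kappa> ?\<sigma> ?\<sigma> = - \<infinity>"
      using p by (simp add: mutual_energy_def en ennreal_mult_top enn2ereal_ennreal)
    then show False using ep(1) by simp
  qed
  then show fMN: "pint M N < \<infinity>" using fin unfolding MN by simp
  obtain a b c d f g where r: "pint P P = ennreal a" "pint P R = ennreal b" "pint R R = ennreal c"
    "pint Q Q = ennreal d" "pint Q R = ennreal f" "pint P Q = ennreal g"
    and nn: "0 \<le> a" "0 \<le> b" "0 \<le> c" "0 \<le> d" "0 \<le> f" "0 \<le> g"
    using fin PQ by (auto simp: less_top_ennreal)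
  have me: "mutual_energy \<kappa> ?\<sigma> ?\<sigma> = ereal (a + d - 2 * g)"
    using nn by (simp add: mutual_energy_def en r ennreal_plus[symmetric] ennreal_mult[symmetric] enn2ereal_ennreal
        numeral_mult_ennreal del: ennreal_plus)
  have "ip M M = a + 2 * b + c" "ip N N = d + 2 * f + c" "ip M N = g + b + f + c"
    using nn unfolding ip_def MM NN MN r
    by (simp_all add: ennreal_plus[symmetric] numeral_mult_ennreal del: ennreal_plus)
  then have d2: "dist2 M N = a + d - 2 * g" by (simp add: dist2_def)
  show "0 \<le> dist2 M N" using ep(1) by (simp add: me d2)
  show "energy_norm \<kappa> ?\<sigma> = sqrt (dist2 M N)" by (simp add: energy_norm_def me d2)
  assume "dist2 M N = 0"
  then have "?\<sigma> = (\<lambda>f. 0)" using ep(2) by (simp add: me d2 zero_ereal_def)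
  also have "\<dots> = difference_functional (null_measure borel) (null_measure borel)"
    by (auto simp: difference_functional_def fun_eq_iff)
  finally have "add_measure M (null_measure borel) = add_measure (null_measure borel) N"
    using difference_functional_eq_iff[OF M(1) N(1) locally_finite_null locally_finite_null] by blast
  then show "M = N"
    using arg_cong[where f = "\<lambda>M. emeasure M _"] M(1) N(1)
    by (intro measure_eqI) (simp_all add: locally_finite_sets emeasure_add_measure[symmetric],
       metis add.left_neutral add.right_neutral emeasure_add_measure emeasure_null_measure locally_finite_sets sets_null_measure)
qed

lemma ip_ennreal: "M \<in> energy_cone \<Longrightarrow> N \<in> energy_cone \<Longrightarrow> ennreal (ip M N) = pint M N"
  using energy_cone_pint(1)[of M N] by (simp add: ip_def)

lemma ip_nonneg: "0 \<le> ip M N" by (simp add: ip_def)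

lemma ip_commute: "M \<in> energy_cone \<Longrightarrow> N \<in> energy_cone \<Longrightarrow> ip M N = ip N M"
  using pint_commute[of M N] by (simp add: ip_def cone_locally_finite)

lemma cone_add:
  assumes "M \<in> energy_cone" "N \<in> energy_cone"
  shows "add_measure M N \<in> energy_cone"
  using assms energy_cone_pint(1)[OF assms] energy_cone_pint(1)[OF assms(2,1)] unfolding energy_cone_def
  by (simp add: locally_finite_add pint_add_left pint_add_right)

lemma cone_scale:
  assumes "M \<in> energy_cone"
  shows "scale_measure (ennreal c) M \<in> energy_cone"
proof -
  have M: "locally_finite_measure M" "pint M M < \<infinity>" using assms by (auto simp: energy_cone_def)
  have "pint (scale_measure (ennreal c) M) (scale_measure (ennreal c) M) = ennreal c * (ennreal c * pint M M)"
    using M(1) pint_commute[OF M(1) locally_finite_scale[OF M(1)]]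
    by (simp add: pint_scale_left locally_finite_scale)
  then show ?thesis using M by (simp add: energy_cone_def locally_finite_scale ennreal_mult_less_top)
qed

lemma cone_null: "null_measure borel \<in> energy_cone"
  by (simp add: energy_cone_def locally_finite_null pint_null)

lemma pint_restrict_le:
  assumes "locally_finite_measure M" "locally_finite_measure N" "B \<in> sets borel"
  shows "pint (restrict_to M B) N \<le> pint M N"
  unfolding pint_restrict_left[OF assms] pint_iterated[OF assms(1,2)]
  by (intro nn_integral_mono) (auto simp: indicator_def)

lemma cone_restrict:
  assumes "M \<in> energy_cone" "B \<in> sets borel"
  shows "restrict_to M B \<in> energy_cone"
proof -
  have M: "locally_finite_measure M" "pint M M < \<infinity>" using assms by (auto simp: energy_cone_def)
  have R: "locally_finite_measure (restrict_to M B)" by (rule locally_finite_restrict[OF M(1) assms(2)])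
  have "pint (restrict_to M B) (restrict_to M B) \<le> pint M (restrict_to M B)" by (rule pint_restrict_le[OF M(1) R assms(2)])
  also have "\<dots> = pint (restrict_to M B) M" by (rule pint_commute[OF M(1) R])
  also have "\<dots> \<le> pint M M" by (rule pint_restrict_le[OF M(1) M(1) assms(2)])
  finally show ?thesis using M R by (simp add: energy_cone_def le_less_trans)
qed

lemma ip_restrict_le:
  assumes "M \<in> energy_cone" "N \<in> energy_cone" "B \<in> sets borel"
  shows "ip (restrict_to M B) N \<le> ip M N"
  using pint_restrict_le[of M N B] assms cone_restrict
  by (metis cone_locally_finite ennreal_le_iff ip_ennreal ip_nonneg)

lemma ip_add_left:
  assumes "M \<in> energy_cone" "M' \<in> energy_cone" "N \<in> energy_cone"
  shows "ip (add_measure M M') N = ip M N + ip M' N"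
  using assms energy_cone_pint(1)[of M N] energy_cone_pint(1)[of M' N]
  by (simp add: ip_def pint_add_left cone_locally_finite enn2real_plus)

lemma ip_add_right:
  assumes "M \<in> energy_cone" "N \<in> energy_cone" "N' \<in> energy_cone"
  shows "ip M (add_measure N N') = ip M N + ip M N'"
  using assms ip_add_left[of N N' M] ip_commute cone_add by simp

lemma ip_scale_left:
  assumes "M \<in> energy_cone" "N \<in> energy_cone" "0 \<le> c"
  shows "ip (scale_measure (ennreal c) M) N = c * ip M N"
  using assms by (simp add: ip_def pint_scale_left cone_locally_finite enn2real_mult)

lemma ip_scale_right:
  assumes "M \<in> energy_cone" "N \<in> energy_cone" "0 \<le> c"
  shows "ip M (scale_measure (ennreal c) N) = c * ip M N"
  using assms ip_scale_left[of N M c] ip_commute[OF assms(1) cone_scale[OF assms(2), of c]] ip_commute[OF assms(1,2)]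
  by simp

lemmas ip_simps = ip_add_left ip_add_right ip_scale_left ip_scale_right cone_add cone_scale

lemma ip_null: "M \<in> energy_cone \<Longrightarrow> ip (null_measure borel) M = 0"
  by (simp add: ip_def pint_null cone_locally_finite)

abbreviation mnorm :: "'a measure \<Rightarrow> real" where
  "mnorm M \<equiv> sqrt (ip M M)"

text \<open>The discriminant bound, from nonnegative arguments only, since only those are available in a cone.\<close>

lemma quadratic_bound:
  fixes x d e :: real
  assumes "\<And>s. 0 \<le> s \<Longrightarrow> 0 \<le> d - 2 * s * x + s\<^sup>2 * e" "0 \<le> d" "0 \<le> e"
  shows "x \<le> sqrt d * sqrt e"
proof (cases "x \<le> 0")
  case True
  then show ?thesis using assms(2,3) by (meson mult_nonneg_nonneg order_trans real_sqrt_ge_zero)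
next
  case False
  have "e \<noteq> 0"
  proof
    assume "e = 0"
    then have "0 \<le> d - 2 * ((d + 1) / (2 * x)) * x" using assms(1)[of "(d + 1) / (2 * x)"] assms(2) False by simp
    then show False using False by simp
  qed
  then have e: "0 < e" using assms(3) by simp
  have "0 \<le> d - 2 * (x / e) * x + (x / e)\<^sup>2 * e" using False e by (intro assms(1)) simp
  then have "x\<^sup>2 \<le> d * e" using e by (simp add: field_simps power2_eq_square)
  then have "x \<le> sqrt (d * e)" by (rule real_le_rsqrt)
  then show ?thesis by (simp add: real_sqrt_mult)
qed

lemma dist2_nonneg: "M \<in> energy_cone \<Longrightarrow> N \<in> energy_cone \<Longrightarrow> 0 \<le> dist2 M N"
  by (rule energy_cone_pint(2))

lemma dist2_commute: "M \<in> energy_cone \<Longrightarrow> N \<in> energy_cone \<Longrightarrow> dist2 M N = dist2 N M"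
  using ip_commute[of M N] by (simp add: dist2_def)

text \<open>The Cauchy--Schwarz inequality for \<open>M - N\<close> and \<open>T\<close>: the energy of \<open>M - (N + s T)\<close> is nonnegative.\<close>

lemma ip_diff_bound:
  assumes "M \<in> energy_cone" "N \<in> energy_cone" "T \<in> energy_cone"
  shows "\<bar>ip M T - ip N T\<bar> \<le> sqrt (dist2 M N) * mnorm T"
proof -
  have *: "ip A T - ip B T \<le> sqrt (dist2 A B) * mnorm T" if A: "A \<in> energy_cone" and B: "B \<in> energy_cone" for A B
  proof (rule quadratic_bound)
    fix s :: real assume s: "0 \<le> s"
    have "0 \<le> dist2 A (add_measure B (scale_measure (ennreal s) T))"
      using A B assms(3) by (intro dist2_nonneg cone_add cone_scale)
    also have "\<dots> = dist2 A B - 2 * s * (ip A T - ip B T) + s\<^sup>2 * ip T T"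
      using A B assms(3) s ip_commute[OF assms(3) B] by (simp add: dist2_def ip_simps power2_eq_square algebra_simps)
    finally show "0 \<le> dist2 A B - 2 * s * (ip A T - ip B T) + s\<^sup>2 * ip T T" .
  qed (use A B dist2_nonneg ip_nonneg in auto)
  show ?thesis using *[OF assms(1,2)] *[OF assms(2,1)] dist2_commute[OF assms(1,2)] by auto
qed

lemma cauchy_schwarz:
  assumes "M \<in> energy_cone" "N \<in> energy_cone"
  shows "ip M N \<le> mnorm M * mnorm N"
  using ip_diff_bound[OF assms(1) cone_null assms(2)] assms cone_null ip_null ip_commute[OF assms(1) cone_null]
  by (simp add: dist2_def ip_null)

lemma functional_of_finite_energy_iff:
  assumes "locally_finite_measure M"
  shows "functional_of M \<in> finite_energy \<kappa> \<longleftrightarrow> M \<in> energy_cone"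
proof -
  have "pos_energy \<kappa> (functional_of M) (functional_of M) = pint M M"
    "neg_energy \<kappa> (functional_of M) (functional_of M) = 0"
    using assms pint_commute[OF assms locally_finite_null]
    by (simp_all add: pos_energy_def neg_energy_def parts_functional_of pint_null locally_finite_null)
  moreover have "functional_of M \<in> signed_measures"
    using assms by (intro difference_signed locally_finite_null)
  ultimately show ?thesis using assms
    by (cases "pint M M")
      (auto simp: finite_energy_def energy_defined_def mutual_energy_def energy_cone_def zero_ennreal.rep_eq top_ereal_def)
qed

lemma mutual_energy_functional_of:
  assumes "M \<in> energy_cone"
  shows "mutual_energy \<kappa> (functional_of M) (functional_of M) = ereal (ip M M)"
proof -
  note M = cone_locally_finite[OF assms]
  have "pos_energy \<kappa> (functional_of M) (functional_of M) = ennreal (ip M M)"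
    "neg_energy \<kappa> (functional_of M) (functional_of M) = 0"
    using M pint_commute[OF M locally_finite_null]
    by (simp_all add: pos_energy_def neg_energy_def parts_functional_of pint_null locally_finite_null ip_ennreal assms)
  then show ?thesis by (simp add: mutual_energy_def ip_nonneg zero_ennreal.rep_eq)
qed

lemma finite_energy_pos_eq: "finite_energy_pos \<kappa> = functional_of ` energy_cone"
proof
  show "functional_of ` energy_cone \<subseteq> finite_energy_pos \<kappa>"
    by (auto simp: finite_energy_pos_def functional_of_positive cone_locally_finite functional_of_finite_energy_iff)
  show "finite_energy_pos \<kappa> \<subseteq> functional_of ` energy_cone"
  proof
    fix \<mu> assume "\<mu> \<in> finite_energy_pos \<kappa>"
    then have \<mu>: "\<mu> \<in> finite_energy \<kappa>" "\<mu> \<in> positive_measures" by (auto simp: finite_energy_pos_def)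
    obtain M where "locally_finite_measure M" "\<mu> = functional_of M" by (rule positive_measure_obtain[OF \<mu>(2)])
    then show "\<mu> \<in> functional_of ` energy_cone" using \<mu>(1) functional_of_finite_energy_iff by blast
  qed
qed

section \<open>Strong completeness\<close>

text \<open>Otherwise the unit mass at \<open>x\<close> would be a nonzero measure of energy zero.\<close>

lemma kernel_diagonal_pos: "0 < \<kappa> x x"
proof (rule ccontr)
  assume "\<not> 0 < \<kappa> x x"
  then have z: "\<kappa> x x = 0" by simp
  \<comment> \<open>the unit mass at \<open>x\<close>\<close>
  let ?D = "distr (count_space {()}) borel (\<lambda>_. x)"
  have D: "locally_finite_measure ?D"
    by (auto simp: locally_finite_measure_def compact_borel emeasure_distr emeasure_count_space_finite)
  have "pos_potential \<kappa> ?D x = 0"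
    using z by (simp add: pos_potential_def nn_integral_distr nn_integral_count_space_finite)
  then have pD: "pint ?D ?D = 0"
    using potential_measurable[OF D]
    by (simp add: pint_iterated[OF D D] nn_integral_distr nn_integral_count_space_finite)
  have en: "pos_energy \<kappa> (functional_of ?D) (functional_of ?D) = 0" "neg_energy \<kappa> (functional_of ?D) (functional_of ?D) = 0"
    using D pD pint_commute[OF D locally_finite_null]
    by (simp_all add: pos_energy_def neg_energy_def parts_functional_of pint_null locally_finite_null)
  have "functional_of ?D = (\<lambda>f. 0)"
    using energy_principle difference_signed[OF D locally_finite_null] en
    by (auto simp: energy_principle_def energy_defined_def mutual_energy_def)
  moreover obtain g :: "'a \<Rightarrow> real" where "g \<in> Cc" "\<And>y. y \<in> {x} \<Longrightarrow> g y = 1"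
    by (rule bump_function[OF compact_sing[of x] open_UNIV subset_UNIV]) blast
  moreover have "functional_of ?D g = g x" if "g \<in> Cc" for g
    using Cc_measurable[OF that]
    by (simp add: functional_of_apply[OF that] integral_distr lebesgue_integral_count_space_finite)
  ultimately show False by (metis singletonI zero_neq_one)
qed

text \<open>Near a diagonal point the kernel is bounded below, so the mass near that point is controlled by
  the energy.\<close>

lemma mass_bound_near:
  obtains U C where "open U" "x \<in> U" "0 \<le> C" "\<And>M. M \<in> energy_cone \<Longrightarrow> emeasure M U \<le> ennreal (C * mnorm M)"
proof -
  obtain \<delta> where d: "0 < \<delta>" "\<delta> < \<kappa> x x" using dense[OF kernel_diagonal_pos] by blast
  then obtain r where r: "\<delta> = ennreal r" "0 < r" by (cases \<delta>) auto
  have "open {(x, y). \<delta> < \<kappa> x y}" using kernel by (simp add: potential_kernel_def)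
  moreover have "(x, x) \<in> {(x, y). \<delta> < \<kappa> x y}" using d by simp
  ultimately obtain A B where AB: "open A" "open B" "x \<in> A" "x \<in> B" "A \<times> B \<subseteq> {(x, y). \<delta> < \<kappa> x y}"
    by (rule open_prod_elim) auto
  define U where "U = A \<inter> B"
  have U: "open U" "x \<in> U" "\<And>y z. y \<in> U \<Longrightarrow> z \<in> U \<Longrightarrow> \<delta> \<le> \<kappa> y z"
    using AB by (auto simp: U_def intro!: less_imp_le)
  have "emeasure M U \<le> ennreal (1 / sqrt r * mnorm M)" if M: "M \<in> energy_cone" for M
  proof -
    have lf: "locally_finite_measure M" by (rule cone_locally_finite[OF M])
    have Us: "U \<in> sets borel" using U(1) by simp
    have pot: "\<delta> * emeasure M U \<le> pos_potential \<kappa> M y" if "y \<in> U" for y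
    proof -
      have "\<delta> * emeasure M U = (\<integral>\<^sup>+z. \<delta> * indicator U z \<partial>M)"
        using Us locally_finite_sets[OF lf] by (simp add: nn_integral_cmult_indicator)
      also have "\<dots> \<le> pos_potential \<kappa> M y"
        unfolding pos_potential_def using U(3)[OF that] by (intro nn_integral_mono) (auto simp: indicator_def)
      finally show ?thesis .
    qed
    have "\<delta> * emeasure M U * emeasure M U = (\<integral>\<^sup>+y. \<delta> * emeasure M U * indicator U y \<partial>M)"
      using Us locally_finite_sets[OF lf] by (simp add: nn_integral_cmult_indicator)
    also have "\<dots> \<le> pint M M"
      unfolding pint_iterated[OF lf lf] using pot by (intro nn_integral_mono) (auto simp: indicator_def)
    also have "\<dots> = ennreal (ip M M)" by (simp add: ip_ennreal M)
    finally have *: "\<delta> * emeasure M U * emeasure M U \<le> ennreal (ip M M)" .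
    have "emeasure M U \<noteq> top"
    proof
      assume "emeasure M U = top"
      moreover have "\<delta> \<noteq> 0" using d(1) by simp
      ultimately show False using * by (simp add: ennreal_mult_top ennreal_top_mult top_unique)
    qed
    then obtain m where m: "emeasure M U = ennreal m" "0 \<le> m" by (cases "emeasure M U") auto
    have "r * m * m \<le> ip M M" using * r m ip_nonneg[of M M] by (simp add: ennreal_mult[symmetric])
    moreover have "(sqrt r * m)\<^sup>2 = r * m * m" using r by (simp add: power_mult_distrib) (simp add: power2_eq_square)
    ultimately have "(sqrt r * m)\<^sup>2 \<le> ip M M" by simp
    then have "sqrt r * m \<le> mnorm M" by (rule real_le_rsqrt)
    then have "m \<le> 1 / sqrt r * mnorm M" using r by (simp add: field_simps)
    then show ?thesis by (simp add: m ennreal_leI)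
  qed
  then show thesis using U r by (intro that[of U "1 / sqrt r"]) auto
qed

lemma mass_bound:
  assumes "compact K"
  obtains C where "0 \<le> C" "\<And>M. M \<in> energy_cone \<Longrightarrow> measure M K \<le> C * mnorm M"
proof -
  obtain U C where UC: "\<And>x. open (U x) \<and> x \<in> U x \<and> 0 \<le> C x"
    "\<And>x M. M \<in> energy_cone \<Longrightarrow> emeasure M (U x) \<le> ennreal (C x * mnorm M)"
  proof -
    have "\<exists>U C. (open U \<and> x \<in> U \<and> 0 \<le> C) \<and> (\<forall>M\<in>energy_cone. emeasure M U \<le> ennreal (C * mnorm M))" for x
      by (rule mass_bound_near[of x]) blast
    then show thesis using that by metis
  qed
  have "K \<subseteq> (\<Union>x\<in>K. U x)" using UC(1) by blast
  then obtain T where T: "finite T" "K \<subseteq> (\<Union>x\<in>T. U x)"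
    by (rule compactE_image[OF assms, of K U, rotated]) (use UC(1) in auto)
  have "measure M K \<le> (\<Sum>x\<in>T. C x) * mnorm M" if M: "M \<in> energy_cone" for M
  proof -
    have s: "sets M = sets borel" by (rule cone_sets[OF M])
    have "emeasure M K \<le> emeasure M (\<Union>x\<in>T. U x)"
      using T UC(1) s by (intro emeasure_mono) (auto intro!: sets.finite_UN)
    also have "\<dots> \<le> (\<Sum>x\<in>T. emeasure M (U x))"
      using T UC(1) s by (intro emeasure_subadditive_finite) auto
    also have "\<dots> \<le> (\<Sum>x\<in>T. ennreal (C x * mnorm M))" by (intro sum_mono UC(2) M)
    also have "\<dots> = ennreal ((\<Sum>x\<in>T. C x) * mnorm M)"
      using UC(1) by (subst sum_ennreal) (auto simp: sum_distrib_right ip_nonneg)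
    finally have "emeasure M K \<le> ennreal ((\<Sum>x\<in>T. C x) * mnorm M)" .
    moreover have "0 \<le> (\<Sum>x\<in>T. C x) * mnorm M" using UC(1) by (simp add: sum_nonneg ip_nonneg)
    ultimately show ?thesis unfolding measure_def by (rule enn2real_leI[rotated])
  qed
  then show thesis using UC(1) by (intro that[of "\<Sum>x\<in>T. C x"]) (auto simp: sum_nonneg)
qed

lemma integral_bound:
  assumes f: "f \<in> Cc"
  obtains C where "0 \<le> C" "\<And>M. M \<in> energy_cone \<Longrightarrow> \<bar>\<integral>x. f x \<partial>M\<bar> \<le> C * mnorm M"
proof -
  obtain K where K: "compact K" "\<And>x. x \<notin> K \<Longrightarrow> f x = 0" using Cc_obtain_compact[OF f] by blast
  obtain B where B: "B > 0" "\<And>x. \<bar>f x\<bar> \<le> B" using Cc_bounded[OF f] by blast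
  obtain C where C: "0 \<le> C" "\<And>M. M \<in> energy_cone \<Longrightarrow> measure M K \<le> C * mnorm M"
    by (rule mass_bound[OF K(1)]) blast
  have "\<bar>\<integral>x. f x \<partial>M\<bar> \<le> (B * C) * mnorm M" if M: "M \<in> energy_cone" for M
  proof -
    have lf: "locally_finite_measure M" by (rule cone_locally_finite[OF M])
    have Ks: "K \<in> sets M" using compact_borel[OF K(1)] locally_finite_sets[OF lf] by simp
    have "\<bar>\<integral>x. f x \<partial>M\<bar> \<le> (\<integral>x. \<bar>f x\<bar> \<partial>M)" by (rule integral_abs_bound)
    also have "\<dots> \<le> (\<integral>x. B * indicator K x \<partial>M)"
    proof (rule integral_mono)
      show "integrable M (\<lambda>x. \<bar>f x\<bar>)" using Cc_integrable[OF lf f] by simp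
      show "integrable M (\<lambda>x. B * indicator K x)"
        using locally_finite_compact[OF lf K(1)] Ks by simp
      show "\<bar>f x\<bar> \<le> B * indicator K x" for x using B K(2)[of x] by (auto simp: indicator_def)
    qed
    also have "\<dots> = B * measure M K" using Ks by simp
    also have "\<dots> \<le> B * (C * mnorm M)" using B C(2)[OF M] by (intro mult_left_mono) auto
    finally show ?thesis by simp
  qed
  then show thesis using B C(1) by (intro that[of "B * C"]) auto
qed

definition cauchy_seq :: "(nat \<Rightarrow> 'a measure) \<Rightarrow> bool" where
  "cauchy_seq c \<longleftrightarrow> (\<forall>e>0. \<exists>N. \<forall>m\<ge>N. \<forall>n\<ge>N. dist2 (c m) (c n) < e)"

lemma norm_diff_le:
  assumes "M \<in> energy_cone" "N \<in> energy_cone"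
  shows "\<bar>mnorm M - mnorm N\<bar> \<le> sqrt (dist2 M N)"
proof -
  have "(mnorm M - mnorm N)\<^sup>2 \<le> dist2 M N"
    using cauchy_schwarz[OF assms] by (simp add: power2_diff dist2_def ip_nonneg)
  then show ?thesis by (metis abs_ge_zero power2_abs real_le_rsqrt)
qed

lemma cauchy_seq_bounded:
  assumes "\<And>n. c n \<in> energy_cone" "cauchy_seq c"
  obtains B where "\<And>n. mnorm (c n) \<le> B"
proof -
  obtain N where N: "\<And>m n. m \<ge> N \<Longrightarrow> n \<ge> N \<Longrightarrow> dist2 (c m) (c n) < 1"
    using assms(2) zero_less_one unfolding cauchy_seq_def by metis
  have tail: "mnorm (c n) \<le> mnorm (c N) + 1" if "n \<ge> N" for n
  proof -
    have "sqrt (dist2 (c n) (c N)) \<le> sqrt 1"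
      by (intro real_sqrt_le_mono less_imp_le N that order_refl)
    then have "sqrt (dist2 (c n) (c N)) \<le> 1" unfolding real_sqrt_one .
    then show ?thesis using norm_diff_le[OF assms(1) assms(1), of n N] by linarith
  qed
  have "mnorm (c n) \<le> max (Max ((\<lambda>n. mnorm (c n)) ` {..N})) (mnorm (c N) + 1)" for n
  proof (cases "n \<le> N")
    case True
    then have "mnorm (c n) \<le> Max ((\<lambda>n. mnorm (c n)) ` {..N})" by (intro Max_ge) auto
    then show ?thesis by simp
  next
    case False
    then show ?thesis using tail[of n] by simp
  qed
  then show thesis by (rule that)
qed

lemma cluster_point_closed:
  assumes "inf (nhds \<phi>) F \<noteq> bot" "closed Z" "eventually (\<lambda>x. x \<in> Z) F"
  shows "\<phi> \<in> Z"
proof (rule ccontr)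
  assume "\<phi> \<notin> Z"
  then have "eventually (\<lambda>x. x \<notin> Z) (nhds \<phi>)"
    using assms(2) by (intro eventually_nhds_in_open[of "- Z", simplified]) auto
  then have "eventually (\<lambda>x. False) (inf (nhds \<phi>) F)"
    using assms(3) unfolding eventually_inf by blast
  then show False using assms(1) by (simp add: eventually_False)
qed

text \<open>Norm bounded sets of measures are vaguely relatively compact by Tychonoff and the
  representation theorem, so a strong Cauchy sequence has a vague cluster point, to which it
  converges strongly by consistency. The cluster point also inherits every limit of integrals.\<close>

theorem strongly_complete:
  assumes c: "\<And>n. c n \<in> energy_cone" and cauchy: "cauchy_seq c"
  obtains M where "M \<in> energy_cone" "(\<lambda>n. dist2 (c n) M) \<longlonglongrightarrow> 0"
    "\<And>f l. f \<in> Cc \<Longrightarrow> (\<lambda>n. \<integral>x. f x \<partial>c n) \<longlonglongrightarrow> l \<Longrightarrow> (\<integral>x. f x \<partial>M) = l"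
proof -
  obtain B where B: "\<And>n. mnorm (c n) \<le> B" by (rule cauchy_seq_bounded[OF c cauchy]) blast
  have "\<exists>C. \<forall>n. \<bar>functional_of (c n) f\<bar> \<le> C" for f
  proof (cases "f \<in> Cc")
    case True
    obtain C where C: "0 \<le> C" "\<And>M. M \<in> energy_cone \<Longrightarrow> \<bar>\<integral>x. f x \<partial>M\<bar> \<le> C * mnorm M"
      by (rule integral_bound[OF True]) blast
    have "\<bar>\<integral>x. f x \<partial>c n\<bar> \<le> C * B" for n
      using C(2)[OF c[of n]] mult_left_mono[OF B C(1), of n] by linarith
    then show ?thesis using functional_of_apply[OF True] by metis
  qed (auto simp: difference_functional_def)
  then obtain C where C: "\<And>n f. \<bar>functional_of (c n) f\<bar> \<le> C f" by metis
  \<comment> \<open>a compact box of functionals containing the whole sequence\<close>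
  define S where "S = (\<Pi>\<^sub>E f\<in>UNIV. {- C f..C f})"
  have "compactin (product_topology (\<lambda>f. euclidean) UNIV) S"
    unfolding S_def compactin_PiE by simp
  then have S: "compact S" by (simp add: euclidean_product_topology)
  define F where "F = filtermap (\<lambda>n. functional_of (c n)) sequentially"
  have F: "F \<noteq> bot" by (simp add: F_def filtermap_bot_iff)
  have evS: "eventually (\<lambda>\<phi>. \<phi> \<in> S) F"
    unfolding F_def eventually_filtermap S_def using C
    by (intro always_eventually allI PiE_I) (auto simp: abs_le_iff minus_le_iff)
  obtain \<phi> where \<phi>: "inf (nhds \<phi>) F \<noteq> bot"
    using S F evS unfolding compact_filter by blast
  have closed: "\<phi> \<in> Z" if "closed Z" "eventually (\<lambda>n. functional_of (c n) \<in> Z) sequentially" for Z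
    using cluster_point_closed[OF \<phi> that(1)] that(2) by (simp add: F_def eventually_filtermap)
  have ev: "continuous_on UNIV (\<lambda>\<psi> :: 'a functional. \<psi> f)" for f
    by (rule continuous_on_product_coordinates)
  have "\<phi> \<in> {\<psi>. 0 \<le> \<psi> f}" if "f \<in> Cc" "\<And>x. 0 \<le> f x" for f
    using that by (intro closed closed_Collect_le continuous_on_const ev) (auto simp: functional_of_apply)
  moreover have "\<phi> \<in> {\<psi>. \<psi> (\<lambda>x. f x + g x) = \<psi> f + \<psi> g}" if "f \<in> Cc" "g \<in> Cc" for f g
    using that
    by (intro closed closed_Collect_eq continuous_on_add ev)
      (auto simp: functional_of_apply Cc_add Bochner_Integration.integral_add[OF Cc_integrable Cc_integrable]
        cone_locally_finite[OF c])
  moreover have "\<phi> \<in> {\<psi>. \<psi> (\<lambda>x. a * f x) = a * \<psi> f}" if "f \<in> Cc" for f a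
    using that
    by (intro closed closed_Collect_eq continuous_on_mult continuous_on_const ev) (auto simp: functional_of_apply Cc_cmult)
  moreover have "\<phi> \<in> {\<psi>. \<psi> f = 0}" if "f \<notin> Cc" for f
    using that by (intro closed closed_Collect_eq continuous_on_const ev) (auto simp: difference_functional_def)
  ultimately obtain M where M: "locally_finite_measure M" "\<phi> = functional_of M"
    by (auto intro: positive_functional_radon[of \<phi>])
  have cone: "F \<le> principal (finite_energy_pos \<kappa>)"
    unfolding F_def finite_energy_pos_eq le_principal eventually_filtermap using c by simp
  have diff: "functional_of M1 - functional_of M2 = difference_functional M1 M2" for M1 M2 :: "'a measure"
    by (auto simp: difference_functional_def fun_eq_iff integral_null_measure)
  have "strong_cauchy \<kappa> F"
    unfolding strong_cauchy_def
  proof (intro allI impI)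
    fix e :: real assume e: "0 < e"
    then obtain N where N: "\<And>m n. m \<ge> N \<Longrightarrow> n \<ge> N \<Longrightarrow> dist2 (c m) (c n) < e\<^sup>2"
      using cauchy unfolding cauchy_seq_def by (metis zero_less_power)
    have "energy_norm \<kappa> (functional_of (c m) - functional_of (c n)) < e" if "m \<ge> N" "n \<ge> N" for m n
      using N[OF that] e by (simp add: diff energy_cone_pint(4)[OF c c] real_less_lsqrt)
    then show "eventually (\<lambda>(\<mu>, \<nu>). energy_norm \<kappa> (\<mu> - \<nu>) < e) (F \<times>\<^sub>F F)"
      unfolding eventually_prod_filter F_def eventually_filtermap
      by (intro exI[of _ "\<lambda>\<mu>. \<mu> \<in> (\<lambda>n. functional_of (c n)) ` {N..}"])
        (auto simp: eventually_sequentially)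
  qed
  moreover have "\<phi> \<in> signed_measures" unfolding M(2) by (rule difference_signed[OF M(1) locally_finite_null])
  ultimately have *: "\<phi> \<in> finite_energy \<kappa>" "((\<lambda>\<mu>. energy_norm \<kappa> (\<mu> - \<phi>)) \<longlongrightarrow> 0) F"
    using consistency_principle F cone \<phi> unfolding consistency_principle_def vague_cluster_point_def by blast+
  have MC: "M \<in> energy_cone" using *(1) functional_of_finite_energy_iff[OF M(1)] M(2) by simp
  have "(\<lambda>n. sqrt (dist2 (c n) M)) \<longlonglongrightarrow> 0"
    using *(2) by (simp add: F_def filterlim_filtermap M(2) diff energy_cone_pint(4)[OF c MC])
  then have "(\<lambda>n. (sqrt (dist2 (c n) M))\<^sup>2) \<longlonglongrightarrow> 0\<^sup>2" by (intro tendsto_power)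
  then have lim: "(\<lambda>n. dist2 (c n) M) \<longlonglongrightarrow> 0" using dist2_nonneg[OF c MC] by simp
  show thesis
  proof (rule that[OF MC lim])
    fix f :: "'a \<Rightarrow> real" and l assume f: "f \<in> Cc" and l: "(\<lambda>n. \<integral>x. f x \<partial>c n) \<longlonglongrightarrow> l"
    have "\<bar>(\<integral>x. f x \<partial>M) - l\<bar> \<le> e" if e: "e > 0" for e
    proof -
      have "eventually (\<lambda>n. \<bar>(\<integral>x. f x \<partial>c n) - l\<bar> < e) sequentially"
        using tendstoD[OF l e] by (simp add: dist_real_def)
      then have "\<phi> \<in> {\<psi>. \<bar>\<psi> f - l\<bar> \<le> e}"
        by (intro closed closed_Collect_le continuous_intros ev)
          (auto simp: functional_of_apply[OF f] elim!: eventually_mono)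
      then show ?thesis by (simp add: M(2) functional_of_apply[OF f])
    qed
    then show "(\<integral>x. f x \<partial>M) = l"
      by (metis abs_ge_zero abs_le_zero_iff eq_iff_diff_eq_0 field_le_epsilon add_0)
  qed
qed

end

section \<open>Strong limits and projections\<close>

lemma AE_add_measure:
  assumes "sets M = sets borel" "sets N = sets borel" "AE x in M. P x" "AE x in N. P x"
  shows "AE x in add_measure M N. P x"
proof -
  have sp: "space M = UNIV" "space N = UNIV" using assms(1,2) by (auto dest: sets_eq_imp_space_eq)
  obtain A where A: "A \<in> null_sets M" "{x. \<not> P x} \<subseteq> A"
    using assms(3) by (auto simp: eventually_ae_filter sp)
  obtain B where B: "B \<in> null_sets N" "{x. \<not> P x} \<subseteq> B"
    using assms(4) by (auto simp: eventually_ae_filter sp)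
  have s: "A \<in> sets borel" "B \<in> sets borel" using A(1) B(1) assms(1,2) by (auto simp: null_sets_def)
  have "emeasure M (A \<inter> B) \<le> emeasure M A" "emeasure N (A \<inter> B) \<le> emeasure N B"
    using s assms(1,2) by (auto intro!: emeasure_mono)
  then have "A \<inter> B \<in> null_sets (add_measure M N)"
    using A(1) B(1) s assms(1,2) by (auto simp: null_sets_def emeasure_add_measure)
  then show ?thesis by (rule AE_I') (use A(2) B(2) in auto)
qed

lemma AE_scale_measure: "AE x in M. P x \<Longrightarrow> AE x in scale_measure c M. P x"
  by (auto simp: eventually_ae_filter null_sets_def space_scale_measure)

lemma AE_restrict:
  assumes "B \<in> sets M"
  shows "(AE x in restrict_to M B. P x) \<longleftrightarrow> (AE x in M. x \<in> B \<longrightarrow> P x)"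
  using assms by (subst AE_density) (auto simp: indicator_def intro!: AE_cong)

context kernel_space
begin

definition half_sum :: "'a measure \<Rightarrow> 'a measure \<Rightarrow> 'a measure" where
  "half_sum M N = scale_measure (ennreal (1/2)) (add_measure M N)"

lemma cone_half_sum: "M \<in> energy_cone \<Longrightarrow> N \<in> energy_cone \<Longrightarrow> half_sum M N \<in> energy_cone"
  unfolding half_sum_def by (intro cone_scale cone_add)

lemma ip_half_sum_left:
  assumes "M \<in> energy_cone" "N \<in> energy_cone" "T \<in> energy_cone"
  shows "ip (half_sum M N) T = (ip M T + ip N T) / 2"
  unfolding half_sum_def using assms ip_scale_left[of "add_measure M N" T "1/2"] by (simp add: ip_simps)

lemma ip_half_sum_right:
  assumes "M \<in> energy_cone" "N \<in> energy_cone" "T \<in> energy_cone"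
  shows "ip T (half_sum M N) = (ip T M + ip T N) / 2"
  using ip_half_sum_left[OF assms] assms by (simp add: ip_commute[of T] cone_half_sum)

lemma parallelogram:
  assumes "M \<in> energy_cone" "N \<in> energy_cone"
  shows "dist2 M N = 2 * ip M M + 2 * ip N N - 4 * ip (half_sum M N) (half_sum M N)"
  using assms ip_commute[OF assms]
  by (simp add: dist2_def ip_half_sum_left ip_half_sum_right cone_half_sum field_simps)

lemma ip_limit:
  assumes "\<And>n. c n \<in> energy_cone" "M \<in> energy_cone" "(\<lambda>n. dist2 (c n) M) \<longlonglongrightarrow> 0" "T \<in> energy_cone"
  shows "(\<lambda>n. ip (c n) T) \<longlonglongrightarrow> ip M T"
proof -
  have "(\<lambda>n. sqrt (dist2 (c n) M) * mnorm T) \<longlonglongrightarrow> sqrt 0 * mnorm T"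
    by (intro tendsto_mult tendsto_const tendsto_real_sqrt assms(3))
  then have lim: "(\<lambda>n. sqrt (dist2 (c n) M) * mnorm T) \<longlonglongrightarrow> 0" by simp
  have "(\<lambda>n. ip (c n) T - ip M T) \<longlonglongrightarrow> 0"
    by (rule Lim_null_comparison[OF _ lim]) (use ip_diff_bound[OF assms(1,2,4)] in auto)
  then show ?thesis by (simp add: LIM_zero_iff)
qed

lemma norm_limit:
  assumes "\<And>n. c n \<in> energy_cone" "M \<in> energy_cone" "(\<lambda>n. dist2 (c n) M) \<longlonglongrightarrow> 0"
  shows "(\<lambda>n. ip (c n) (c n)) \<longlonglongrightarrow> ip M M"
proof -
  have "(\<lambda>n. dist2 (c n) M + 2 * ip (c n) M - ip M M) \<longlonglongrightarrow> 0 + 2 * ip M M - ip M M"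
    by (intro tendsto_intros assms(3) ip_limit[OF assms assms(2)])
  then show ?thesis by (simp add: dist2_def)
qed

lemma strong_limit_unique:
  assumes c: "\<And>n. c n \<in> energy_cone" and M: "M \<in> energy_cone" and N: "N \<in> energy_cone"
    and "(\<lambda>n. dist2 (c n) M) \<longlonglongrightarrow> 0" "(\<lambda>n. dist2 (c n) N) \<longlonglongrightarrow> 0"
  shows "M = N"
proof (rule energy_cone_pint(3)[OF M N])
  have "ip M T = ip N T" if "T \<in> energy_cone" for T
    using LIMSEQ_unique[OF ip_limit[OF c M assms(4) that] ip_limit[OF c N assms(5) that]] .
  then show "dist2 M N = 0" using M N ip_commute[OF M N] by (simp add: dist2_def)
qed

lemma cauchy_seq_dominated:
  assumes "\<And>m n. dist2 (c m) (c n) \<le> \<bar>a m - a n\<bar>" "convergent a"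
  shows "cauchy_seq c"
  unfolding cauchy_seq_def
proof (intro allI impI)
  fix e :: real assume "e > 0"
  moreover have "Cauchy a" using assms(2) by (simp add: Cauchy_convergent_iff)
  ultimately obtain N where "\<forall>m\<ge>N. \<forall>n\<ge>N. dist (a m) (a n) < e" unfolding Cauchy_def by blast
  then show "\<exists>N. \<forall>m\<ge>N. \<forall>n\<ge>N. dist2 (c m) (c n) < e"
    using assms(1) unfolding dist_real_def by (meson le_less_trans)
qed

text \<open>The hypothesis bounds the energy of \<open>c m - c n\<close> by the difference of the energies of \<open>c m\<close> and \<open>c n\<close>,
  which converge.\<close>

lemma increasing_cauchy:
  assumes c: "\<And>n. c n \<in> energy_cone" and mono: "\<And>m n. n \<le> m \<Longrightarrow> ip (c n) (c n) \<le> ip (c m) (c n)"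
    and bound: "\<And>n. ip (c n) (c n) \<le> B"
  shows "cauchy_seq c"
proof -
  have d: "dist2 (c m) (c n) \<le> ip (c m) (c m) - ip (c n) (c n)" if "n \<le> m" for m n
    using mono[OF that] by (simp add: dist2_def)
  show ?thesis
  proof (rule cauchy_seq_dominated)
    show "dist2 (c m) (c n) \<le> \<bar>ip (c m) (c m) - ip (c n) (c n)\<bar>" for m n
      using d[of n m] d[of m n] dist2_commute[OF c c, of m n] by (cases "n \<le> m") auto
    have inc: "incseq (\<lambda>n. ip (c n) (c n))"
      using d dist2_nonneg[OF c c] by (intro incseq_SucI) (metis diff_ge_0_iff_ge le_Suc_eq order_refl order_trans)
    show "convergent (\<lambda>n. ip (c n) (c n))"
      using incseq_convergent[OF inc, of B] bound by (metis convergentI)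
  qed
qed

lemma decreasing_cauchy:
  assumes c: "\<And>n. c n \<in> energy_cone" and mono: "\<And>m n. n \<le> m \<Longrightarrow> ip (c m) (c m) \<le> ip (c n) (c m)"
  shows "cauchy_seq c"
proof -
  have d: "dist2 (c n) (c m) \<le> ip (c n) (c n) - ip (c m) (c m)" if "n \<le> m" for m n
    using mono[OF that] by (simp add: dist2_def)
  show ?thesis
  proof (rule cauchy_seq_dominated)
    show "dist2 (c m) (c n) \<le> \<bar>ip (c m) (c m) - ip (c n) (c n)\<bar>" for m n
      using d[of n m] d[of m n] dist2_commute[OF c c, of m n] by (cases "n \<le> m") auto
    have dec: "decseq (\<lambda>n. ip (c n) (c n))"
      using d dist2_nonneg[OF c c] by (intro decseq_SucI) (metis diff_ge_0_iff_ge le_Suc_eq order_refl order_trans)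
    then show "convergent (\<lambda>n. ip (c n) (c n))"
      using decseq_convergent[OF dec, of 0] ip_nonneg by (metis convergentI)
  qed
qed

text \<open>By the parallelogram law, the distance of two near minimizers is bounded by the difference of the
  infima over the two sets, and these infima converge. A constant sequence of sets gives projections, the
  hulls of the tails of a sequence give convergent convex combinations, and a sequence of competitor
  classes gives the continuity of a capacity along increasing sets.\<close>

lemma near_minimizers:
  fixes S :: "nat \<Rightarrow> 'a measure set" and J :: "'a measure \<Rightarrow> real"
  assumes S: "\<And>n. S n \<noteq> {}" "\<And>m n. n \<le> m \<Longrightarrow> S m \<subseteq> S n"
    and mid: "\<And>n x y. x \<in> S n \<Longrightarrow> y \<in> S n \<Longrightarrow> half_sum x y \<in> S n"
    and J: "\<And>x y. x \<in> S 0 \<Longrightarrow> y \<in> S 0 \<Longrightarrow> dist2 x y \<le> 2 * J x + 2 * J y - 4 * J (half_sum x y)"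
    and L: "\<And>x. x \<in> S 0 \<Longrightarrow> L \<le> J x" and B: "\<And>n. Inf (J ` S n) \<le> B"
  obtains c where "\<And>n. c n \<in> S n" "cauchy_seq c" "\<And>n. J (c n) \<le> Inf (J ` S n) + 1 / real (Suc n)"
proof -
  define d where "d n = Inf (J ` S n)" for n
  have bdd: "bdd_below (J ` S n)" for n using S(2)[of 0 n] L by (intro bdd_belowI[of _ L]) auto
  have lower: "d n \<le> J x" if "x \<in> S n" for n x
    unfolding d_def using bdd that by (intro cInf_lower) auto
  have inc: "incseq d" unfolding d_def incseq_def
    using S(1) bdd by (intro allI impI cInf_superset_mono image_mono S(2)) auto
  have "convergent d"
    using incseq_convergent[OF inc, of B] B by (metis convergentI d_def)
  then have Cd: "Cauchy d" by (simp add: Cauchy_convergent_iff)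
  have "\<exists>x\<in>S n. J x \<le> d n + 1 / real (Suc n)" for n
  proof -
    have lt: "Inf (J ` S n) < d n + 1 / real (Suc n)" by (simp add: d_def)
    have "\<exists>y\<in>J ` S n. y < d n + 1 / real (Suc n)" by (rule cInf_lessD[OF _ lt]) (simp add: S(1))
    then show ?thesis by (auto intro: less_imp_le)
  qed
  then obtain c where c: "\<And>n. c n \<in> S n" "\<And>n. J (c n) \<le> d n + 1 / real (Suc n)" by metis
  have c0: "c n \<in> S 0" for n using S(2)[of 0 n] c(1) by blast
  have le: "dist2 (c m) (c n) \<le> 2 * \<bar>d m - d n\<bar> + 2 / real (Suc m) + 2 / real (Suc n)" for m n
  proof -
    \<comment> \<open>both near minimizers, and hence their midpoint, lie in the set with the smaller index\<close>
    define k where "k = min m n"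
    have "c m \<in> S k" "c n \<in> S k" using c(1) S(2) unfolding k_def by (meson min.cobounded1 min.cobounded2 subsetD)+
    then have "d k \<le> J (half_sum (c m) (c n))" by (intro lower mid)
    moreover have "2 * d m + 2 * d n - 4 * d k \<le> 2 * \<bar>d m - d n\<bar>"
      unfolding k_def min_def abs_if by (simp split: if_split)
    ultimately show ?thesis using J[OF c0 c0, of m n] c(2)[of m] c(2)[of n] by simp
  qed
  have cs: "cauchy_seq c" unfolding cauchy_seq_def
  proof (intro allI impI)
    fix e :: real assume e: "e > 0"
    obtain N1 where N1: "\<And>m n. m \<ge> N1 \<Longrightarrow> n \<ge> N1 \<Longrightarrow> \<bar>d m - d n\<bar> < e / 8"
      using Cd e unfolding Cauchy_def dist_real_def by (metis divide_pos_pos zero_less_numeral)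
    obtain N2 where N2: "N2 > 0" "1 / real N2 < e / 8"
      using e by (metis divide_pos_pos inverse_eq_divide real_arch_inverse zero_less_numeral gr0I of_nat_0 inverse_zero less_irrefl)
    have small: "1 / real (Suc n) < e / 8" if "n \<ge> N2" for n
      using that N2 by (intro le_less_trans[OF _ N2(2)] divide_left_mono) auto
    have "dist2 (c m) (c n) < e" if "m \<ge> max N1 N2" "n \<ge> max N1 N2" for m n
      using le[of m n] N1[of m n] small[of m] small[of n] that e by simp
    then show "\<exists>N. \<forall>m\<ge>N. \<forall>n\<ge>N. dist2 (c m) (c n) < e" by blast
  qed
  show thesis
  proof (rule that)
    show "J (c n) \<le> Inf (J ` S n) + 1 / real (Suc n)" for n using c(2)[of n] unfolding d_def .
  qed (rule c(1), rule cs)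
qed

definition cone_on :: "'a set \<Rightarrow> 'a measure set" where
  "cone_on A = {M \<in> energy_cone. AE x in M. x \<in> A}"

lemma cone_on_cone: "M \<in> cone_on A \<Longrightarrow> M \<in> energy_cone"
  by (simp add: cone_on_def)

lemma cone_on_mono: "A \<subseteq> B \<Longrightarrow> cone_on A \<subseteq> cone_on B"
  unfolding cone_on_def by (auto elim!: eventually_mono)

lemma cone_on_UNIV: "cone_on UNIV = energy_cone"
  by (simp add: cone_on_def)

lemma cone_on_add: "M \<in> cone_on A \<Longrightarrow> N \<in> cone_on A \<Longrightarrow> add_measure M N \<in> cone_on A"
  unfolding cone_on_def by (auto intro: cone_add AE_add_measure simp: cone_sets)

lemma cone_on_scale: "M \<in> cone_on A \<Longrightarrow> scale_measure (ennreal c) M \<in> cone_on A"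
  unfolding cone_on_def by (auto intro: cone_scale AE_scale_measure)

lemma cone_on_half_sum: "M \<in> cone_on A \<Longrightarrow> N \<in> cone_on A \<Longrightarrow> half_sum M N \<in> cone_on A"
  unfolding half_sum_def by (intro cone_on_scale cone_on_add)

lemma cone_on_null: "null_measure borel \<in> cone_on A"
  by (auto simp: cone_on_def cone_null intro!: AE_I'[of UNIV])

lemma cone_on_restrict:
  assumes "M \<in> cone_on A" "B \<in> sets borel"
  shows "restrict_to M B \<in> cone_on (A \<inter> B)"
proof -
  have "B \<in> sets M" using assms cone_sets[OF cone_on_cone[OF assms(1)]] by simp
  then have "AE x in restrict_to M B. x \<in> A \<inter> B"
    using assms(1) unfolding AE_restrict[OF \<open>B \<in> sets M\<close>] cone_on_def by (auto elim!: eventually_mono)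
  then show ?thesis using assms by (simp add: cone_on_def cone_restrict)
qed

text \<open>Being carried by a closed set is a condition on integrals of test functions, so it passes to vague
  limits.\<close>

lemma closed_support_iff:
  fixes M :: "'a measure"
  assumes M: "locally_finite_measure M" and F: "closed F"
  shows "(AE x in M. x \<in> F) \<longleftrightarrow> (\<forall>f\<in>Cc. (\<forall>x. 0 \<le> f x) \<longrightarrow> (\<forall>x\<in>F. f x = 0) \<longrightarrow> (\<integral>x. f x \<partial>M) = 0)"
proof
  assume "AE x in M. x \<in> F"
  then show "\<forall>f\<in>Cc. (\<forall>x. 0 \<le> f x) \<longrightarrow> (\<forall>x\<in>F. f x = 0) \<longrightarrow> (\<integral>x. f x \<partial>M) = 0"
    by (auto intro!: integral_eq_zero_AE elim!: eventually_mono)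
next
  assume *: "\<forall>f\<in>Cc. (\<forall>x. 0 \<le> f x) \<longrightarrow> (\<forall>x\<in>F. f x = 0) \<longrightarrow> (\<integral>x. f x \<partial>M) = 0"
  have oF: "open (- F)" using F by auto
  have "radon_measure M" using M by (simp add: radon_measure_iff)
  then have inner: "\<forall>U. open U \<longrightarrow> emeasure M U = (SUP K\<in>{K. compact K \<and> K \<subseteq> U}. emeasure M K)"
    unfolding radon_measure_def by (elim conjE)
  have "emeasure M (- F) = (SUP K\<in>{K. compact K \<and> K \<subseteq> - F}. emeasure M K)"
    by (rule inner[rule_format, OF oF])
  also have "\<dots> \<le> 0"
  proof (rule SUP_least)
    fix K assume "K \<in> {K. compact K \<and> K \<subseteq> - F}"
    then have K: "compact K" "K \<subseteq> - F" by auto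
    obtain g where g: "g \<in> Cc" "\<And>x. 0 \<le> g x" "\<And>x. x \<in> K \<Longrightarrow> g x = 1" "closure {x. g x \<noteq> 0} \<subseteq> - F"
      by (rule bump_function[OF K(1) oF K(2)]) blast
    have "g x = 0" if "x \<in> F" for x using g(4) closure_subset[of "{x. g x \<noteq> 0}"] that by auto
    then have "(\<integral>x. g x \<partial>M) = 0" using * g(1,2) by blast
    then have "(\<integral>\<^sup>+x. ennreal (g x) \<partial>M) = 0" using integral_Cc_eq_nn[OF M g(1,2)] by simp
    moreover have "emeasure M K = (\<integral>\<^sup>+x. indicator K x \<partial>M)"
      using compact_borel[OF K(1)] locally_finite_sets[OF M] by simp
    moreover have "(\<integral>\<^sup>+x. indicator K x \<partial>M) \<le> (\<integral>\<^sup>+x. ennreal (g x) \<partial>M)"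
      using g(3) by (intro nn_integral_mono) (auto simp: indicator_def)
    ultimately show "emeasure M K \<le> 0" by simp
  qed
  finally have "- F \<in> null_sets M" using oF locally_finite_sets[OF M] by (auto simp: null_sets_def)
  then show "AE x in M. x \<in> F" by (rule AE_I') auto
qed

lemma cone_on_complete:
  assumes F: "closed F" and c: "\<And>n. c n \<in> cone_on F" and cauchy: "cauchy_seq c"
  obtains M where "M \<in> cone_on F" "(\<lambda>n. dist2 (c n) M) \<longlonglongrightarrow> 0"
proof -
  obtain M where M: "M \<in> energy_cone" "(\<lambda>n. dist2 (c n) M) \<longlonglongrightarrow> 0"
    "\<And>f l. f \<in> Cc \<Longrightarrow> (\<lambda>n. \<integral>x. f x \<partial>c n) \<longlonglongrightarrow> l \<Longrightarrow> (\<integral>x. f x \<partial>M) = l"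
    by (rule strongly_complete[OF cone_on_cone[OF c] cauchy]) blast
  have "(\<integral>x. f x \<partial>M) = 0" if f: "f \<in> Cc" "\<forall>x. 0 \<le> f x" "\<forall>x\<in>F. f x = 0" for f
  proof (rule M(3)[OF f(1)])
    have "(\<integral>x. f x \<partial>c n) = 0" for n
      using closed_support_iff[OF cone_locally_finite[OF cone_on_cone[OF c]] F, of n] c[of n] f
      by (auto simp: cone_on_def)
    then show "(\<lambda>n. \<integral>x. f x \<partial>c n) \<longlonglongrightarrow> 0" by simp
  qed
  then have "AE x in M. x \<in> F" using closed_support_iff[OF cone_locally_finite[OF M(1)] F] by blast
  then show thesis using M(1,2) by (intro that[of M]) (auto simp: cone_on_def)
qed

text \<open>The orthogonal projection of \<open>\<alpha> - \<beta>\<close> onto the cone minimizes the energy of \<open>\<alpha> - \<beta> - t\<close>. It exists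
  because the cone is complete, and the stated relations are the first variation: in the direction of a
  member of the cone, and in both directions along \<open>p\<close> itself.\<close>

theorem projection:
  assumes F: "closed F" and \<alpha>: "\<alpha> \<in> energy_cone" and \<beta>: "\<beta> \<in> energy_cone"
  obtains p where "p \<in> cone_on F" "\<And>t. t \<in> cone_on F \<Longrightarrow> ip \<alpha> t - ip \<beta> t \<le> ip p t"
    "ip p p = ip \<alpha> p - ip \<beta> p" "ip p p \<le> dist2 \<alpha> \<beta>"
proof -
  define J where "J t = ip t t - 2 * (ip \<alpha> t - ip \<beta> t)" for t
  have Jpos: "0 \<le> dist2 \<alpha> \<beta> + J t" if t: "t \<in> energy_cone" for t
  proof -
    have "dist2 \<alpha> (add_measure \<beta> t) = dist2 \<alpha> \<beta> + J t"
      using \<alpha> \<beta> t ip_commute[OF t \<beta>] by (simp add: dist2_def J_def ip_simps)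
    then show ?thesis using dist2_nonneg[OF \<alpha> cone_add[OF \<beta> t]] by simp
  qed
  have ne: "cone_on F \<noteq> {}" using cone_on_null by blast
  have bdd: "bdd_below (J ` cone_on F)"
    using Jpos cone_on_cone by (intro bdd_belowI[of _ "- dist2 \<alpha> \<beta>"]) fastforce
  obtain c where c: "\<And>n. c n \<in> cone_on F" "cauchy_seq c" "\<And>n::nat. J (c n) \<le> Inf (J ` cone_on F) + 1 / real (Suc n)"
  proof (rule near_minimizers[where S = "\<lambda>n. cone_on F" and J = J and L = "- dist2 \<alpha> \<beta>" and B = "Inf (J ` cone_on F)"])
    fix x y assume xy: "x \<in> cone_on F" "y \<in> cone_on F"
    then show "half_sum x y \<in> cone_on F" by (rule cone_on_half_sum)
    have "x \<in> energy_cone" "y \<in> energy_cone" using xy cone_on_cone by auto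
    then show "dist2 x y \<le> 2 * J x + 2 * J y - 4 * J (half_sum x y)"
      using \<alpha> \<beta> by (simp add: parallelogram J_def ip_half_sum_right field_simps)
    show "- dist2 \<alpha> \<beta> \<le> J x" using Jpos[of x] xy(1) cone_on_cone by force
  qed (use ne in auto)
  have cc: "c n \<in> energy_cone" for n using c(1) cone_on_cone by blast
  obtain p where p: "p \<in> cone_on F" "(\<lambda>n. dist2 (c n) p) \<longlonglongrightarrow> 0"
    by (rule cone_on_complete[OF F c(1,2)])
  have pc: "p \<in> energy_cone" using p(1) cone_on_cone by blast
  have "(\<lambda>n. ip (c n) (c n) - 2 * (ip (c n) \<alpha> - ip (c n) \<beta>)) \<longlonglongrightarrow> ip p p - 2 * (ip p \<alpha> - ip p \<beta>)"
    by (intro tendsto_intros norm_limit ip_limit cc pc p(2) \<alpha> \<beta>)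
  then have "(\<lambda>n. J (c n)) \<longlonglongrightarrow> J p"
    using ip_commute[OF cc] ip_commute[OF pc] \<alpha> \<beta> by (simp add: J_def)
  moreover have "(\<lambda>n. Inf (J ` cone_on F) + 1 / real (Suc n)) \<longlonglongrightarrow> Inf (J ` cone_on F) + 0"
    by (intro tendsto_add tendsto_const LIMSEQ_Suc[OF lim_1_over_n])
  ultimately have "J p \<le> Inf (J ` cone_on F)" using c(3) by (auto intro: LIMSEQ_le)
  then have min: "J p \<le> J t" if "t \<in> cone_on F" for t
    using cInf_lower[OF imageI[OF that] bdd] by simp
  have first: "ip \<alpha> t - ip \<beta> t \<le> ip p t" if t: "t \<in> cone_on F" for t
  proof -
    have tc: "t \<in> energy_cone" using t cone_on_cone by blast
    define x where "x = ip p t - (ip \<alpha> t - ip \<beta> t)"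
    have *: "0 \<le> 2 * s * x + s\<^sup>2 * ip t t" if s: "0 \<le> s" for s
    proof -
      have "J p \<le> J (add_measure p (scale_measure (ennreal s) t))"
        by (intro min cone_on_add cone_on_scale p(1) t)
      also have "\<dots> = J p + 2 * s * x + s\<^sup>2 * ip t t"
        using pc tc \<alpha> \<beta> s ip_commute[OF tc pc]
        by (simp add: J_def x_def ip_simps power2_eq_square algebra_simps)
      finally show ?thesis by simp
    qed
    have "- x \<le> sqrt 0 * sqrt (ip t t)"
      by (rule quadratic_bound) (use * in \<open>auto simp: ip_nonneg\<close>)
    then show ?thesis by (simp add: x_def)
  qed
  have second: "ip p p \<le> ip \<alpha> p - ip \<beta> p"
  proof -
    \<comment> \<open>compare \<open>p\<close> with its multiples \<open>(1 - s) p\<close> as \<open>s\<close> tends to zero\<close>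
    define x where "x = ip p p - (ip \<alpha> p - ip \<beta> p)"
    have *: "0 \<le> - 2 * s * x + s\<^sup>2 * ip p p" if s: "0 \<le> s" "s \<le> 1" for s
    proof -
      have "J p \<le> J (scale_measure (ennreal (1 - s)) p)" by (intro min cone_on_scale p(1))
      also have "\<dots> = J p - 2 * s * x + s\<^sup>2 * ip p p"
        using pc \<alpha> \<beta> s by (simp add: J_def x_def ip_simps power2_eq_square algebra_simps)
      finally show ?thesis by simp
    qed
    have "x \<le> 0"
    proof (rule field_le_epsilon)
      fix e :: real assume e: "0 < e"
      define s where "s = min 1 (e / (ip p p + 1))"
      have pos: "0 < ip p p + 1" using ip_nonneg[of p p] by simp
      have s: "0 < s" "s \<le> 1" using e pos by (auto simp: s_def)
      have "s \<le> e / (ip p p + 1)" by (simp add: s_def)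
      then have s3: "s * (ip p p + 1) \<le> e" using pos by (simp add: pos_le_divide_eq)
      have "0 \<le> s * (- 2 * x + s * ip p p)" using *[of s] s by (simp add: power2_eq_square algebra_simps)
      then have "2 * x \<le> s * ip p p" using s(1) by (simp add: zero_le_mult_iff)
      also have "\<dots> \<le> e" using s s3 by (simp add: algebra_simps)
      finally show "x \<le> 0 + e" using e by simp
    qed
    then show ?thesis by (simp add: x_def)
  qed
  have eq: "ip p p = ip \<alpha> p - ip \<beta> p" using first[OF p(1)] second by simp
  have "ip p p \<le> dist2 \<alpha> \<beta>" using Jpos[OF pc] eq by (simp add: J_def)
  then show thesis using that p(1) first eq by blast
qed

end

section \<open>Countable unions of compact sets\<close>

lemma K_sigma_iff: "K_sigma (S :: 'b::topological_space set) \<longleftrightarrow> (\<exists>\<C>. countable \<C> \<and> (\<forall>K\<in>\<C>. compact K) \<and> S = \<Union>\<C>)"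
proof
  assume "K_sigma S"
  then obtain K :: "nat \<Rightarrow> 'b set" where "\<forall>n. compact (K n)" "S = (\<Union>n. K n)" by (auto simp: K_sigma_def)
  then show "\<exists>\<C>. countable \<C> \<and> (\<forall>K\<in>\<C>. compact K) \<and> S = \<Union>\<C>" by (intro exI[of _ "range K"]) auto
next
  assume "\<exists>\<C>. countable \<C> \<and> (\<forall>K\<in>\<C>. compact K) \<and> S = \<Union>\<C>"
  then obtain \<C> where C: "countable \<C>" "\<forall>K\<in>\<C>. compact K" "S = \<Union>\<C>" by blast
  have r: "range (from_nat_into (insert {} \<C>)) = insert {} \<C>"
    by (rule range_from_nat_into) (use C in auto)
  show "K_sigma S" unfolding K_sigma_def
  proof (intro exI conjI allI)
    show "compact (from_nat_into (insert {} \<C>) n)" for n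
      using from_nat_into[of "insert {} \<C>" n] C(2) by auto
    show "S = (\<Union>n. from_nat_into (insert {} \<C>) n)" using r C(3) by auto
  qed
qed

lemma compact_imp_K_sigma: "compact K \<Longrightarrow> K_sigma K"
  unfolding K_sigma_def by (rule exI[of _ "\<lambda>_. K"]) simp

lemma K_sigma_UN:
  assumes "countable I" "\<And>i. i \<in> I \<Longrightarrow> K_sigma (f i)"
  shows "K_sigma (\<Union>i\<in>I. f i)"
proof -
  obtain \<C> where C: "\<And>i. i \<in> I \<Longrightarrow> countable (\<C> i) \<and> (\<forall>K\<in>\<C> i. compact K) \<and> f i = \<Union>(\<C> i)"
    using assms(2) unfolding K_sigma_iff by metis
  show ?thesis unfolding K_sigma_iff
    by (rule exI[of _ "\<Union>i\<in>I. \<C> i"]) (use C assms(1) in auto)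
qed

lemma second_countable_dense_subset:
  fixes T :: "'b::second_countable_topology set"
  obtains D where "countable D" "D \<subseteq> T" "T \<subseteq> closure D"
proof -
  obtain B :: "'b set set" where B: "countable B" "topological_basis B" using ex_countable_basis by blast
  define D where "D = (\<lambda>b. SOME x. x \<in> b \<inter> T) ` {b \<in> B. b \<inter> T \<noteq> {}}"
  have pick: "(SOME x. x \<in> b \<inter> T) \<in> b \<inter> T" if "b \<inter> T \<noteq> {}" for b
    by (rule someI_ex) (use that in blast)
  show thesis
  proof (rule that[of D])
    show "countable D" using B(1) by (simp add: D_def)
    show "D \<subseteq> T" using pick by (auto simp: D_def)
    show "T \<subseteq> closure D"
    proof
      fix x assume x: "x \<in> T"
      show "x \<in> closure D" unfolding closure_iff_nhds_not_empty
      proof (intro allI impI)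
        fix W V assume V: "V \<subseteq> W" "open V" "x \<in> V"
        obtain b where b: "b \<in> B" "x \<in> b" "b \<subseteq> V" using V B(2) by (meson topological_basisE)
        then have "b \<inter> T \<noteq> {}" using x by blast
        then have "(SOME x. x \<in> b \<inter> T) \<in> D \<inter> W" using b(1,3) V(1) pick[of b] by (auto simp: D_def)
        then show "D \<inter> W \<noteq> {}" by blast
      qed
    qed
  qed
qed

section \<open>Sweeping\<close>

context kernel_space
begin

abbreviation pot :: "'a measure \<Rightarrow> 'a \<Rightarrow> ennreal" where
  "pot \<equiv> pos_potential \<kappa>"

lemma pot_measurable:
  assumes "M \<in> energy_cone" "N \<in> energy_cone"
  shows "pot M \<in> borel_measurable N"
  using potential_measurable[OF cone_locally_finite[OF assms(1)]] measurable_cong_sets[OF cone_sets[OF assms(2)] refl]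
  by blast

lemma ip_eq_integral:
  assumes "M \<in> energy_cone" "N \<in> energy_cone"
  shows "ennreal (ip M N) = (\<integral>\<^sup>+x. pot M x \<partial>N)"
  using assms ip_ennreal[OF assms] pint_commute[of M N] by (simp add: cone_locally_finite pint_iterated)

lemma ip_mono_AE:
  assumes "M \<in> energy_cone" "M' \<in> energy_cone" "N \<in> energy_cone" "AE x in N. pot M x \<le> pot M' x"
  shows "ip M N \<le> ip M' N"
proof -
  have "ennreal (ip M N) \<le> ennreal (ip M' N)"
    unfolding ip_eq_integral[OF assms(1,3)] ip_eq_integral[OF assms(2,3)]
    by (rule nn_integral_mono_AE[OF assms(4)])
  then show ?thesis by (simp add: ip_nonneg)
qed

lemma AE_pot_le_of_ip_le:
  assumes M: "M \<in> energy_cone" and M': "M' \<in> energy_cone" and N: "N \<in> energy_cone"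
    and ge: "AE x in N. pot M x \<le> pot M' x" and ip: "ip M' N \<le> ip M N"
  shows "AE x in N. pot M' x \<le> pot M x"
proof (rule ccontr)
  assume "\<not> ?thesis"
  then have "(\<integral>\<^sup>+x. pot M x \<partial>N) < (\<integral>\<^sup>+x. pot M' x \<partial>N)"
    using ge ip_eq_integral[OF M N, symmetric]
    by (intro nn_integral_less pot_measurable M M' N) auto
  then have "ennreal (ip M N) < ennreal (ip M' N)" by (simp add: ip_eq_integral M M' N)
  then show False using ip by (simp add: ennreal_less_iff ip_nonneg)
qed

text \<open>Testing against all measures carried by \<open>A\<close> is the same as comparing potentials almost
  everywhere for these measures: test with the restriction to the exceptional set.\<close>

lemma AE_pot_le:
  assumes M: "M \<in> energy_cone" and M': "M' \<in> energy_cone" and N: "N \<in> cone_on A"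
    and ip: "\<And>t. t \<in> cone_on A \<Longrightarrow> ip M t \<le> ip M' t"
  shows "AE x in N. pot M x \<le> pot M' x"
proof -
  define S where "S = {x. pot M' x < pot M x}"
  have [measurable]: "pot M \<in> borel_measurable borel" "pot M' \<in> borel_measurable borel"
    using potential_measurable M M' cone_locally_finite by blast+
  have S: "S \<in> sets borel" unfolding S_def by measurable
  have Nc: "N \<in> energy_cone" using N by (rule cone_on_cone)
  have SN: "S \<in> sets N" using S cone_sets[OF Nc] by simp
  define R where "R = restrict_to N S"
  have R: "R \<in> cone_on A" using cone_on_restrict[OF N S] cone_on_mono[of "A \<inter> S" A] by (auto simp: R_def)
  have Rc: "R \<in> energy_cone" using R by (rule cone_on_cone)
  have "AE x in R. pot M' x \<le> pot M x" unfolding R_def AE_restrict[OF SN] by (auto simp: S_def)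
  then have "AE x in R. pot M x \<le> pot M' x" by (rule AE_pot_le_of_ip_le[OF M' M Rc _ ip[OF R]])
  then show ?thesis unfolding R_def AE_restrict[OF SN] by (rule eventually_mono) (auto simp: S_def not_less)
qed

lemma potential_functional_of:
  assumes "locally_finite_measure M"
  shows "potential \<kappa> (functional_of M) x = enn2ereal (pot M x)"
  by (simp add: potential_def parts_functional_of[OF assms] pos_potential_def zero_ennreal.rep_eq)

lemma domination:
  assumes "M \<in> energy_cone" "N \<in> energy_cone" "AE x in M. pot M x \<le> pot N x"
  shows "pot M x \<le> pot N x"
proof -
  have "functional_of M \<in> finite_energy_pos \<kappa>" "functional_of N \<in> finite_energy_pos \<kappa>"
    using assms finite_energy_pos_eq by auto
  moreover have "AE x in pos_measure (functional_of M). potential \<kappa> (functional_of M) x \<le> potential \<kappa> (functional_of N) x"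
    unfolding parts_functional_of[OF cone_locally_finite[OF assms(1)]]
    using assms by (simp add: potential_functional_of cone_locally_finite less_eq_ennreal.rep_eq[symmetric])
  ultimately have "potential \<kappa> (functional_of M) x \<le> potential \<kappa> (functional_of N) x"
    using domination_principle unfolding domination_principle_def by blast
  then show ?thesis
    using assms by (simp add: potential_functional_of cone_locally_finite less_eq_ennreal.rep_eq[symmetric])
qed

text \<open>The weak inequality gives the inequality of the potentials almost everywhere for \<open>M\<close>, and the
  domination principle extends it to all points.\<close>

lemma pot_le_of_ip_le:
  assumes "M \<in> energy_cone" "N \<in> energy_cone" "\<And>t. t \<in> energy_cone \<Longrightarrow> ip M t \<le> ip N t"
  shows "pot M x \<le> pot N x"
  using assms AE_pot_le[of M N M UNIV] by (intro domination) (auto simp: cone_on_UNIV)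

lemma eq_of_pot_eq:
  assumes M: "M \<in> energy_cone" and N: "N \<in> energy_cone" and eq: "\<And>x. pot M x = pot N x"
  shows "M = N"
proof (rule energy_cone_pint(3)[OF M N])
  have "ennreal (ip M T) = ennreal (ip N T)" if "T \<in> energy_cone" for T
    using eq by (simp add: ip_eq_integral M N that)
  then have "ip M T = ip N T" if "T \<in> energy_cone" for T using that by (simp add: ip_nonneg)
  then show "dist2 M N = 0" using M N ip_commute[OF M N] by (simp add: dist2_def)
qed

text \<open>The measures competing for the inner balayage, in the weak form justified by \<open>inner_exception_iff\<close>.\<close>

definition sweeps :: "'a set \<Rightarrow> 'a measure \<Rightarrow> 'a measure set" where
  "sweeps A \<mu> = {\<nu> \<in> energy_cone. \<forall>t\<in>cone_on A. ip \<mu> t \<le> ip \<nu> t}"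

lemma sweeps_cone: "\<nu> \<in> sweeps A \<mu> \<Longrightarrow> \<nu> \<in> energy_cone"
  by (simp add: sweeps_def)

lemma sweeps_antimono: "A \<subseteq> B \<Longrightarrow> sweeps B \<mu> \<subseteq> sweeps A \<mu>"
  using cone_on_mono[of A B] by (auto simp: sweeps_def)

lemma sweeps_AE:
  assumes "\<nu> \<in> sweeps A \<mu>" "\<mu> \<in> energy_cone" "t \<in> cone_on A"
  shows "AE x in t. pot \<mu> x \<le> pot \<nu> x"
  using assms by (intro AE_pot_le[of \<mu> \<nu> t A]) (auto simp: sweeps_def)

section \<open>Capacities\<close>

lemma concentrated_on_iff:
  fixes M :: "'a measure"
  assumes M: "locally_finite_measure M"
  shows "concentrated_on (functional_of M) A \<longleftrightarrow> (AE x in M. x \<in> A)"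
proof
  assume "AE x in M. x \<in> A"
  then obtain N where "N \<in> null_sets M" "- A \<subseteq> N"
    by (auto simp: eventually_ae_filter locally_finite_space[OF M] Compl_eq)
  then show "concentrated_on (functional_of M) A"
    unfolding concentrated_on_def parts_functional_of[OF M] by blast
next
  assume conc: "concentrated_on (functional_of M) A"
  obtain K :: "nat \<Rightarrow> 'a set" where K: "\<And>n. compact (K n)" "(\<Union>n. K n) = UNIV"
    using compact_exhaustion by metis
  have "AE x in M. x \<in> K n \<longrightarrow> x \<in> A" for n
  proof -
    obtain N where "N \<in> null_sets M" "(- A) \<inter> K n \<subseteq> N"
      using conc K(1)[of n] unfolding concentrated_on_def parts_functional_of[OF M] by blast
    then show ?thesis by (intro AE_I'[of N]) auto
  qed
  then have "AE x in M. \<forall>n. x \<in> K n \<longrightarrow> x \<in> A" unfolding AE_all_countable by (rule allI)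
  then show "AE x in M. x \<in> A" using K(2) by (auto elim!: eventually_mono)
qed

lemma inner_capacity_eq:
  "inner_capacity \<kappa> A = inverse (INF M\<in>{M \<in> cone_on A. emeasure M UNIV = 1}. ereal (ip M M))"
proof -
  have "{\<mu> \<in> finite_energy_pos \<kappa>. concentrated_on \<mu> A \<and> emeasure (pos_measure \<mu>) UNIV = 1} =
      functional_of ` {M \<in> cone_on A. emeasure M UNIV = 1}"
    unfolding finite_energy_pos_eq
    by (auto simp: cone_on_def concentrated_on_iff cone_locally_finite parts_functional_of)
  then show ?thesis
    unfolding inner_capacity_def
    by (auto simp: image_comp mutual_energy_functional_of cone_on_cone intro!: arg_cong[where f = inverse] INF_cong)
qed

lemma INF_energy_nonneg: "0 \<le> (INF M\<in>{M \<in> cone_on A. emeasure M UNIV = 1}. ereal (ip M M))"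
  by (intro INF_greatest) (simp add: ip_nonneg)

lemma inner_capacity_nonneg: "0 \<le> inner_capacity \<kappa> A"
  unfolding inner_capacity_eq using INF_energy_nonneg[of A] by (rule inverse_ereal_ge0I)

lemma inner_capacity_mono: "A \<subseteq> B \<Longrightarrow> inner_capacity \<kappa> A \<le> inner_capacity \<kappa> B"
  unfolding inner_capacity_eq using cone_on_mono[of A B]
  by (intro ereal_inverse_antimono INF_energy_nonneg INF_superset_mono) auto

lemma outer_capacity_nonneg: "0 \<le> outer_capacity \<kappa> A"
  unfolding outer_capacity_def by (intro INF_greatest inner_capacity_nonneg)

lemma inner_le_outer_capacity: "inner_capacity \<kappa> A \<le> outer_capacity \<kappa> A"
  unfolding outer_capacity_def by (intro INF_greatest inner_capacity_mono) auto

text \<open>A nonzero measure charges some compact set; restrict to it and normalize.\<close>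

lemma normalized_mass:
  assumes t: "t \<in> cone_on A" and ne: "t \<noteq> null_measure borel"
  obtains s where "s \<in> cone_on A" "emeasure s UNIV = 1"
proof -
  have lf: "locally_finite_measure t" using t by (intro cone_locally_finite cone_on_cone)
  obtain K :: "nat \<Rightarrow> 'a set" where K: "\<And>n. compact (K n)" "(\<Union>n. K n) = UNIV"
    using compact_exhaustion by metis
  have "\<exists>n. emeasure t (K n) \<noteq> 0"
  proof (rule ccontr)
    assume "\<not> ?thesis"
    then have "emeasure t (\<Union>n. K n) = 0"
      using K locally_finite_sets[OF lf] by (intro emeasure_UN_eq_0) (auto simp: compact_borel)
    then have z: "emeasure t UNIV = 0" by (simp add: K(2))
    have "emeasure t B = 0" for B
      using emeasure_mono[of B UNIV t] z locally_finite_sets[OF lf] by simp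
    then have "t = null_measure borel" by (intro measure_eqI) (auto simp: locally_finite_sets[OF lf])
    then show False using ne by simp
  qed
  then obtain n where n: "emeasure t (K n) \<noteq> 0" by blast
  obtain m where m: "emeasure t (K n) = ennreal m" "0 < m"
    using n locally_finite_compact[OF lf K(1)[of n]] by (cases "emeasure t (K n)") (auto simp: less_le)
  define s where "s = scale_measure (ennreal (1 / m)) (restrict_to t (K n))"
  have "restrict_to t (K n) \<in> cone_on A"
    using cone_on_restrict[OF t compact_borel[OF K(1)[of n]]] cone_on_mono[of "A \<inter> K n" A] by auto
  then have "s \<in> cone_on A" unfolding s_def by (rule cone_on_scale)
  moreover have "emeasure s UNIV = 1"
    using m by (simp add: s_def emeasure_restrict locally_finite_sets[OF lf] compact_borel[OF K(1)] ennreal_mult[symmetric])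
  ultimately show thesis by (rule that)
qed

lemma inner_capacity_zero_iff: "inner_capacity \<kappa> A = 0 \<longleftrightarrow> cone_on A = {null_measure borel}"
proof
  assume zero: "inner_capacity \<kappa> A = 0"
  show "cone_on A = {null_measure borel}"
  proof (rule ccontr)
    assume "\<not> ?thesis"
    then obtain t where "t \<in> cone_on A" "t \<noteq> null_measure borel" using cone_on_null by blast
    then obtain s where s: "s \<in> cone_on A" "emeasure s UNIV = 1" by (rule normalized_mass)
    then have "(INF M\<in>{M \<in> cone_on A. emeasure M UNIV = 1}. ereal (ip M M)) \<le> ereal (ip s s)"
      by (intro INF_lower) auto
    then show False using zero INF_energy_nonneg[of A]
      by (auto simp: inner_capacity_eq ereal_inverse_eq_0)
  qed
next
  assume "cone_on A = {null_measure borel}"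
  then have "{M \<in> cone_on A. emeasure M UNIV = 1} = {}" by auto
  then show "inner_capacity \<kappa> A = 0"
    unfolding inner_capacity_eq by (simp only: image_empty Inf_empty top_ereal_def) simp
qed

lemma cone_on_null_iff:
  "cone_on N = {null_measure borel} \<longleftrightarrow> (\<forall>t\<in>energy_cone. (AE x in t. x \<in> N) \<longrightarrow> t = null_measure borel)"
  using cone_on_null by (auto simp: cone_on_def)

lemma null_measure_of_AE_False:
  assumes "locally_finite_measure t" "AE x in t. False"
  shows "t = null_measure borel"
proof (rule measure_eqI)
  fix B assume "B \<in> sets t"
  have "emeasure t B = (\<integral>\<^sup>+x. indicator B x \<partial>t)" using \<open>B \<in> sets t\<close> by simp
  also have "\<dots> = (\<integral>\<^sup>+x. 0 \<partial>t)" using assms(2) by (intro nn_integral_cong_AE) auto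
  finally show "emeasure t B = emeasure (null_measure borel) B" by simp
qed (simp add: locally_finite_sets[OF assms(1)])

text \<open>A set of inner capacity zero carries no nonzero measure of finite energy; hence the inequality nearly
  everywhere on \<open>A\<close> between two potentials is an inequality between mutual energies with the measures
  carried by \<open>A\<close>.\<close>

lemma inner_exception_iff:
  assumes \<mu>: "\<mu> \<in> energy_cone" and \<nu>: "\<nu> \<in> energy_cone"
  shows "inner_capacity \<kappa> {x \<in> A. \<not> pot \<mu> x \<le> pot \<nu> x} = 0 \<longleftrightarrow> \<nu> \<in> sweeps A \<mu>"
proof
  let ?S = "{x. \<not> pot \<mu> x \<le> pot \<nu> x}"
  have [measurable]: "pot \<mu> \<in> borel_measurable borel" "pot \<nu> \<in> borel_measurable borel"
    using potential_measurable \<mu> \<nu> cone_locally_finite by blast+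
  have S: "?S \<in> sets borel" by measurable
  assume "inner_capacity \<kappa> {x \<in> A. \<not> pot \<mu> x \<le> pot \<nu> x} = 0"
  then have z: "cone_on (A \<inter> ?S) = {null_measure borel}" by (simp add: inner_capacity_zero_iff Int_def)
  have "ip \<mu> t \<le> ip \<nu> t" if t: "t \<in> cone_on A" for t
  proof -
    have tc: "t \<in> energy_cone" using t by (rule cone_on_cone)
    have St: "?S \<in> sets t" using S cone_sets[OF tc] by simp
    have "restrict_to t ?S = null_measure borel" using cone_on_restrict[OF t S] z by auto
    moreover have "AE x in null_measure borel. pot \<mu> x \<le> pot \<nu> x" by (rule AE_I'[of UNIV]) auto
    ultimately have "AE x in restrict_to t ?S. pot \<mu> x \<le> pot \<nu> x" by (simp only:)
    then have "AE x in t. pot \<mu> x \<le> pot \<nu> x" unfolding AE_restrict[OF St] by (auto elim!: eventually_mono)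
    then show ?thesis by (rule ip_mono_AE[OF \<mu> \<nu> tc])
  qed
  then show "\<nu> \<in> sweeps A \<mu>" using \<nu> by (simp add: sweeps_def)
next
  assume sw: "\<nu> \<in> sweeps A \<mu>"
  have "t = null_measure borel" if t: "t \<in> energy_cone" "AE x in t. x \<in> {x \<in> A. \<not> pot \<mu> x \<le> pot \<nu> x}" for t
  proof -
    have "t \<in> cone_on A" using t by (auto simp: cone_on_def elim!: eventually_mono)
    then have "AE x in t. pot \<mu> x \<le> pot \<nu> x" by (rule sweeps_AE[OF sw \<mu>])
    with t(2) have "AE x in t. False" by eventually_elim auto
    then show ?thesis by (rule null_measure_of_AE_False[OF cone_locally_finite[OF t(1)]])
  qed
  then show "inner_capacity \<kappa> {x \<in> A. \<not> pot \<mu> x \<le> pot \<nu> x} = 0"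
    by (simp add: inner_capacity_zero_iff cone_on_null_iff)
qed

lemma balayage_class_eq:
  assumes \<mu>: "\<mu> \<in> energy_cone" and mono: "\<And>A B. A \<subseteq> B \<Longrightarrow> cap A \<le> cap B" and nn: "\<And>A. 0 \<le> cap A"
  shows "balayage_class \<kappa> cap A (functional_of \<mu>) =
    functional_of ` {\<nu> \<in> energy_cone. cap {x \<in> A. \<not> pot \<mu> x \<le> pot \<nu> x} = 0}"
proof -
  have "holds_outside_cap_zero cap A (\<lambda>x. potential \<kappa> (functional_of \<mu>) x \<le> potential \<kappa> (functional_of \<nu>) x)
      \<longleftrightarrow> cap {x \<in> A. \<not> pot \<mu> x \<le> pot \<nu> x} = 0" if \<nu>: "\<nu> \<in> energy_cone" for \<nu>
  proof -
    have eq: "potential \<kappa> (functional_of \<mu>) x \<le> potential \<kappa> (functional_of \<nu>) x \<longleftrightarrow> pot \<mu> x \<le> pot \<nu> x" for x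
      using \<mu> \<nu> by (simp add: potential_functional_of cone_locally_finite less_eq_ennreal.rep_eq)
    show ?thesis unfolding holds_outside_cap_zero_def eq
    proof
      assume "\<exists>N\<subseteq>A. cap N = 0 \<and> (\<forall>x\<in>A - N. pot \<mu> x \<le> pot \<nu> x)"
      then obtain N where N: "N \<subseteq> A" "cap N = 0" "\<forall>x\<in>A - N. pot \<mu> x \<le> pot \<nu> x" by blast
      then have "cap {x \<in> A. \<not> pot \<mu> x \<le> pot \<nu> x} \<le> cap N" by (intro mono) blast
      then show "cap {x \<in> A. \<not> pot \<mu> x \<le> pot \<nu> x} = 0" using N(2) nn by (simp add: antisym)
    next
      assume "cap {x \<in> A. \<not> pot \<mu> x \<le> pot \<nu> x} = 0"
      then show "\<exists>N\<subseteq>A. cap N = 0 \<and> (\<forall>x\<in>A - N. pot \<mu> x \<le> pot \<nu> x)"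
        by (intro exI[of _ "{x \<in> A. \<not> pot \<mu> x \<le> pot \<nu> x}"]) auto
    qed
  qed
  then show ?thesis unfolding balayage_class_def finite_energy_pos_eq by auto
qed

lemma inner_balayage_class:
  assumes "\<mu> \<in> energy_cone"
  shows "balayage_class \<kappa> (inner_capacity \<kappa>) A (functional_of \<mu>) = functional_of ` sweeps A \<mu>"
  using balayage_class_eq[OF assms inner_capacity_mono inner_capacity_nonneg] inner_exception_iff[OF assms]
  by (auto simp: sweeps_cone)

section \<open>A countable union of compact sets carrying a strongly dense set of measures\<close>

text \<open>The complement of \<open>A\<close> lies in a null set, which has open neighbourhoods of arbitrarily small measure;
  remove them from the members of a compact exhaustion.\<close>

lemma carried_by_K_sigma:
  fixes M :: "'a measure"
  assumes M: "locally_finite_measure M" and A: "AE x in M. x \<in> A"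
  obtains S where "K_sigma S" "S \<subseteq> A" "AE x in M. x \<in> S"
proof -
  have sM: "sets M = sets borel" by (rule locally_finite_sets[OF M])
  obtain N where N: "N \<in> null_sets M" "- A \<subseteq> N"
    using A by (auto simp: eventually_ae_filter locally_finite_space[OF M] Compl_eq)
  have Nb: "N \<in> sets borel" "emeasure M N = 0" using N(1) sM by (auto simp: null_sets_def)
  obtain K :: "nat \<Rightarrow> 'a set" where K: "\<And>n. compact (K n)" "(\<Union>n. K n) = UNIV"
    using compact_exhaustion by metis
  have "radon_measure M" using M by (simp add: radon_measure_iff)
  then have outer: "\<forall>B\<in>sets borel. emeasure M B = (INF U\<in>{U. open U \<and> B \<subseteq> U}. emeasure M U)"
    unfolding radon_measure_def by (elim conjE)
  have "\<exists>U. open U \<and> N \<subseteq> U \<and> emeasure M U < ennreal (1 / real (Suc j))" for j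
  proof -
    have "(INF U\<in>{U. open U \<and> N \<subseteq> U}. emeasure M U) < ennreal (1 / real (Suc j))"
      using outer[rule_format, OF Nb(1)] Nb(2) by simp
    then show ?thesis unfolding INF_less_iff by blast
  qed
  then obtain U where U: "\<And>j. open (U j)" "\<And>j. N \<subseteq> U j" "\<And>j. emeasure M (U j) < ennreal (1 / real (Suc j))"
    by metis
  define S where "S = (\<Union>n. \<Union>j. K n - U j)"
  have "K_sigma S" unfolding S_def
    using K(1) U(1) by (intro K_sigma_UN compact_imp_K_sigma compact_diff) auto
  moreover have "S \<subseteq> A" using U(2) N(2) by (auto simp: S_def)
  moreover have "AE x in M. x \<in> S"
  proof (rule AE_I')
    show "{x \<in> space M. x \<notin> S} \<subseteq> (\<Inter>j. U j)" using K(2) by (auto simp: S_def)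
    have Us: "U j \<in> sets M" for j using U(1) sM by simp
    have Is: "(\<Inter>j. U j) \<in> sets M" using Us by (intro sets.countable_INT) auto
    have "emeasure M (\<Inter>j. U j) \<le> ennreal (1 / real (Suc j))" for j
      using emeasure_mono[of "\<Inter>j. U j" "U j" M] Us U(3)[of j] by (meson INT_lower UNIV_I less_imp_le order_trans)
    note bound = this
    have "emeasure M (\<Inter>j. U j) \<le> 0"
    proof (rule ennreal_le_epsilon)
      fix e :: real assume e: "0 < e"
      obtain n where "inverse (real (Suc n)) < e" using reals_Archimedean[OF e] by blast
      then have "ennreal (1 / real (Suc n)) \<le> ennreal e" by (intro ennreal_leI) (simp add: inverse_eq_divide)
      then show "emeasure M (\<Inter>j. U j) \<le> 0 + ennreal e" using bound[of n] by simp
    qed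
    then have "emeasure M (\<Inter>j. U j) = 0" by simp
    then show "(\<Inter>j. U j) \<in> null_sets M" using Is by (simp add: null_sets_def)
  qed
  ultimately show thesis by (rule that)
qed

lemma integral_half_sum:
  fixes f :: "'a \<Rightarrow> real"
  assumes M: "M \<in> energy_cone" and N: "N \<in> energy_cone" and f: "f \<in> Cc" "\<And>x. 0 \<le> f x"
  shows "(\<integral>x. f x \<partial>half_sum M N) = ((\<integral>x. f x \<partial>M) + (\<integral>x. f x \<partial>N)) / 2"
proof -
  note lf = cone_locally_finite[OF M] cone_locally_finite[OF N]
  note lfs = locally_finite_add[OF lf]
  have m: "(\<lambda>x. ennreal (f x)) \<in> borel_measurable (add_measure M N)"
  proof (rule measurable_compose[OF _ measurable_ennreal])
    show "f \<in> borel_measurable (add_measure M N)"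
      using Cc_measurable[OF f(1)] measurable_cong_sets[OF locally_finite_sets[OF lfs] refl] by blast
  qed
  have "ennreal (\<integral>x. f x \<partial>half_sum M N) = (\<integral>\<^sup>+x. ennreal (f x) \<partial>half_sum M N)"
    unfolding half_sum_def by (rule integral_Cc_eq_nn[OF locally_finite_scale[OF lfs] f, symmetric])
  also have "\<dots> = ennreal (1/2) * (\<integral>\<^sup>+x. ennreal (f x) \<partial>add_measure M N)"
    unfolding half_sum_def by (rule nn_integral_scale_measure[OF m])
  also have "\<dots> = ennreal (1/2 * (\<integral>x. f x \<partial>add_measure M N))"
    unfolding integral_Cc_eq_nn[OF lfs f] using f(2) by (intro ennreal_mult[symmetric]) auto
  finally have "(\<integral>x. f x \<partial>half_sum M N) = 1/2 * (\<integral>x. f x \<partial>add_measure M N)"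
    using f(2) by (subst (asm) ennreal_inj) auto
  then show ?thesis by (simp add: integral_add_measure[OF lf f(1)])
qed

inductive_set tail_hull :: "(nat \<Rightarrow> 'a measure) \<Rightarrow> nat \<Rightarrow> 'a measure set" for s n where
  "n \<le> k \<Longrightarrow> s k \<in> tail_hull s n"
| "x \<in> tail_hull s n \<Longrightarrow> y \<in> tail_hull s n \<Longrightarrow> half_sum x y \<in> tail_hull s n"

text \<open>The measures of norm at most \<open>b\<close> carried by \<open>A\<close> have a vaguely dense countable subset, since the
  vague topology is given by countably many integrals. Midpoint combinations of the tails of a vaguely
  convergent norm bounded sequence can be chosen strongly Cauchy, and their strong limit is the
  vague limit. So combinations of countably many measures carried by \<open>A\<close> are strongly dense, and each
  of them is carried by a countable union of compact subsets of \<open>A\<close>.\<close>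

theorem strongly_dense_K_sigma:
  fixes A :: "'a set"
  obtains A0 where "K_sigma A0" "A0 \<subseteq> A"
    "\<And>M. M \<in> cone_on A \<Longrightarrow> \<exists>c. (\<forall>n. c n \<in> cone_on A0) \<and> (\<lambda>n. dist2 (c n) M) \<longlonglongrightarrow> 0"
proof -
  obtain G :: "('a \<Rightarrow> real) set" where G: "countable G" "G \<subseteq> Cc" "\<And>g x. g \<in> G \<Longrightarrow> 0 \<le> g x"
    "\<And>M N. locally_finite_measure M \<Longrightarrow> locally_finite_measure N \<Longrightarrow>
      (\<And>g. g \<in> G \<Longrightarrow> (\<integral>x. g x \<partial>M) = (\<integral>x. g x \<partial>N)) \<Longrightarrow> M = N"
    by (rule countable_determining_family) blast
  define g where "g = from_nat_into (insert (\<lambda>x. 0) G)"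
  have gr: "range g = insert (\<lambda>x. 0) G" unfolding g_def by (rule range_from_nat_into) (use G(1) in auto)
  have "g i \<in> insert (\<lambda>x. 0) G" for i unfolding gr[symmetric] by simp
  then have gi: "g i \<in> insert (\<lambda>x. 0) G" for i .
  have g: "g i \<in> Cc" "0 \<le> g i x" for i x
  proof -
    have "g i \<in> Cc \<and> 0 \<le> g i x"
    proof (cases "g i \<in> G")
      case False
      then have "g i = (\<lambda>x. 0)" using gi[of i] by blast
      then show ?thesis using Cc_zero by simp
    qed (use G(2,3) in auto)
    then show "g i \<in> Cc" "0 \<le> g i x" by auto
  qed
  define \<Phi> where "\<Phi> M i = (\<integral>x. g i x \<partial>M)" for M :: "'a measure" and i
  define T where "T b = {M \<in> cone_on A. ip M M \<le> real b}" for b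
  have "\<exists>D. countable D \<and> D \<subseteq> T b \<and> \<Phi> ` T b \<subseteq> closure (\<Phi> ` D)" for b
  proof -
    obtain E where E: "countable E" "E \<subseteq> \<Phi> ` T b" "\<Phi> ` T b \<subseteq> closure E"
      by (rule second_countable_dense_subset)
    then obtain D where "D \<subseteq> T b" "countable D" "E = \<Phi> ` D" by (meson countable_subset_image)
    then show ?thesis using E(3) by blast
  qed
  then obtain D where D: "\<And>b. countable (D b)" "\<And>b. D b \<subseteq> T b" "\<And>b. \<Phi> ` T b \<subseteq> closure (\<Phi> ` D b)" by metis
  define DD where "DD = (\<Union>b. D b)"
  have cDD: "countable DD" using D(1) by (simp add: DD_def)
  have DDA: "s \<in> cone_on A" if "s \<in> DD" for s using that D(2) by (auto simp: DD_def T_def)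
  have "\<exists>S. K_sigma S \<and> S \<subseteq> A \<and> (AE x in s. x \<in> S)" if "s \<in> DD" for s
  proof -
    have "locally_finite_measure s" "AE x in s. x \<in> A"
      using DDA[OF that] cone_locally_finite by (auto simp: cone_on_def)
    then show ?thesis by (rule carried_by_K_sigma) blast
  qed
  then obtain S where S: "\<And>s. s \<in> DD \<Longrightarrow> K_sigma (S s) \<and> S s \<subseteq> A \<and> (AE x in s. x \<in> S s)" by metis
  define A0 where "A0 = (\<Union>s\<in>DD. S s)"
  have DDA0: "s \<in> cone_on A0" if "s \<in> DD" for s
  proof -
    have "AE x in s. x \<in> S s" using S[OF that] by blast
    then have "AE x in s. x \<in> A0" by (rule eventually_mono) (use that in \<open>auto simp: A0_def\<close>)
    then show ?thesis using DDA[OF that] by (simp add: cone_on_def)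
  qed
  show thesis
  proof (rule that[of A0])
    show "K_sigma A0" unfolding A0_def using S cDD by (intro K_sigma_UN) auto
    show "A0 \<subseteq> A" using S by (auto simp: A0_def)
    fix M assume M: "M \<in> cone_on A"
    have Mc: "M \<in> energy_cone" using M by (rule cone_on_cone)
    obtain b :: nat where b: "ip M M \<le> real b" using real_arch_simple by blast
    then have "\<Phi> M \<in> closure (\<Phi> ` D b)" using M D(3)[of b] by (auto simp: T_def)
    then obtain y where y: "\<And>n. y n \<in> \<Phi> ` D b" "y \<longlonglongrightarrow> \<Phi> M" unfolding closure_sequential by blast
    then have "\<forall>n. \<exists>s. s \<in> D b \<and> y n = \<Phi> s" by blast
    then obtain s where s: "\<And>n. s n \<in> D b" "\<And>n. y n = \<Phi> (s n)" by metis
    have sA0: "s n \<in> cone_on A0" for n using s(1) by (intro DDA0) (auto simp: DD_def)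
    have sb: "ip (s n) (s n) \<le> real b" for n using s(1) D(2) by (auto simp: T_def)
    have lim: "(\<lambda>n. \<integral>x. g i x \<partial>s n) \<longlonglongrightarrow> (\<integral>x. g i x \<partial>M)" for i
    proof -
      have "(\<lambda>n. y n i) \<longlonglongrightarrow> \<Phi> M i"
        by (rule continuous_on_tendsto_compose[OF continuous_on_product_coordinates y(2)]) auto
      then show ?thesis by (simp add: s(2) \<Phi>_def)
    qed
    have hull: "tail_hull s n \<subseteq> cone_on A0" for n
    proof
      fix x assume "x \<in> tail_hull s n"
      then show "x \<in> cone_on A0" by induction (auto intro: sA0 cone_on_half_sum)
    qed
    have hc: "x \<in> energy_cone" if "x \<in> tail_hull s n" for x n using hull that cone_on_cone by blast
    have sub: "tail_hull s m \<subseteq> tail_hull s n" if "n \<le> m" for m n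
    proof
      fix x assume "x \<in> tail_hull s m"
      then show "x \<in> tail_hull s n" by induction (use that in \<open>auto intro: tail_hull.intros\<close>)
    qed
    obtain c where c: "\<And>n. c n \<in> tail_hull s n" "cauchy_seq c"
    proof (rule near_minimizers[where S = "tail_hull s" and J = "\<lambda>x. ip x x" and L = 0 and B = "real b"])
      show "tail_hull s n \<noteq> {}" for n using tail_hull.intros(1)[of n n s] by auto
      show "Inf ((\<lambda>x. ip x x) ` tail_hull s n) \<le> real b" for n
      proof (rule cInf_lower2)
        show "ip (s n) (s n) \<in> (\<lambda>x. ip x x) ` tail_hull s n" using tail_hull.intros(1)[of n n s] by auto
        show "bdd_below ((\<lambda>x. ip x x) ` tail_hull s n)" by (rule bdd_belowI[of _ 0]) (auto simp: ip_nonneg)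
      qed (rule sb)
    qed (use sub hc in \<open>auto simp: ip_nonneg parallelogram intro: tail_hull.intros\<close>)
    have cc: "c n \<in> energy_cone" for n using c(1) hc by blast
    obtain P where P: "P \<in> energy_cone" "(\<lambda>n. dist2 (c n) P) \<longlonglongrightarrow> 0"
      "\<And>f l. f \<in> Cc \<Longrightarrow> (\<lambda>n. \<integral>x. f x \<partial>c n) \<longlonglongrightarrow> l \<Longrightarrow> (\<integral>x. f x \<partial>P) = l"
      by (rule strongly_complete[OF cc c(2)]) blast
    have Pg: "(\<integral>x. g i x \<partial>P) = (\<integral>x. g i x \<partial>M)" for i
    proof (rule P(3)[OF g(1)], rule LIMSEQ_I)
      let ?l = "\<integral>x. g i x \<partial>M"
      fix e :: real assume "e > 0"
      then obtain N where N: "\<And>n. n \<ge> N \<Longrightarrow> norm ((\<integral>x. g i x \<partial>s n) - ?l) < e"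
        using LIMSEQ_D[OF lim] by metis
      have close: "norm ((\<integral>x. g i x \<partial>x) - ?l) < e" if "x \<in> tail_hull s N" for x
        using that
      proof induction
        case (1 k) then show ?case by (rule N)
      next
        case (2 x y)
        have "(\<integral>z. g i z \<partial>half_sum x y) - ?l = (((\<integral>z. g i z \<partial>x) - ?l) + ((\<integral>z. g i z \<partial>y) - ?l)) / 2"
          using integral_half_sum[OF hc[OF 2(1)] hc[OF 2(2)] g(1) g(2), of i] by (simp add: field_simps)
        then show ?case using 2(3,4) by (simp add: abs_if split: if_splits)
      qed
      show "\<exists>N. \<forall>n\<ge>N. norm ((\<integral>x. g i x \<partial>c n) - ?l) < e"
        using close c(1) sub by (meson subsetD)
    qed
    have "P = M"
    proof (rule G(4)[OF cone_locally_finite[OF P(1)] cone_locally_finite[OF Mc]])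
      fix h assume "h \<in> G"
      then obtain i where "h = g i" using gr by (metis insertI2 imageE)
      then show "(\<integral>x. h x \<partial>P) = (\<integral>x. h x \<partial>M)" using Pg by simp
    qed
    then show "\<exists>c. (\<forall>n. c n \<in> cone_on A0) \<and> (\<lambda>n. dist2 (c n) M) \<longlonglongrightarrow> 0"
      using P(2) c(1) hull by blast
  qed
qed

section \<open>Existence of the inner balayage\<close>

text \<open>The weak inequality passes to strong limits of the test measures.\<close>

lemma sweeps_dense:
  assumes dense: "\<And>M. M \<in> cone_on A \<Longrightarrow> \<exists>c. (\<forall>n. c n \<in> cone_on A0) \<and> (\<lambda>n. dist2 (c n) M) \<longlonglongrightarrow> 0"
    and \<mu>: "\<mu> \<in> energy_cone" and \<nu>: "\<nu> \<in> sweeps A0 \<mu>"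
  shows "\<nu> \<in> sweeps A \<mu>"
proof -
  have \<nu>c: "\<nu> \<in> energy_cone" using \<nu> by (rule sweeps_cone)
  have "ip \<mu> t \<le> ip \<nu> t" if t: "t \<in> cone_on A" for t
  proof -
    obtain c where c: "\<And>n. c n \<in> cone_on A0" "(\<lambda>n. dist2 (c n) t) \<longlonglongrightarrow> 0" using dense[OF t] by blast
    have cc: "c n \<in> energy_cone" for n using c(1) cone_on_cone by blast
    have tc: "t \<in> energy_cone" using t by (rule cone_on_cone)
    have "ip (c n) \<mu> \<le> ip (c n) \<nu>" for n
      using \<nu> c(1)[of n] ip_commute[OF cc \<mu>] ip_commute[OF cc \<nu>c] by (simp add: sweeps_def)
    then have "ip t \<mu> \<le> ip t \<nu>"
      by (intro LIMSEQ_le[OF ip_limit[OF cc tc c(2) \<mu>] ip_limit[OF cc tc c(2) \<nu>c]]) auto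
    then show ?thesis using ip_commute[OF tc \<mu>] ip_commute[OF tc \<nu>c] by simp
  qed
  then show ?thesis using \<nu>c by (simp add: sweeps_def)
qed

lemma sweeps_UN:
  assumes B: "\<And>n. B n \<in> sets borel" and \<mu>: "\<mu> \<in> energy_cone" and \<nu>: "\<And>n. \<nu> \<in> sweeps (B n) \<mu>"
  shows "\<nu> \<in> sweeps (\<Union>n. B (n::nat)) \<mu>"
proof -
  have \<nu>c: "\<nu> \<in> energy_cone" using \<nu> by (rule sweeps_cone)
  have "ip \<mu> t \<le> ip \<nu> t" if t: "t \<in> cone_on (\<Union>n. B n)" for t
  proof -
    have tc: "t \<in> energy_cone" using t by (rule cone_on_cone)
    have Bt: "B n \<in> sets t" for n using B cone_sets[OF tc] by simp
    have "AE x in t. x \<in> B n \<longrightarrow> pot \<mu> x \<le> pot \<nu> x" for n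
    proof -
      have "restrict_to t (B n) \<in> cone_on (B n)"
        using cone_on_restrict[OF t B] cone_on_mono[of "(\<Union>n. B n) \<inter> B n" "B n"] by auto
      then have "AE x in restrict_to t (B n). pot \<mu> x \<le> pot \<nu> x" by (rule sweeps_AE[OF \<nu> \<mu>])
      then show ?thesis unfolding AE_restrict[OF Bt] .
    qed
    then have "AE x in t. \<forall>n. x \<in> B n \<longrightarrow> pot \<mu> x \<le> pot \<nu> x" unfolding AE_all_countable by (rule allI)
    moreover have "AE x in t. x \<in> (\<Union>n. B n)" using t by (simp add: cone_on_def)
    ultimately have "AE x in t. pot \<mu> x \<le> pot \<nu> x" by eventually_elim blast
    then show ?thesis by (rule ip_mono_AE[OF \<mu> \<nu>c tc])
  qed
  then show ?thesis using \<nu>c by (simp add: sweeps_def)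
qed

text \<open>The projection \<open>p\<close> of \<open>\<mu>\<close> satisfies \<open>pot \<mu> \<le> pot p\<close> almost everywhere for \<open>p\<close> itself, since \<open>p\<close> lies in the
  cone, and equality holds there because the integrals \<open>ip \<mu> p\<close> and \<open>ip p p\<close> agree. So every competitor dominates \<open>p\<close> almost everywhere for \<open>p\<close>, and the domination principle applies.\<close>

lemma projection_sweeps:
  assumes F: "closed F" and \<mu>: "\<mu> \<in> energy_cone"
  obtains p where "p \<in> cone_on F" "p \<in> sweeps F \<mu>" "ip p p = ip \<mu> p" "ip p p \<le> ip \<mu> \<mu>"
    "\<And>\<nu> x. \<nu> \<in> sweeps F \<mu> \<Longrightarrow> pot p x \<le> pot \<nu> x"
proof -
  obtain p where p: "p \<in> cone_on F"
    "\<And>t. t \<in> cone_on F \<Longrightarrow> ip \<mu> t - ip (null_measure borel) t \<le> ip p t"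
    "ip p p = ip \<mu> p - ip (null_measure borel) p" "ip p p \<le> dist2 \<mu> (null_measure borel)"
    by (rule projection[OF F \<mu> cone_null]) blast
  have pc: "p \<in> energy_cone" using p(1) by (rule cone_on_cone)
  have sw: "p \<in> sweeps F \<mu>" using pc p(2) cone_on_cone by (auto simp: sweeps_def ip_null)
  have eq: "ip p p = ip \<mu> p" using p(3) pc by (simp add: ip_null)
  have le: "ip p p \<le> ip \<mu> \<mu>"
    using p(4) ip_commute[OF \<mu> cone_null] by (simp add: dist2_def ip_null \<mu> cone_null)
  have touch: "AE x in p. pot p x \<le> pot \<mu> x"
    by (rule AE_pot_le_of_ip_le[OF \<mu> pc pc sweeps_AE[OF sw \<mu> p(1)]]) (simp add: eq)
  have "pot p x \<le> pot \<nu> x" if \<nu>: "\<nu> \<in> sweeps F \<mu>" for \<nu> x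
  proof (rule domination[OF pc sweeps_cone[OF \<nu>]])
    show "AE x in p. pot p x \<le> pot \<nu> x"
      using touch sweeps_AE[OF \<nu> \<mu> p(1)] by eventually_elim (rule order_trans)
  qed
  then show thesis using that[OF p(1) sw eq le] by blast
qed

text \<open>The projections onto the cones of an exhausting sequence of compact sets increase to the
  balayage.\<close>

theorem minimal_sweep:
  assumes \<mu>: "\<mu> \<in> energy_cone"
  obtains p where "p \<in> sweeps A \<mu>" "\<And>\<nu> x. \<nu> \<in> sweeps A \<mu> \<Longrightarrow> pot p x \<le> pot \<nu> x"
proof -
  obtain A0 where A0: "K_sigma A0" "A0 \<subseteq> A"
    and dense: "\<And>M. M \<in> cone_on A \<Longrightarrow> \<exists>c. (\<forall>n. c n \<in> cone_on A0) \<and> (\<lambda>n. dist2 (c n) M) \<longlonglongrightarrow> 0"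
    by (rule strongly_dense_K_sigma) blast
  obtain K :: "nat \<Rightarrow> 'a set" where K: "\<And>n. compact (K n)" "A0 = (\<Union>n. K n)"
    using A0(1) by (auto simp: K_sigma_def)
  define F where "F n = (\<Union>i\<le>n. K i)" for n
  have F: "closed (F n)" for n
    unfolding F_def using K(1) by (intro compact_imp_closed compact_UN) auto
  have incF: "incseq F" unfolding F_def by (intro incseq_SucI UN_mono) auto
  have UF: "A0 = (\<Union>n. F n)" unfolding K(2) F_def by auto
  have "\<exists>p. p \<in> cone_on (F n) \<and> p \<in> sweeps (F n) \<mu> \<and> ip p p = ip \<mu> p \<and> ip p p \<le> ip \<mu> \<mu> \<and>
      (\<forall>\<nu>\<in>sweeps (F n) \<mu>. \<forall>x. pot p x \<le> pot \<nu> x)" for n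
    by (rule projection_sweeps[OF F[of n] \<mu>]) blast
  then obtain p where p: "\<And>n. p n \<in> cone_on (F n)" "\<And>n. p n \<in> sweeps (F n) \<mu>"
    "\<And>n. ip (p n) (p n) = ip \<mu> (p n)" "\<And>n. ip (p n) (p n) \<le> ip \<mu> \<mu>"
    "\<And>n \<nu> x. \<nu> \<in> sweeps (F n) \<mu> \<Longrightarrow> pot (p n) x \<le> pot \<nu> x" by metis
  have pc: "p n \<in> energy_cone" for n using p(1) cone_on_cone by blast
  have "cauchy_seq p"
  proof (rule increasing_cauchy[OF pc _ p(4)])
    fix m n :: nat assume "n \<le> m"
    then have "p n \<in> cone_on (F m)" using p(1)[of n] incF cone_on_mono by (meson incseqD subsetD)
    then show "ip (p n) (p n) \<le> ip (p m) (p n)" using p(2)[of m] p(3)[of n] by (simp add: sweeps_def)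
  qed
  then obtain q where q: "q \<in> cone_on UNIV" "(\<lambda>n. dist2 (p n) q) \<longlonglongrightarrow> 0"
    using cone_on_complete[OF closed_UNIV, of p] pc by (metis cone_on_UNIV)
  have qc: "q \<in> energy_cone" using q(1) by (rule cone_on_cone)
  have "q \<in> sweeps (F n) \<mu>" for n
  proof -
    have "ip \<mu> t \<le> ip q t" if t: "t \<in> cone_on (F n)" for t
    proof (rule LIMSEQ_le[OF tendsto_const ip_limit[OF pc qc q(2) cone_on_cone[OF t]]])
      have "ip \<mu> t \<le> ip (p m) t" if "n \<le> m" for m
        using p(2)[of m] t cone_on_mono[OF incseqD[OF incF that]] by (auto simp: sweeps_def)
      then show "\<exists>N. \<forall>m\<ge>N. ip \<mu> t \<le> ip (p m) t" by blast
    qed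
    then show ?thesis using qc by (simp add: sweeps_def)
  qed
  then have "q \<in> sweeps A0 \<mu>"
    unfolding UF using F by (intro sweeps_UN \<mu>) auto
  then have "q \<in> sweeps A \<mu>" using sweeps_dense[of A A0 \<mu> q] dense \<mu> by blast
  moreover have "pot q x \<le> pot \<nu> x" if \<nu>: "\<nu> \<in> sweeps A \<mu>" for \<nu> x
  proof (rule pot_le_of_ip_le[OF qc sweeps_cone[OF \<nu>]])
    fix t assume t: "t \<in> energy_cone"
    have "\<nu> \<in> sweeps (F n) \<mu>" for n
      using sweeps_antimono[of "F n" A \<mu>] \<nu> A0(2) UF by blast
    then have "ip (p n) t \<le> ip \<nu> t" for n
      by (intro ip_mono_AE pc sweeps_cone[OF \<nu>] t always_eventually allI p(5))
    then show "ip q t \<le> ip \<nu> t"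
      by (intro LIMSEQ_le[OF ip_limit[OF pc qc q(2) t] tendsto_const]) auto
  qed
  ultimately show thesis by (rule that)
qed

end

section \<open>Capacitability of Borel sets\<close>

text \<open>Dellacherie's scrapers, seen as a game: a player answers a finite decreasing sequence of sets, the
  last of which belongs to the collection \<open>\<C>\<close> of large sets, by a large subset of the last one, and the opponent
  shrinks the answer to a large set. A strategy sees the whole history of moves. A set \<open>A\<close> is scraped when
  some strategy forces the intersection of the closures into \<open>A\<close>, provided that the game starts inside \<open>A\<close>.
  Unlike the inner approximation property itself, this is stable under countable intersections.\<close>

definition legal_strategy :: "'a set set \<Rightarrow> ('a set list \<Rightarrow> 'a set) \<Rightarrow> bool" where
  "legal_strategy \<C> F \<longleftrightarrow> (\<forall>h. h \<noteq> [] \<and> last h \<in> \<C> \<longrightarrow> F h \<subseteq> last h \<and> F h \<in> \<C>)"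

definition play :: "'a set set \<Rightarrow> ('a set list \<Rightarrow> 'a set) \<Rightarrow> (nat \<Rightarrow> 'a set) \<Rightarrow> bool" where
  "play \<C> F P \<longleftrightarrow> (\<forall>n. P n \<in> \<C> \<and> P (Suc n) \<subseteq> F (map P [0..<Suc n]))"

definition scraped :: "'a::topological_space set set \<Rightarrow> 'a set \<Rightarrow> bool" where
  "scraped \<C> A \<longleftrightarrow> (\<exists>F. legal_strategy \<C> F \<and>
     (\<forall>P. play \<C> F P \<and> P 0 \<subseteq> A \<longrightarrow> (\<Inter>n. closure (P n)) \<subseteq> A))"

lemma play_decreasing:
  assumes "legal_strategy \<C> F" "play \<C> F P" "m \<le> n"
  shows "P n \<subseteq> P m"
proof -
  have "P (Suc n) \<subseteq> P n" for n
  proof -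
    have "P (Suc n) \<subseteq> F (map P [0..<Suc n])" "P n \<in> \<C>" using assms(2) by (auto simp: play_def)
    moreover have "last (map P [0..<Suc n]) = P n" by simp
    ultimately show ?thesis
      using assms(1) unfolding legal_strategy_def by (metis map_is_Nil_conv order_trans upt_Suc_append le0 append_is_Nil_conv not_Cons_self2)
  qed
  then have "decseq P" by (rule decseq_SucI)
  then show ?thesis using assms(3) by (rule decseqD)
qed

lemma scraped_closed:
  assumes "closed A"
  shows "scraped \<C> A"
  unfolding scraped_def
proof (intro exI[of _ last] conjI allI impI)
  show "legal_strategy \<C> last" by (simp add: legal_strategy_def)
  fix P assume P: "play \<C> last P \<and> P 0 \<subseteq> A"
  have "closure (P 0) \<subseteq> A" using P assms by (intro closure_minimal) auto
  then show "(\<Inter>n. closure (P n)) \<subseteq> A" by blast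
qed

text \<open>The strategies of all the sets are followed at once, the \<open>k\<close>-th one at the times that code a
  pair \<open>(k, j)\<close>.\<close>

lemma scraped_INT:
  assumes "\<And>k::nat. scraped \<C> (A k)"
  shows "scraped \<C> (\<Inter>k. A k)"
proof -
  obtain F where F: "\<And>k. legal_strategy \<C> (F k)"
    "\<And>k P. play \<C> (F k) P \<Longrightarrow> P 0 \<subseteq> A k \<Longrightarrow> (\<Inter>n. closure (P n)) \<subseteq> A k"
    using assms unfolding scraped_def by metis
  define G where "G h = (case prod_decode (length h - 1) of (k, j) \<Rightarrow>
    F k (map (\<lambda>i. h ! prod_encode (k, i)) [0..<Suc j]))" for h
  have step: "prod_encode (k, j) < prod_encode (k, Suc j)" for k j
    by (simp add: prod_encode_def)
  have mono: "i \<le> j \<Longrightarrow> prod_encode (k, i) \<le> prod_encode (k, j)" for i j k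
    by (rule lift_Suc_mono_le[of "\<lambda>j. prod_encode (k, j)"]) (auto intro: less_imp_le step)
  have legal: "legal_strategy \<C> G"
    unfolding legal_strategy_def
  proof (intro allI impI)
    fix h assume h: "h \<noteq> [] \<and> last h \<in> \<C>"
    obtain k j where kj: "prod_decode (length h - 1) = (k, j)" by (cases "prod_decode (length h - 1)")
    then have e: "prod_encode (k, j) = length h - 1" by (metis prod_decode_inverse)
    define h' where "h' = map (\<lambda>i. h ! prod_encode (k, i)) [0..<Suc j]"
    have "h' \<noteq> []" "last h' = last h" using h by (auto simp: h'_def e last_conv_nth)
    moreover have "G h = F k h'" by (simp only: G_def kj h'_def prod.case)
    moreover have "F k h' \<subseteq> last h' \<and> F k h' \<in> \<C>"
      by (rule F(1)[of k, unfolded legal_strategy_def, rule_format]) (use h calculation in simp)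
    ultimately show "G h \<subseteq> last h \<and> G h \<in> \<C>" by simp
  qed
  moreover have "(\<Inter>n. closure (P n)) \<subseteq> (\<Inter>k. A k)" if P: "play \<C> G P" "P 0 \<subseteq> (\<Inter>k. A k)" for P
  proof (rule INT_greatest)
    fix k
    define Q where "Q j = P (prod_encode (k, j))" for j
    have "play \<C> (F k) Q" unfolding play_def
    proof (intro allI conjI)
      fix j
      show "Q j \<in> \<C>" using P(1) by (simp add: play_def Q_def)
      let ?n = "prod_encode (k, j)"
      have "Q (Suc j) \<subseteq> P (Suc ?n)"
        unfolding Q_def using step by (intro play_decreasing[OF legal P(1)]) (simp add: Suc_le_eq)
      also have "\<dots> \<subseteq> G (map P [0..<Suc ?n])" using P(1) by (simp add: play_def)
      also have "\<dots> = F k (map (\<lambda>i. map P [0..<Suc ?n] ! prod_encode (k, i)) [0..<Suc j])"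
        by (simp add: G_def)
      also have "map (\<lambda>i. map P [0..<Suc ?n] ! prod_encode (k, i)) [0..<Suc j] = map Q [0..<Suc j]"
        using mono by (intro map_cong refl) (auto simp: Q_def less_Suc_eq_le simp del: upt_Suc)
      finally show "Q (Suc j) \<subseteq> F k (map Q [0..<Suc j])" .
    qed
    moreover have "Q 0 \<subseteq> A k"
      using play_decreasing[OF legal P(1), of 0 "prod_encode (k, 0)"] P(2) by (auto simp: Q_def)
    ultimately have "(\<Inter>j. closure (Q j)) \<subseteq> A k" by (rule F(2))
    then show "(\<Inter>n. closure (P n)) \<subseteq> A k" by (auto simp: Q_def)
  qed
  ultimately show ?thesis unfolding scraped_def by blast
qed

text \<open>The first answer cuts the opening set \<open>P\<close> down to a large part \<open>P \<inter> A m\<close>; from then on the strategy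
  of \<open>A m\<close> is followed, with the opening set dropped from the history.\<close>

lemma scraped_incseq_UN:
  assumes \<C>: "\<And>B. incseq B \<Longrightarrow> (\<Union>n::nat. B n) \<in> \<C> \<Longrightarrow> \<exists>n. B n \<in> \<C>"
    and A: "incseq A" "\<And>k::nat. scraped \<C> (A k)"
  shows "scraped \<C> (\<Union>k. A k)"
proof -
  obtain F where F: "\<And>k. legal_strategy \<C> (F k)"
    "\<And>k P. play \<C> (F k) P \<Longrightarrow> P 0 \<subseteq> A k \<Longrightarrow> (\<Inter>n. closure (P n)) \<subseteq> A k"
    using A(2) unfolding scraped_def by metis
  have "\<exists>m. P \<inter> A m \<in> \<C>" if "P \<in> \<C>" "P \<subseteq> (\<Union>k. A k)" for P
  proof (rule \<C>)
    show "incseq (\<lambda>m. P \<inter> A m)" using A(1) by (auto simp: incseq_def)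
    have "(\<Union>m. P \<inter> A m) = P" using that(2) by blast
    then show "(\<Union>m. P \<inter> A m) \<in> \<C>" using that(1) by simp
  qed
  then obtain m where m: "\<And>P. P \<in> \<C> \<Longrightarrow> P \<subseteq> (\<Union>k. A k) \<Longrightarrow> P \<inter> A (m P) \<in> \<C>" by metis
  define G where "G h = (if hd h \<subseteq> (\<Union>k. A k) then
    (if tl h = [] then hd h \<inter> A (m (hd h)) else F (m (hd h)) (tl h)) else last h)" for h
  have legal: "legal_strategy \<C> G" unfolding legal_strategy_def
  proof (intro allI impI)
    fix h assume h: "h \<noteq> [] \<and> last h \<in> \<C>"
    then obtain P r where hr: "h = P # r" by (cases h) auto
    show "G h \<subseteq> last h \<and> G h \<in> \<C>"
    proof (cases "r = []")
      case True
      then show ?thesis using h m[of P] by (auto simp: G_def hr)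
    next
      case False
      then show ?thesis using h F(1)[of "m P"] by (auto simp: G_def hr legal_strategy_def)
    qed
  qed
  moreover have "(\<Inter>n. closure (P n)) \<subseteq> (\<Union>k. A k)" if P: "play \<C> G P" "P 0 \<subseteq> (\<Union>k. A k)" for P
  proof -
    define Q where "Q n = P (Suc n)" for n
    have map_P: "map P [0..<Suc (Suc n)] = P 0 # map Q [0..<Suc n]" for n
      by (simp only: upt_conv_Cons[OF zero_less_Suc] map_Suc_upt[symmetric] list.map map_map Q_def o_def)
    have "Q 0 \<subseteq> G (map P [0..<Suc 0])" unfolding Q_def using P(1) unfolding play_def by blast
    then have Q0: "Q 0 \<subseteq> A (m (P 0))" using P(2) by (simp add: G_def)
    have "play \<C> (F (m (P 0))) Q" unfolding play_def
    proof (intro allI conjI)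
      fix n
      show "Q n \<in> \<C>" using P(1) by (simp add: play_def Q_def)
      have "Q (Suc n) \<subseteq> G (map P [0..<Suc (Suc n)])" unfolding Q_def using P(1) unfolding play_def by blast
      then show "Q (Suc n) \<subseteq> F (m (P 0)) (map Q [0..<Suc n])"
        unfolding map_P using P(2) by (simp add: G_def)
    qed
    then have "(\<Inter>n. closure (Q n)) \<subseteq> A (m (P 0))" using Q0 by (rule F(2))
    then show ?thesis by (auto simp: Q_def)
  qed
  ultimately show ?thesis unfolding scraped_def by blast
qed

text \<open>Complements are avoided, since a strategy for a set yields none for its complement; increasing unions
  suffice because the hull turns out to be closed under finite unions.\<close>

inductive_set monotone_hull :: "'a::topological_space set set" where
  "compact K \<Longrightarrow> K \<in> monotone_hull"
| "(\<And>n::nat. A n \<in> monotone_hull) \<Longrightarrow> (\<Inter>n. A n) \<in> monotone_hull"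
| "incseq A \<Longrightarrow> (\<And>n::nat. A n \<in> monotone_hull) \<Longrightarrow> (\<Union>n. A n) \<in> monotone_hull"

lemma monotone_hull_Un_compact:
  assumes "A \<in> monotone_hull" "compact K"
  shows "A \<union> K \<in> monotone_hull"
  using assms(1)
proof induction
  case (1 L)
  then show ?case using assms(2) by (intro monotone_hull.intros(1) compact_Un)
next
  case (2 A)
  have "(\<Inter>n. A n) \<union> K = (\<Inter>n. A n \<union> K)" by blast
  then show ?case using 2 by (metis monotone_hull.intros(2))
next
  case (3 A)
  have "(\<Union>n. A n) \<union> K = (\<Union>n. A n \<union> K)" by blast
  moreover have "incseq (\<lambda>n. A n \<union> K)" using 3(1) by (fastforce simp: incseq_def)
  ultimately show ?case using 3 by (metis (mono_tags, lifting) monotone_hull.intros(3))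
qed

lemma monotone_hull_Un:
  assumes "A \<in> monotone_hull" "B \<in> monotone_hull"
  shows "A \<union> B \<in> monotone_hull"
  using assms(1)
proof induction
  case (1 K)
  have "B \<union> K \<in> monotone_hull" by (rule monotone_hull_Un_compact[OF assms(2) 1])
  then show ?case by (simp only: Un_commute)
next
  case (2 A)
  have "(\<Inter>n. A n) \<union> B = (\<Inter>n. A n \<union> B)" by blast
  then show ?case using 2 by (metis monotone_hull.intros(2))
next
  case (3 A)
  have "(\<Union>n. A n) \<union> B = (\<Union>n. A n \<union> B)" by blast
  moreover have "incseq (\<lambda>n. A n \<union> B)" using 3(1) by (fastforce simp: incseq_def)
  ultimately show ?case using 3 by (metis (mono_tags, lifting) monotone_hull.intros(3))
qed

lemma monotone_hull_UN:
  assumes "\<And>n::nat. A n \<in> monotone_hull"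
  shows "(\<Union>n. A n) \<in> monotone_hull"
proof -
  define B where "B n = (\<Union>i\<le>n. A i)" for n
  have "B n \<in> monotone_hull" for n
  proof (induction n)
    case 0
    then show ?case using assms by (simp add: B_def)
  next
    case (Suc n)
    have "B (Suc n) = B n \<union> A (Suc n)" by (auto simp: B_def atMost_Suc)
    then show ?case using monotone_hull_Un[OF Suc assms] by simp
  qed
  moreover have "incseq B" unfolding B_def by (intro incseq_SucI UN_mono) auto
  ultimately have "(\<Union>n. B n) \<in> monotone_hull" by (intro monotone_hull.intros(3))
  moreover have "(\<Union>n. B n) = (\<Union>n. A n)" by (auto simp: B_def)
  ultimately show ?thesis by simp
qed

context lcsc_space
begin

lemma open_K_sigma:
  fixes U :: "'a set"
  assumes U: "open U"
  shows "K_sigma U"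
proof -
  obtain B :: "'a set set" where B: "countable B" "topological_basis B" using ex_countable_basis by blast
  define \<C> where "\<C> = closure ` {b \<in> B. compact (closure b) \<and> closure b \<subseteq> U}"
  have "\<exists>K\<in>\<C>. x \<in> K" if x: "x \<in> U" for x
  proof -
    obtain W where W: "open W" "{x} \<subseteq> W" "compact (closure W)" "closure W \<subseteq> U"
      by (rule relatively_compact_neighbourhood[OF compact_sing[of x] U]) (use x in auto)
    obtain b where b: "b \<in> B" "x \<in> b" "b \<subseteq> W" using W(1,2) by (meson B(2) insert_subset topological_basisE)
    have cl: "closure b \<subseteq> closure W" by (rule closure_mono[OF b(3)])
    have "compact (closure b)" by (rule compact_closure_subset[OF W(3) cl])
    then have "closure b \<in> \<C>" using b(1) cl W(4) by (auto simp: \<C>_def)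
    then show ?thesis using b(2) closure_subset[of b] by blast
  qed
  then have "U = \<Union>\<C>" by (auto simp: \<C>_def)
  then show ?thesis unfolding K_sigma_iff
    by (intro exI[of _ \<C>]) (use B(1) in \<open>auto simp: \<C>_def\<close>)
qed

lemma borel_monotone_hull:
  fixes B :: "'a set"
  assumes "B \<in> sets borel"
  shows "B \<in> monotone_hull"
proof -
  obtain K :: "nat \<Rightarrow> 'a set" where K: "\<And>n. compact (K n)" "(\<Union>n. K n) = UNIV"
    using compact_exhaustion by metis
  have closed: "F \<in> monotone_hull" if "closed F" for F :: "'a set"
  proof -
    have "(\<Union>n. K n \<inter> F) \<in> monotone_hull"
      using K(1) that by (intro monotone_hull_UN monotone_hull.intros(1) compact_Int_closed)
    moreover have "(\<Union>n. K n \<inter> F) = F" using K(2) by blast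
    ultimately show ?thesis by simp
  qed
  have "B \<in> sigma_sets UNIV {S. open S}" using assms by (simp add: borel_def)
  then have "B \<in> monotone_hull \<and> - B \<in> monotone_hull"
  proof induction
    case (Basic U)
    then obtain L :: "nat \<Rightarrow> 'a set" where L: "\<forall>n. compact (L n)" "U = (\<Union>n. L n)"
      using open_K_sigma[of U] by (auto simp: K_sigma_def)
    have "U \<in> monotone_hull"
      unfolding L(2) by (intro monotone_hull_UN monotone_hull.intros(1)) (use L(1) in simp)
    then show ?case using Basic closed[of "- U"] by auto
  next
    case Empty
    then show ?case using closed[of "{}"] closed[of UNIV] by simp
  next
    case (Compl a)
    then show ?case by (simp add: Compl_eq_Diff_UNIV[symmetric])
  next
    case (Union a)
    then have "(\<Inter>n. - a n) \<in> monotone_hull" by (intro monotone_hull.intros(2)) auto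
    then show ?case using Union by (auto intro: monotone_hull_UN)
  qed
  then show ?thesis ..
qed

text \<open>Call a set large when its capacity exceeds \<open>t\<close>. Follow a strategy of \<open>B\<close>, starting from a large
  relatively compact part of \<open>B\<close>; the intersection \<open>L\<close> of the closures is a compact subset of \<open>B\<close>. Any open
  neighbourhood of \<open>L\<close> contains some move, so its capacity exceeds \<open>t\<close>.\<close>

theorem capacitability:
  fixes I :: "'a set \<Rightarrow> real"
  assumes mono: "\<And>A B. A \<subseteq> B \<Longrightarrow> I A \<le> I B"
    and inc: "\<And>A t. incseq A \<Longrightarrow> (\<And>n::nat. I (A n) \<le> t) \<Longrightarrow> I (\<Union>n. A n) \<le> t"
    and outer: "\<And>L t. compact L \<Longrightarrow> I L < t \<Longrightarrow> \<exists>D. open D \<and> L \<subseteq> D \<and> I D < t"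
    and B: "B \<in> sets borel" "t < I B"
  obtains L where "compact L" "L \<subseteq> B" "t \<le> I L"
proof -
  define \<C> where "\<C> = {P. t < I P}"
  have \<C>: "\<exists>n. A n \<in> \<C>" if "incseq A" "(\<Union>n. A n) \<in> \<C>" for A :: "nat \<Rightarrow> 'a set"
    using inc[OF that(1), of t] that(2) by (force simp: \<C>_def not_less)
  have "scraped \<C> A" if "A \<in> monotone_hull" for A :: "'a set"
    using that
  proof induction
    case (1 K)
    then show ?case by (intro scraped_closed compact_imp_closed)
  next
    case (2 A)
    then show ?case by (intro scraped_INT)
  next
    case (3 A)
    show ?case by (rule scraped_incseq_UN[OF \<C> 3(1)]) (use 3 in auto)
  qed
  then have "scraped \<C> B" using borel_monotone_hull[OF B(1)] .
  then obtain F where F: "legal_strategy \<C> F"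
    "\<forall>P. play \<C> F P \<and> P 0 \<subseteq> B \<longrightarrow> (\<Inter>n. closure (P n)) \<subseteq> B"
    unfolding scraped_def by (elim exE conjE)
  obtain K :: "nat \<Rightarrow> 'a set" where K: "\<And>n. compact (K n)" "incseq K" "(\<Union>n. K n) = UNIV"
    using compact_exhaustion by metis
  have "\<exists>n. B \<inter> K n \<in> \<C>"
  proof (rule \<C>)
    show "incseq (\<lambda>n. B \<inter> K n)" using K(2) by (auto simp: incseq_def)
    have "(\<Union>n. B \<inter> K n) = B" using K(3) by blast
    then show "(\<Union>n. B \<inter> K n) \<in> \<C>" using B(2) by (simp add: \<C>_def)
  qed
  then obtain n0 where n0: "B \<inter> K n0 \<in> \<C>" ..
  \<comment> \<open>the moves are recorded as histories because the strategy needs the entire past\<close>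
  define hist where "hist = rec_nat [B \<inter> K n0] (\<lambda>_ h. h @ [F h])"
  have hist: "hist 0 = [B \<inter> K n0]" "hist (Suc n) = hist n @ [F (hist n)]" for n
    by (simp_all add: hist_def)
  define P where "P n = last (hist n)" for n
  have hP: "hist n = map P [0..<Suc n]" for n
  proof (induction n)
    case 0
    then show ?case by (simp add: hist P_def)
  next
    case (Suc n)
    have "hist (Suc n) = hist n @ [P (Suc n)]" by (simp add: hist P_def)
    then show ?case using Suc by simp
  qed
  have hne: "hist n \<noteq> []" for n by (induction n) (auto simp: hist)
  have PS: "P (Suc n) = F (hist n)" for n by (simp add: P_def hist)
  have PC: "P n \<in> \<C>" for n
  proof (induction n)
    case 0
    then show ?case using n0 by (simp add: P_def hist)
  next
    case (Suc n)
    then show ?case using F(1) hne[of n] unfolding legal_strategy_def PS by (simp add: P_def)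
  qed
  have play: "play \<C> F P" unfolding play_def using PC PS hP by simp
  have P0: "P 0 = B \<inter> K n0" by (simp add: P_def hist)
  define L where "L = (\<Inter>n. closure (P n))"
  have L: "L \<subseteq> B" unfolding L_def by (rule F(2)[rule_format]) (use play P0 in auto)
  have "closure (P 0) \<subseteq> K n0" unfolding P0 by (intro closure_minimal compact_imp_closed K(1)) auto
  then have cP0: "compact (closure (P 0))" by (rule compact_closure_subset[OF K(1)])
  have "L = closure (P 0) \<inter> L" by (auto simp: L_def)
  moreover have "closed L" by (auto simp: L_def)
  ultimately have cL: "compact L" using compact_Int_closed[OF cP0] by metis
  have "t \<le> I L"
  proof (rule ccontr)
    assume "\<not> t \<le> I L"
    then obtain D where D: "open D" "L \<subseteq> D" "I D < t" using outer[OF cL, of t] by auto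
    have cm: "compact (closure (P 0) - D)" using cP0 D(1) by (rule compact_diff)
    have "closure (P 0) - D \<subseteq> (\<Union>n\<in>UNIV. - closure (P n))" using D(2) by (auto simp: L_def)
    then obtain T where T: "finite T" "closure (P 0) - D \<subseteq> (\<Union>n\<in>T. - closure (P n))"
      by (rule compactE_image[OF cm, of UNIV "\<lambda>n. - closure (P n)", rotated]) auto
    obtain n where n: "\<forall>i\<in>T. i \<le> n" using T(1) finite_nat_set_iff_bounded_le by blast
    have "P n \<subseteq> closure (P i)" if "i \<in> T" for i
      using play_decreasing[OF F(1) play, of i n] n that closure_subset[of "P i"] by blast
    moreover have "P n \<subseteq> closure (P 0)"
      using play_decreasing[OF F(1) play, of 0 n] closure_subset[of "P 0"] by blast
    ultimately have "P n \<subseteq> D" using T(2) by blast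
    then show False using mono[of "P n" D] PC[of n] D(3) by (simp add: \<C>_def)
  qed
  then show thesis by (rule that[OF cL L])
qed

end

section \<open>Borel sets of inner capacity zero have outer capacity zero\<close>

context kernel_space
begin

lemma half_sum_sweeps:
  assumes "M \<in> sweeps D \<mu>" "N \<in> sweeps E \<mu>" "\<mu> \<in> energy_cone"
  shows "half_sum M N \<in> sweeps (D \<inter> E) \<mu>"
proof -
  have c: "M \<in> energy_cone" "N \<in> energy_cone" using assms sweeps_cone by auto
  have "ip \<mu> t \<le> ip (half_sum M N) t" if t: "t \<in> cone_on (D \<inter> E)" for t
  proof -
    have "t \<in> cone_on D" "t \<in> cone_on E" using t cone_on_mono[of "D \<inter> E"] by blast+
    then have "ip \<mu> t \<le> ip M t" "ip \<mu> t \<le> ip N t" using assms by (auto simp: sweeps_def)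
    then show ?thesis using ip_half_sum_left[OF c cone_on_cone[OF t]] by simp
  qed
  then show ?thesis using cone_half_sum[OF c] by (simp add: sweeps_def)
qed

lemma mnorm_add_le:
  assumes "M \<in> energy_cone" "N \<in> energy_cone"
  shows "mnorm (add_measure M N) \<le> mnorm M + mnorm N"
proof (rule real_le_lsqrt)
  have "ip (add_measure M N) (add_measure M N) = ip M M + 2 * ip M N + ip N N"
    using assms ip_commute[OF assms] by (simp add: ip_simps)
  also have "\<dots> \<le> (mnorm M + mnorm N)\<^sup>2"
    using cauchy_schwarz[OF assms] by (simp add: power2_sum ip_nonneg)
  finally show "ip (add_measure M N) (add_measure M N) \<le> (mnorm M + mnorm N)\<^sup>2" .
qed (simp add: ip_nonneg)

text \<open>The inequality holds only nearly everywhere on the open set because this is what projections onto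
  the cone of a closed neighbourhood satisfy; the open set makes the capacity below an outer one.\<close>

definition open_sweeps :: "'a measure \<Rightarrow> 'a set \<Rightarrow> 'a measure set" where
  "open_sweeps \<mu> A = (\<Union>D\<in>{D. open D \<and> A \<subseteq> D}. sweeps D \<mu>)"

definition sweep_capacity :: "'a measure \<Rightarrow> 'a set \<Rightarrow> real" where
  "sweep_capacity \<mu> A = Inf ((\<lambda>\<nu>. ip \<nu> \<nu>) ` open_sweeps \<mu> A)"

lemma open_sweeps_nonempty: "\<mu> \<in> energy_cone \<Longrightarrow> open_sweeps \<mu> A \<noteq> {}"
  by (auto simp: open_sweeps_def sweeps_def intro!: exI[of _ UNIV])

lemma open_sweeps_antimono: "A \<subseteq> B \<Longrightarrow> open_sweeps \<mu> B \<subseteq> open_sweeps \<mu> A"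
  unfolding open_sweeps_def by blast

lemma open_sweeps_cone: "\<nu> \<in> open_sweeps \<mu> A \<Longrightarrow> \<nu> \<in> energy_cone"
  by (auto simp: open_sweeps_def sweeps_cone)

lemma bdd_below_energies: "bdd_below ((\<lambda>\<nu>. ip \<nu> \<nu>) ` S)"
  by (rule bdd_belowI[of _ 0]) (auto simp: ip_nonneg)

lemma sweep_capacity_le: "\<nu> \<in> open_sweeps \<mu> A \<Longrightarrow> sweep_capacity \<mu> A \<le> ip \<nu> \<nu>"
  unfolding sweep_capacity_def by (intro cInf_lower bdd_below_energies) auto

lemma sweep_capacity_nonneg: "\<mu> \<in> energy_cone \<Longrightarrow> 0 \<le> sweep_capacity \<mu> A"
  unfolding sweep_capacity_def by (intro cInf_greatest) (auto simp: ip_nonneg open_sweeps_nonempty)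

lemma sweep_capacity_less:
  assumes "\<mu> \<in> energy_cone" "sweep_capacity \<mu> A < t"
  obtains D \<nu> where "open D" "A \<subseteq> D" "\<nu> \<in> sweeps D \<mu>" "ip \<nu> \<nu> < t"
proof -
  have "\<exists>y\<in>(\<lambda>\<nu>. ip \<nu> \<nu>) ` open_sweeps \<mu> A. y < t"
    by (rule cInf_lessD) (use assms open_sweeps_nonempty in \<open>auto simp: sweep_capacity_def\<close>)
  then show thesis using that by (auto simp: open_sweeps_def)
qed

lemma sweep_capacity_mono: "\<mu> \<in> energy_cone \<Longrightarrow> A \<subseteq> B \<Longrightarrow> sweep_capacity \<mu> A \<le> sweep_capacity \<mu> B"
  unfolding sweep_capacity_def
  by (intro cInf_superset_mono bdd_below_energies image_mono open_sweeps_antimono)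
    (auto simp: open_sweeps_nonempty)

text \<open>Near minimizers for the members of an increasing sequence of sets form a strong Cauchy sequence.
  Along a rapidly convergent subsequence, the projections \<open>\<sigma>\<close> of the successive differences have
  summable norms, and adding them to the first near minimizer gives a single measure whose potential
  dominates all the later ones.\<close>

lemma sweep_capacity_increasing:
  assumes \<mu>: "\<mu> \<in> energy_cone" and A: "incseq A" and t: "\<And>n::nat. sweep_capacity \<mu> (A n) \<le> t"
  shows "sweep_capacity \<mu> (\<Union>n. A n) \<le> t"
proof -
  obtain c where c: "\<And>n. c n \<in> open_sweeps \<mu> (A n)" "cauchy_seq c"
    "\<And>n. ip (c n) (c n) \<le> Inf ((\<lambda>x. ip x x) ` open_sweeps \<mu> (A n)) + 1 / real (Suc n)"
  proof (rule near_minimizers[where S = "\<lambda>n. open_sweeps \<mu> (A n)" and J = "\<lambda>x. ip x x" and L = 0 and B = t])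
    show "open_sweeps \<mu> (A n) \<noteq> {}" for n by (rule open_sweeps_nonempty[OF \<mu>])
    show "open_sweeps \<mu> (A m) \<subseteq> open_sweeps \<mu> (A n)" if "n \<le> m" for m n
      by (rule open_sweeps_antimono[OF incseqD[OF A that]])
    show "half_sum x y \<in> open_sweeps \<mu> (A n)"
      if xy: "x \<in> open_sweeps \<mu> (A n)" "y \<in> open_sweeps \<mu> (A n)" for n x y
    proof -
      obtain D where D: "open D" "A n \<subseteq> D" "x \<in> sweeps D \<mu>"
        using xy(1) by (auto simp: open_sweeps_def)
      obtain E where E: "open E" "A n \<subseteq> E" "y \<in> sweeps E \<mu>"
        using xy(2) by (auto simp: open_sweeps_def)
      have "half_sum x y \<in> sweeps (D \<inter> E) \<mu>" by (rule half_sum_sweeps[OF D(3) E(3) \<mu>])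
      then show ?thesis
        unfolding open_sweeps_def by (rule UN_I[rotated]) (use D E in auto)
    qed
    show "dist2 x y \<le> 2 * ip x x + 2 * ip y y - 4 * ip (half_sum x y) (half_sum x y)"
      if "x \<in> open_sweeps \<mu> (A 0)" "y \<in> open_sweeps \<mu> (A 0)" for x y
      using parallelogram[of x y] that open_sweeps_cone by simp
    show "Inf ((\<lambda>x. ip x x) ` open_sweeps \<mu> (A n)) \<le> t" for n
      using t[of n] by (simp add: sweep_capacity_def)
  qed (auto simp: ip_nonneg)
  have cc: "c n \<in> energy_cone" for n using c(1) by (rule open_sweeps_cone)
  have cn: "ip (c n) (c n) \<le> t + 1 / real (Suc n)" for n
    using c(3)[of n] t[of n] by (simp add: sweep_capacity_def)
  have bound: "sweep_capacity \<mu> (\<Union>n. A n) \<le> (sqrt (t + e) + 2 * e)\<^sup>2" if e: "e > 0" for e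
  proof -
    have "\<exists>N. \<forall>m\<ge>N. \<forall>n\<ge>N. dist2 (c m) (c n) < (e * (1/2)^j)\<^sup>2" for j :: nat
      using c(2) e unfolding cauchy_seq_def by simp
    then obtain N where N: "\<And>j m n. m \<ge> N j \<Longrightarrow> n \<ge> N j \<Longrightarrow> dist2 (c m) (c n) < (e * (1/2)^j)\<^sup>2" by metis
    obtain N' :: nat where N': "inverse (real (Suc N')) < e" using reals_Archimedean[OF e] by blast
    \<comment> \<open>\<open>N'\<close> makes the first energy nearly optimal, and \<open>j\<close> makes the subsequence cofinal\<close>
    define r where "r j = N' + j + (\<Sum>i\<le>j. N i)" for j
    have rN: "N j \<le> r j" for j
      using member_le_sum[of j "{..j}" N] by (simp add: r_def)
    have rmono: "r j \<le> r (Suc j)" for j by (simp add: r_def)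
    define d where "d j = c (r j)" for j
    have dc: "d j \<in> energy_cone" for j by (simp add: d_def cc)
    have dd: "dist2 (d (Suc j)) (d j) \<le> (e * (1/2)^j)\<^sup>2" for j
      unfolding d_def using N[of j "r (Suc j)" "r j"] rN[of j] rmono[of j] by simp
    have d0: "mnorm (d 0) \<le> sqrt (t + e)"
    proof (rule real_sqrt_le_mono)
      have "1 / real (Suc (r 0)) \<le> 1 / real (Suc N')" by (intro divide_left_mono) (auto simp: r_def)
      then show "ip (d 0) (d 0) \<le> t + e" using cn[of "r 0"] N' by (simp add: d_def inverse_eq_divide)
    qed
    have "\<exists>D. open D \<and> A j \<subseteq> D \<and> d j \<in> sweeps D \<mu>" for j
    proof -
      have "A j \<subseteq> A (r j)" by (rule incseqD[OF A]) (simp add: r_def)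
      then show ?thesis using c(1)[of "r j"] unfolding d_def open_sweeps_def by blast
    qed
    then obtain D where D: "\<And>j. open (D j)" "\<And>j. A j \<subseteq> D j" "\<And>j. d j \<in> sweeps (D j) \<mu>" by metis
    have "\<exists>p. p \<in> energy_cone \<and> (\<forall>t\<in>energy_cone. ip (d (Suc j)) t - ip (d j) t \<le> ip p t)
        \<and> ip p p \<le> dist2 (d (Suc j)) (d j)" for j
      by (rule projection[OF closed_UNIV dc[of "Suc j"] dc[of j]]) (auto simp: cone_on_UNIV)
    then obtain \<sigma> where \<sigma>: "\<And>j. \<sigma> j \<in> energy_cone"
      "\<And>j t. t \<in> energy_cone \<Longrightarrow> ip (d (Suc j)) t - ip (d j) t \<le> ip (\<sigma> j) t"
      "\<And>j. ip (\<sigma> j) (\<sigma> j) \<le> dist2 (d (Suc j)) (d j)" by metis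
    have \<sigma>n: "mnorm (\<sigma> j) \<le> e * (1/2)^j" for j
      using order_trans[OF \<sigma>(3) dd] e by (intro real_le_lsqrt) (auto simp: ip_nonneg)
    define s where "s = rec_nat (d 0) (\<lambda>j x. add_measure x (\<sigma> j))"
    have s: "s 0 = d 0" "s (Suc j) = add_measure (s j) (\<sigma> j)" for j by (simp_all add: s_def)
    have sc: "s j \<in> energy_cone" for j by (induction j) (auto simp: s dc cone_add \<sigma>)
    have ds: "ip (d j) t \<le> ip (s j) t" if "t \<in> energy_cone" for j t
    proof (induction j)
      case (Suc j)
      then show ?case using \<sigma>(2)[OF that, of j] by (simp add: s ip_add_left sc \<sigma>(1) that)
    qed (simp add: s)
    have smono: "ip (s n) t \<le> ip (s m) t" if "n \<le> m" "t \<in> energy_cone" for n m t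
      using that(1) by (rule lift_Suc_mono_le[rotated]) (simp add: s ip_add_left sc \<sigma>(1) that(2) ip_nonneg)
    have sn: "mnorm (s j) \<le> sqrt (t + e) + e * (\<Sum>i<j. (1/2)^i)" for j
    proof (induction j)
      case 0
      show ?case using d0 by (simp add: s)
    next
      case (Suc j)
      have "mnorm (s (Suc j)) \<le> mnorm (s j) + mnorm (\<sigma> j)"
        unfolding s by (rule mnorm_add_le[OF sc \<sigma>(1)])
      then show ?case using Suc \<sigma>n[of j] by (simp add: distrib_left)
    qed
    have geo: "(\<Sum>i<j. (1/2)^i) \<le> (2::real)" for j
    proof -
      have "(\<Sum>i<j. (1/2)^i) = 2 - 2 * (1/2::real)^j" by (induction j) auto
      then show ?thesis by simp
    qed
    have sbound: "ip (s j) (s j) \<le> (sqrt (t + e) + 2 * e)\<^sup>2" for j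
    proof -
      have "mnorm (s j) \<le> sqrt (t + e) + 2 * e"
      proof -
        have "e * (\<Sum>i<j. (1/2)^i) \<le> e * 2" using e by (intro mult_left_mono geo) simp
        then show ?thesis using sn[of j] by linarith
      qed
      then have "(mnorm (s j))\<^sup>2 \<le> (sqrt (t + e) + 2 * e)\<^sup>2" by (intro power_mono) (auto simp: ip_nonneg)
      then show ?thesis by (simp add: ip_nonneg)
    qed
    have "cauchy_seq s" by (rule increasing_cauchy[OF sc smono sbound]) (auto simp: sc)
    then obtain q where q: "q \<in> cone_on UNIV" "(\<lambda>n. dist2 (s n) q) \<longlonglongrightarrow> 0"
      using cone_on_complete[OF closed_UNIV, of s] sc by (metis cone_on_UNIV)
    have qc: "q \<in> energy_cone" using q(1) by (rule cone_on_cone)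
    have sq: "ip (s j) t \<le> ip q t" if "t \<in> energy_cone" for j t
      by (rule LIMSEQ_le[OF tendsto_const ip_limit[OF sc qc q(2) that]]) (use smono that in blast)
    have "q \<in> sweeps (D j) \<mu>" for j
    proof -
      have "ip \<mu> t \<le> ip q t" if t: "t \<in> cone_on (D j)" for t
      proof -
        have "ip \<mu> t \<le> ip (d j) t" using D(3)[of j] t by (simp add: sweeps_def)
        also have "\<dots> \<le> ip (s j) t" by (rule ds[OF cone_on_cone[OF t]])
        also have "\<dots> \<le> ip q t" by (rule sq[OF cone_on_cone[OF t]])
        finally show ?thesis .
      qed
      then show ?thesis using qc by (simp add: sweeps_def)
    qed
    then have "q \<in> sweeps (\<Union>j. D j) \<mu>" using D(1) by (intro sweeps_UN \<mu>) auto
    moreover have "open (\<Union>j. D j)" "(\<Union>n. A n) \<subseteq> (\<Union>j. D j)" using D(1,2) by (auto; blast)+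
    ultimately have "q \<in> open_sweeps \<mu> (\<Union>n. A n)" unfolding open_sweeps_def by blast
    then have "sweep_capacity \<mu> (\<Union>n. A n) \<le> ip q q" by (rule sweep_capacity_le)
    also have "\<dots> \<le> (sqrt (t + e) + 2 * e)\<^sup>2"
      by (rule LIMSEQ_le[OF norm_limit[OF sc qc q(2)] tendsto_const]) (use sbound in blast)
    finally show ?thesis .
  qed
  have t0: "0 \<le> t" using sweep_capacity_nonneg[OF \<mu>, of "A 0"] t[of 0] by simp
  have "((\<lambda>e. (sqrt (t + e) + 2 * e)\<^sup>2) \<longlongrightarrow> (sqrt (t + 0) + 2 * 0)\<^sup>2) (at_right 0)"
    by (intro tendsto_intros)
  then have lim: "((\<lambda>e. (sqrt (t + e) + 2 * e)\<^sup>2) \<longlongrightarrow> t) (at_right 0)" using t0 by simp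
  show ?thesis
  proof (rule tendsto_lowerbound[OF lim])
    show "\<forall>\<^sub>F e in at_right 0. sweep_capacity \<mu> (\<Union>n. A n) \<le> (sqrt (t + e) + 2 * e)\<^sup>2"
      using bound by (auto simp: eventually_at_right_field intro: exI[of _ 1])
  qed simp
qed

text \<open>The projections onto the cones of a decreasing sequence of closed neighbourhoods of \<open>L\<close> converge
  strongly to a measure on \<open>L\<close>, which is zero.\<close>

lemma sweep_capacity_compact_zero:
  assumes \<mu>: "\<mu> \<in> energy_cone" and L: "compact L" and zero: "inner_capacity \<kappa> L = 0"
  shows "sweep_capacity \<mu> L = 0"
proof -
  have "open (- L)" using L by (simp add: compact_imp_closed open_Compl)
  then obtain C :: "nat \<Rightarrow> 'a set" where C: "\<And>n. compact (C n)" "- L = (\<Union>n. C n)"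
    using open_K_sigma[of "- L"] by (auto simp: K_sigma_def)
  have "\<exists>W. open W \<and> L \<subseteq> W \<and> closure W \<subseteq> - C n" for n
  proof -
    have "open (- C n)" "L \<subseteq> - C n" using C by (auto simp: compact_imp_closed open_Compl)
    then show ?thesis by (rule relatively_compact_neighbourhood[OF L]) blast
  qed
  then obtain W where W: "\<And>n. open (W n)" "\<And>n. L \<subseteq> W n" "\<And>n. closure (W n) \<subseteq> - C n" by metis
  define F where "F n = (\<Inter>i\<le>n. closure (W i))" for n :: nat
  define D where "D n = (\<Inter>i\<le>n. W i)" for n :: nat
  have F: "closed (F n)" for n by (auto simp: F_def)
  have D: "open (D n)" "L \<subseteq> D n" "D n \<subseteq> F n" for n
    using W(1,2) closure_subset by (auto simp: D_def F_def intro!: open_INT) blast+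
  have Fdec: "F m \<subseteq> F n" if "n \<le> m" for m n using that by (auto simp: F_def)
  have FL: "(\<Inter>n. F n) \<subseteq> L" using W(3) C(2) by (auto simp: F_def) blast
  have "\<exists>p. p \<in> cone_on (F n) \<and> p \<in> sweeps (F n) \<mu> \<and> ip p p = ip \<mu> p" for n
    by (rule projection_sweeps[OF F[of n] \<mu>]) blast
  then obtain p where p: "\<And>n. p n \<in> cone_on (F n)" "\<And>n. p n \<in> sweeps (F n) \<mu>" "\<And>n. ip (p n) (p n) = ip \<mu> (p n)"
    by metis
  have pc: "p n \<in> energy_cone" for n using p(1) by (rule cone_on_cone)
  have cs: "cauchy_seq p"
  proof (rule decreasing_cauchy[OF pc])
    fix m n :: nat assume "n \<le> m"
    then have "p m \<in> cone_on (F n)" using p(1)[of m] cone_on_mono[OF Fdec] by blast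
    then show "ip (p m) (p m) \<le> ip (p n) (p m)" using p(2)[of n] p(3)[of m] by (simp add: sweeps_def)
  qed
  then obtain q where q: "q \<in> cone_on UNIV" "(\<lambda>n. dist2 (p n) q) \<longlonglongrightarrow> 0"
    using cone_on_complete[OF closed_UNIV, of p] pc by (metis cone_on_UNIV)
  have qc: "q \<in> energy_cone" using q(1) by (rule cone_on_cone)
  have "AE x in q. x \<in> F j" for j
  proof -
    have "p (n + j) \<in> cone_on (F j)" for n using p(1)[of "n + j"] cone_on_mono[OF Fdec[of j "n + j"]] by auto
    moreover have "cauchy_seq (\<lambda>n. p (n + j))"
      using cs unfolding cauchy_seq_def by (meson trans_le_add1)
    ultimately obtain M where M: "M \<in> cone_on (F j)" "(\<lambda>n. dist2 (p (n + j)) M) \<longlonglongrightarrow> 0"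
      by (rule cone_on_complete[OF F])
    have "M = q"
      using strong_limit_unique[OF pc cone_on_cone[OF M(1)] qc M(2) LIMSEQ_ignore_initial_segment[OF q(2)]] .
    then show ?thesis using M(1) by (simp add: cone_on_def)
  qed
  then have "AE x in q. \<forall>j. x \<in> F j" unfolding AE_all_countable by (rule allI)
  then have "AE x in q. x \<in> L" by (rule eventually_mono) (use FL in blast)
  then have "q = null_measure borel" using zero qc by (auto simp: inner_capacity_zero_iff cone_on_def)
  then have lim: "(\<lambda>n. ip (p n) (p n)) \<longlonglongrightarrow> 0"
    using norm_limit[OF pc qc q(2)] by (simp add: ip_null cone_null)
  have "p n \<in> open_sweeps \<mu> L" for n
    using D[of n] sweeps_antimono[OF D(3)[of n], of \<mu>] p(2)[of n] unfolding open_sweeps_def by blast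
  then have "sweep_capacity \<mu> L \<le> ip (p n) (p n)" for n by (rule sweep_capacity_le)
  then have "sweep_capacity \<mu> L \<le> 0" by (intro LIMSEQ_le[OF tendsto_const lim]) auto
  then show ?thesis using sweep_capacity_nonneg[OF \<mu>, of L] by simp
qed

lemma sweep_capacity_borel_zero:
  assumes \<mu>: "\<mu> \<in> energy_cone" and N: "N \<in> sets borel" and zero: "inner_capacity \<kappa> N = 0"
  shows "sweep_capacity \<mu> N = 0"
proof (rule ccontr)
  assume "sweep_capacity \<mu> N \<noteq> 0"
  then have pos: "sweep_capacity \<mu> N / 2 < sweep_capacity \<mu> N" "0 < sweep_capacity \<mu> N"
    using sweep_capacity_nonneg[OF \<mu>, of N] by auto
  obtain L where L: "compact L" "L \<subseteq> N" "sweep_capacity \<mu> N / 2 \<le> sweep_capacity \<mu> L"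
  proof (rule capacitability[where I = "sweep_capacity \<mu>", OF _ _ _ N pos(1)])
    show "sweep_capacity \<mu> A \<le> sweep_capacity \<mu> B" if "A \<subseteq> B" for A B
      by (rule sweep_capacity_mono[OF \<mu> that])
    show "sweep_capacity \<mu> (\<Union>n. A n) \<le> t" if "incseq A" "\<And>n::nat. sweep_capacity \<mu> (A n) \<le> t" for A t
      by (rule sweep_capacity_increasing[OF \<mu> that])
    show "\<exists>D. open D \<and> L \<subseteq> D \<and> sweep_capacity \<mu> D < t" if lt: "sweep_capacity \<mu> L < t" for L t
    proof -
      obtain D \<nu> where D: "open D" "L \<subseteq> D" "\<nu> \<in> sweeps D \<mu>" "ip \<nu> \<nu> < t"
        by (rule sweep_capacity_less[OF \<mu> lt])
      then have "sweep_capacity \<mu> D \<le> ip \<nu> \<nu>" by (intro sweep_capacity_le) (auto simp: open_sweeps_def)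
      then show ?thesis using D by (intro exI[of _ D]) auto
    qed
  qed blast
  have "inner_capacity \<kappa> L = 0"
    using inner_capacity_mono[OF L(2)] zero inner_capacity_nonneg[of L] by simp
  then have "sweep_capacity \<mu> L = 0" by (rule sweep_capacity_compact_zero[OF \<mu> L(1)])
  then show False using L(3) pos(2) by simp
qed

text \<open>Lower semicontinuity of potentials, from Fatou's lemma along sequences.\<close>

lemma potential_open:
  assumes M: "locally_finite_measure M"
  shows "open {x. a < pot M x}"
proof -
  have "closed {x. pot M x \<le> a}"
    unfolding closed_sequential_limits
  proof (intro allI impI)
    fix f l assume fl: "(\<forall>n. f n \<in> {x. pot M x \<le> a}) \<and> f \<longlonglongrightarrow> l"
    have m: "\<kappa> x \<in> borel_measurable M" for x
      using kernel_section_measurable measurable_cong_sets[OF locally_finite_sets[OF M] refl] by blast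
    have lsc: "\<kappa> l y \<le> liminf (\<lambda>n. \<kappa> (f n) y)" for y
      unfolding le_Liminf_iff
    proof (intro allI impI)
      fix b assume b: "b < \<kappa> l y"
      have op: "open {(x, y). b < \<kappa> x y}" using kernel by (simp add: potential_kernel_def)
      have lim: "(\<lambda>n. (f n, y)) \<longlonglongrightarrow> (l, y)" using fl by (intro tendsto_Pair) auto
      have "\<forall>\<^sub>F n in sequentially. (f n, y) \<in> {(x, y). b < \<kappa> x y}"
        by (rule topological_tendstoD[OF lim op]) (use b in simp)
      then show "\<forall>\<^sub>F n in sequentially. b < \<kappa> (f n) y" by simp
    qed
    have "pot M l \<le> (\<integral>\<^sup>+y. liminf (\<lambda>n. \<kappa> (f n) y) \<partial>M)"
      unfolding pos_potential_def using lsc by (intro nn_integral_mono)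
    also have "\<dots> \<le> liminf (\<lambda>n. pot M (f n))"
      unfolding pos_potential_def by (rule nn_integral_liminf[OF m])
    also have "\<dots> \<le> liminf (\<lambda>n. a)" using fl by (intro Liminf_mono always_eventually) auto
    also have "\<dots> = a" by (rule Liminf_const) simp
    finally show "l \<in> {x. pot M x \<le> a}" by simp
  qed
  moreover have "{x. a < pot M x} = - {x. pot M x \<le> a}" by (auto simp: not_le)
  ultimately show ?thesis by (simp add: open_Compl)
qed

text \<open>Let \<open>D\<close> be an open set containing \<open>N\<close> and \<open>\<nu>\<close> a measure of small energy that sweeps \<open>D\<close>. On the open set
  where moreover \<open>pot \<mu>\<close> exceeds \<open>1 / (k + 1)\<close>, a measure \<open>s\<close> of finite energy has mass at most
  \<open>(k + 1) ip \<nu> s\<close>, which is small relative to the norm of \<open>s\<close>. The union over \<open>k\<close> of such open sets covers \<open>N\<close>.\<close>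

lemma outer_capacity_zero:
  assumes \<mu>: "\<mu> \<in> energy_cone" and zero: "sweep_capacity \<mu> N = 0" and N: "N \<subseteq> {x. 0 < pot \<mu> x}"
  shows "outer_capacity \<kappa> N = 0"
proof -
  have bound: "outer_capacity \<kappa> N \<le> ereal (e\<^sup>2)" if e: "e > 0" for e
  proof -
    \<comment> \<open>these bounds on the norms make the masses on the open sets below sum up to at most \<open>e\<close> times the norm\<close>
    define a where "a k = e * (1/2)^Suc k / real (Suc k)" for k
    have a: "0 < a k" for k using e by (simp add: a_def)
    have "\<exists>D \<nu>. open D \<and> N \<subseteq> D \<and> \<nu> \<in> sweeps D \<mu> \<and> ip \<nu> \<nu> < (a k)\<^sup>2" for k
    proof -
      have "sweep_capacity \<mu> N < (a k)\<^sup>2" using zero a[of k] by simp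
      then show ?thesis by (rule sweep_capacity_less[OF \<mu>]) blast
    qed
    then obtain D \<nu> where D: "\<And>k. open (D k)" "\<And>k. N \<subseteq> D k" "\<And>k. \<nu> k \<in> sweeps (D k) \<mu>"
      "\<And>k. ip (\<nu> k) (\<nu> k) < (a k)\<^sup>2" by metis
    define E where "E k = D k \<inter> {x. ennreal (1 / real (Suc k)) < pot \<mu> x}" for k
    have E: "open (E k)" for k
      unfolding E_def by (intro open_Int D(1) potential_open cone_locally_finite \<mu>)
    have NE: "N \<subseteq> (\<Union>k. E k)"
    proof
      fix x assume x: "x \<in> N"
      then obtain b where b: "0 < b" "b < pot \<mu> x" using N dense[of 0 "pot \<mu> x"] by auto
      then obtain r where r: "b = ennreal r" "0 < r" by (cases b) auto
      obtain k where "inverse (real (Suc k)) < r" using reals_Archimedean[OF r(2)] by blast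
      then have "ennreal (1 / real (Suc k)) \<le> b" unfolding r by (intro ennreal_leI) (simp add: inverse_eq_divide)
      then show "x \<in> (\<Union>k. E k)" using b(2) x D(2) unfolding E_def by (auto intro: le_less_trans)
    qed
    have "1 / e\<^sup>2 \<le> ip s s" if s: "s \<in> cone_on (\<Union>k. E k)" "emeasure s UNIV = 1" for s
    proof -
      have sc: "s \<in> energy_cone" using s(1) by (rule cone_on_cone)
      have Es: "E k \<in> sets s" for k using E cone_sets[OF sc] by simp
      have part: "emeasure s (E k) \<le> ennreal (e * (1/2)^Suc k * mnorm s)" for k
      proof -
        let ?R = "restrict_to s (E k)"
        have Rc: "?R \<in> energy_cone" using E by (intro cone_restrict sc) auto
        have RD: "?R \<in> cone_on (D k)"
          using cone_on_restrict[OF s(1) borel_open[OF E[of k]]] cone_on_mono[of "(\<Union>k. E k) \<inter> E k" "D k"]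
          by (auto simp: E_def)
        have "ennreal (1 / real (Suc k)) * emeasure s (E k) = (\<integral>\<^sup>+x. ennreal (1 / real (Suc k)) * indicator (E k) x \<partial>s)"
          using Es by (simp add: nn_integral_cmult_indicator)
        also have "\<dots> \<le> (\<integral>\<^sup>+x. pot \<mu> x * indicator (E k) x \<partial>s)"
          by (intro nn_integral_mono) (auto simp: E_def indicator_def)
        also have "\<dots> = pint ?R \<mu>"
          by (rule pint_restrict_left[symmetric]) (use sc \<mu> E in \<open>auto simp: cone_locally_finite\<close>)
        also have "\<dots> = ennreal (ip \<mu> ?R)" using ip_ennreal[OF Rc \<mu>] ip_commute[OF Rc \<mu>] by simp
        also have "ip \<mu> ?R \<le> a k * mnorm s"
        proof -
          have \<nu>c: "\<nu> k \<in> energy_cone" using D(3) by (rule sweeps_cone)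
          have "ip \<mu> ?R \<le> ip (\<nu> k) ?R" using D(3)[of k] RD by (simp add: sweeps_def)
          also have "\<dots> = ip ?R (\<nu> k)" by (rule ip_commute[OF \<nu>c Rc])
          also have "\<dots> \<le> ip s (\<nu> k)" using E by (intro ip_restrict_le sc \<nu>c) auto
          also have "\<dots> \<le> mnorm s * mnorm (\<nu> k)" by (rule cauchy_schwarz[OF sc \<nu>c])
          also have "\<dots> \<le> mnorm s * a k"
            using D(4)[of k] a[of k] by (intro mult_left_mono real_le_lsqrt) (auto simp: ip_nonneg)
          finally show ?thesis by (simp add: mult.commute)
        qed
        finally have "ennreal (1 / real (Suc k)) * emeasure s (E k) \<le> ennreal (a k * mnorm s)"
          by (simp add: ennreal_leI)
        then have "ennreal (real (Suc k)) * (ennreal (1 / real (Suc k)) * emeasure s (E k))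
            \<le> ennreal (real (Suc k)) * ennreal (a k * mnorm s)" by (rule mult_left_mono) simp
        moreover have "ennreal (real (Suc k)) * (ennreal (1 / real (Suc k)) * emeasure s (E k)) = emeasure s (E k)"
          by (simp add: mult.assoc[symmetric] ennreal_mult[symmetric] del: of_nat_Suc)
        moreover have "ennreal (real (Suc k)) * ennreal (a k * mnorm s) = ennreal (e * (1/2)^Suc k * mnorm s)"
        proof -
          have "real (Suc k) * (a k * mnorm s) = e * (1/2)^Suc k * mnorm s"
            by (simp add: a_def del: of_nat_Suc power_Suc)
          moreover have "ennreal (real (Suc k)) * ennreal (a k * mnorm s) = ennreal (real (Suc k) * (a k * mnorm s))"
            using a[of k] by (intro ennreal_mult[symmetric]) (auto simp: ip_nonneg)
          ultimately show ?thesis by (simp only:)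
        qed
        ultimately show ?thesis by simp
      qed
      have "(1::ennreal) = emeasure s (\<Union>k. E k)"
      proof -
        have "emeasure s UNIV = emeasure s (\<Union>k. E k)"
          using s(1) Es cone_sets[OF sc] by (intro emeasure_eq_AE) (auto simp: cone_on_def)
        then show ?thesis using s(2) by simp
      qed
      also have "\<dots> \<le> (\<Sum>k. emeasure s (E k))" using Es by (intro emeasure_subadditive_countably) auto
      also have "\<dots> \<le> (\<Sum>k. ennreal (e * (1/2)^Suc k * mnorm s))" by (intro suminf_le part) auto
      also have "\<dots> = ennreal (e * 1 * mnorm s)"
      proof (rule suminf_ennreal_eq)
        show "(\<lambda>k. e * (1/2)^Suc k * mnorm s) sums (e * 1 * mnorm s)"
          by (intro sums_mult sums_mult2 power_half_series)
      qed (use e in \<open>simp add: ip_nonneg\<close>)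
      finally have "ennreal 1 \<le> ennreal (e * mnorm s)" by simp
      then have "1 \<le> e * mnorm s" using e by (subst (asm) ennreal_le_iff) (auto simp: ip_nonneg)
      then have "1\<^sup>2 \<le> (e * mnorm s)\<^sup>2" by (intro power_mono) auto
      then show ?thesis using e by (simp add: power_mult_distrib ip_nonneg field_simps)
    qed
    then have "ereal (1 / e\<^sup>2) \<le> (INF M\<in>{M \<in> cone_on (\<Union>k. E k). emeasure M UNIV = 1}. ereal (ip M M))"
      by (intro INF_greatest) auto
    then have "inner_capacity \<kappa> (\<Union>k. E k) \<le> inverse (ereal (1 / e\<^sup>2))"
      unfolding inner_capacity_eq by (intro ereal_inverse_antimono) auto
    also have "\<dots> = ereal (e\<^sup>2)" using e by simp
    finally have "inner_capacity \<kappa> (\<Union>k. E k) \<le> ereal (e\<^sup>2)" .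
    moreover have "outer_capacity \<kappa> N \<le> inner_capacity \<kappa> (\<Union>k. E k)"
      unfolding outer_capacity_def by (rule INF_lower) (use E NE in auto)
    ultimately show ?thesis by simp
  qed
  have "outer_capacity \<kappa> N \<le> 0"
  proof (rule ereal_le_epsilon2)
    fix e :: real assume "0 < e"
    then show "outer_capacity \<kappa> N \<le> 0 + ereal e" using bound[of "sqrt e"] by simp
  qed
  then show ?thesis using outer_capacity_nonneg[of N] by simp
qed

section \<open>Equality of the balayages\<close>

lemma outer_capacity_mono: "A \<subseteq> B \<Longrightarrow> outer_capacity \<kappa> A \<le> outer_capacity \<kappa> B"
  unfolding outer_capacity_def by (rule INF_superset_mono) auto

text \<open>On a Borel set the exceptional set is Borel, so it does not matter which capacity measures it.\<close>

lemma outer_exception_iff: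
  assumes \<mu>: "\<mu> \<in> energy_cone" and \<nu>: "\<nu> \<in> energy_cone" and B: "B \<in> sets borel"
  shows "outer_capacity \<kappa> {x \<in> B. \<not> pot \<mu> x \<le> pot \<nu> x} = 0 \<longleftrightarrow> \<nu> \<in> sweeps B \<mu>"
proof -
  let ?N = "{x \<in> B. \<not> pot \<mu> x \<le> pot \<nu> x}"
  have [measurable]: "pot \<mu> \<in> borel_measurable borel" "pot \<nu> \<in> borel_measurable borel" "B \<in> sets borel"
    using potential_measurable \<mu> \<nu> cone_locally_finite B by blast+
  have N: "?N \<in> sets borel" by measurable
  have sub: "?N \<subseteq> {x. 0 < pot \<mu> x}" by (auto simp: not_le intro: le_less_trans[OF zero_le])
  have "outer_capacity \<kappa> ?N = 0 \<longleftrightarrow> inner_capacity \<kappa> ?N = 0"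
  proof
    assume "outer_capacity \<kappa> ?N = 0"
    then show "inner_capacity \<kappa> ?N = 0"
      using inner_le_outer_capacity[of ?N] inner_capacity_nonneg[of ?N] by simp
  next
    assume "inner_capacity \<kappa> ?N = 0"
    then show "outer_capacity \<kappa> ?N = 0"
      by (intro outer_capacity_zero[OF \<mu> _ sub] sweep_capacity_borel_zero[OF \<mu> N])
  qed
  then show ?thesis using inner_exception_iff[OF \<mu> \<nu>] by simp
qed

lemma outer_balayage_class:
  assumes "\<mu> \<in> energy_cone" "B \<in> sets borel"
  shows "balayage_class \<kappa> (outer_capacity \<kappa>) B (functional_of \<mu>) = functional_of ` sweeps B \<mu>"
  using balayage_class_eq[OF assms(1) outer_capacity_mono outer_capacity_nonneg] outer_exception_iff[OF assms(1) _ assms(2)]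
  by (auto simp: sweeps_cone)

text \<open>The parameters \<open>A\<close> and \<open>B\<close> are separate because different sets and capacities lead to the same class.\<close>

lemma is_balayage_iff:
  assumes "balayage_class \<kappa> cap A (functional_of \<mu>) = functional_of ` sweeps B \<mu>"
  shows "is_balayage \<kappa> cap A (functional_of \<mu>) \<phi> \<longleftrightarrow>
    (\<exists>p\<in>sweeps B \<mu>. \<phi> = functional_of p \<and> (\<forall>\<nu>\<in>sweeps B \<mu>. \<forall>x. pot p x \<le> pot \<nu> x))"
  unfolding is_balayage_def assms
  by (auto simp: potential_functional_of cone_locally_finite sweeps_cone less_eq_ennreal.rep_eq[symmetric])

lemma is_balayage_ex1:
  assumes cls: "balayage_class \<kappa> cap A (functional_of \<mu>) = functional_of ` sweeps B \<mu>" and \<mu>: "\<mu> \<in> energy_cone"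
  shows "\<exists>!\<phi>. is_balayage \<kappa> cap A (functional_of \<mu>) \<phi>"
proof -
  obtain p where p: "p \<in> sweeps B \<mu>" "\<And>\<nu> x. \<nu> \<in> sweeps B \<mu> \<Longrightarrow> pot p x \<le> pot \<nu> x"
    by (rule minimal_sweep[OF \<mu>]) blast
  have "q = p" if "q \<in> sweeps B \<mu>" "\<forall>\<nu>\<in>sweeps B \<mu>. \<forall>x. pot q x \<le> pot \<nu> x" for q
    using that p by (intro eq_of_pot_eq) (auto simp: sweeps_cone intro: antisym)
  then show ?thesis unfolding is_balayage_iff[OF cls] using p by blast
qed

lemma finite_energy_parts:
  assumes "\<mu> \<in> finite_energy \<kappa>"
  shows "pos_measure \<mu> \<in> energy_cone" "neg_measure \<mu> \<in> energy_cone"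
proof -
  have \<mu>: "\<mu> \<in> signed_measures" "energy_defined \<kappa> \<mu> \<mu>" "\<bar>mutual_energy \<kappa> \<mu> \<mu>\<bar> \<noteq> \<infinity>"
    using assms by (auto simp: finite_energy_def)
  have "pos_energy \<kappa> \<mu> \<mu> < \<infinity>"
  proof (rule ccontr)
    assume "\<not> pos_energy \<kappa> \<mu> \<mu> < \<infinity>"
    then have "pos_energy \<kappa> \<mu> \<mu> = top" by (simp add: less_top[symmetric])
    then have "mutual_energy \<kappa> \<mu> \<mu> = \<infinity>"
      by (simp add: mutual_energy_def top_ennreal.rep_eq top_ereal_def)
    then show False using \<mu>(3) by simp
  qed
  then show "pos_measure \<mu> \<in> energy_cone" "neg_measure \<mu> \<in> energy_cone"
    using signed_measure_parts(1,2)[OF \<mu>(1)] by (auto simp: energy_cone_def pos_energy_def)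
qed

lemma balayage_cong:
  assumes "\<And>\<mu>. \<mu> \<in> energy_cone \<Longrightarrow> balayage_class \<kappa> cap A (functional_of \<mu>) = balayage_class \<kappa> cap' B (functional_of \<mu>)"
    and "\<mu> \<in> finite_energy \<kappa>"
  shows "balayage \<kappa> cap A \<mu> = balayage \<kappa> cap' B \<mu>"
  using assms(1)[OF finite_energy_parts(1)[OF assms(2)]] assms(1)[OF finite_energy_parts(2)[OF assms(2)]]
  by (simp add: balayage_def is_balayage_def pos_part_def neg_part_def)

theorem balayage_on_K_sigma:
  "\<exists>A0. K_sigma A0 \<and> A0 \<subseteq> A \<and>
    (\<forall>Q. A0 \<subseteq> Q \<and> Q \<subseteq> A \<longrightarrow>
      (\<forall>\<mu>\<in>finite_energy \<kappa>.
         inner_balayage \<kappa> A \<mu> = inner_balayage \<kappa> Q \<mu> \<and>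
         inner_balayage \<kappa> Q \<mu> = inner_balayage \<kappa> A0 \<mu>)) \<and>
    (\<forall>B\<in>sets borel. A0 \<subseteq> B \<and> B \<subseteq> A \<longrightarrow>
      (\<forall>\<mu>\<in>finite_energy \<kappa>.
         outer_balayage_exists \<kappa> B \<mu> \<and> outer_balayage_exists \<kappa> A0 \<mu> \<and>
         inner_balayage \<kappa> A \<mu> = outer_balayage \<kappa> B \<mu> \<and>
         outer_balayage \<kappa> B \<mu> = outer_balayage \<kappa> A0 \<mu>))"
proof -
  obtain A0 where A0: "K_sigma A0" "A0 \<subseteq> A"
    and dense: "\<And>M. M \<in> cone_on A \<Longrightarrow> \<exists>c. (\<forall>n. c n \<in> cone_on A0) \<and> (\<lambda>n. dist2 (c n) M) \<longlonglongrightarrow> 0"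
    by (rule strongly_dense_K_sigma) blast
  obtain K :: "nat \<Rightarrow> 'a set" where K: "\<forall>n. compact (K n)" "A0 = (\<Union>n. K n)"
    using A0(1) by (auto simp: K_sigma_def)
  have A0_borel: "A0 \<in> sets borel"
    unfolding K(2) using K(1) by (intro sets.countable_UN) (auto simp: compact_borel)
  have sweeps_eq: "sweeps Q \<mu> = sweeps A0 \<mu>" if "A0 \<subseteq> Q" "Q \<subseteq> A" "\<mu> \<in> energy_cone" for Q \<mu>
    using sweeps_antimono[OF that(1), of \<mu>] sweeps_antimono[OF that(2), of \<mu>] sweeps_dense[of A A0 \<mu>] dense that(3)
    by blast
  have inner: "balayage_class \<kappa> (inner_capacity \<kappa>) Q (functional_of \<mu>) = functional_of ` sweeps A0 \<mu>"
    if "A0 \<subseteq> Q" "Q \<subseteq> A" "\<mu> \<in> energy_cone" for Q \<mu>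
    using inner_balayage_class[OF that(3)] sweeps_eq[OF that] by simp
  have outer: "balayage_class \<kappa> (outer_capacity \<kappa>) B (functional_of \<mu>) = functional_of ` sweeps A0 \<mu>"
    if "B \<in> sets borel" "A0 \<subseteq> B" "B \<subseteq> A" "\<mu> \<in> energy_cone" for B \<mu>
    using outer_balayage_class[OF that(4,1)] sweeps_eq[OF that(2-4)] by simp
  have ex: "outer_balayage_exists \<kappa> B \<mu>" if "B \<in> sets borel" "A0 \<subseteq> B" "B \<subseteq> A" "\<mu> \<in> finite_energy \<kappa>" for B \<mu>
    unfolding balayage_exists_def pos_part_def neg_part_def
    using is_balayage_ex1[OF outer[OF that(1-3)]] finite_energy_parts[OF that(4)] by blast
  show ?thesis
  proof (intro exI[of _ A0] conjI allI ballI impI A0)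
    fix Q \<mu> assume Q: "A0 \<subseteq> Q \<and> Q \<subseteq> A" and \<mu>: "\<mu> \<in> finite_energy \<kappa>"
    show "inner_balayage \<kappa> A \<mu> = inner_balayage \<kappa> Q \<mu>"
      by (rule balayage_cong[OF _ \<mu>]) (use inner A0(2) Q in simp)
    show "inner_balayage \<kappa> Q \<mu> = inner_balayage \<kappa> A0 \<mu>"
      by (rule balayage_cong[OF _ \<mu>]) (use inner A0(2) Q in simp)
  next
    fix B \<mu> assume B: "B \<in> sets borel" "A0 \<subseteq> B \<and> B \<subseteq> A" and \<mu>: "\<mu> \<in> finite_energy \<kappa>"
    show "outer_balayage_exists \<kappa> B \<mu>" "outer_balayage_exists \<kappa> A0 \<mu>"
      using ex B A0(2) A0_borel \<mu> by auto
    show "inner_balayage \<kappa> A \<mu> = outer_balayage \<kappa> B \<mu>"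
      by (rule balayage_cong[OF _ \<mu>]) (use inner outer A0(2) B in simp)
    show "outer_balayage \<kappa> B \<mu> = outer_balayage \<kappa> A0 \<mu>"
      by (rule balayage_cong[OF _ \<mu>]) (use outer A0_borel A0(2) B in simp)
  qed
qed

end

theorem theorem5p1:
  fixes \<kappa> :: "'a::{t2_space, second_countable_topology} \<Rightarrow> 'a \<Rightarrow> ennreal"
    and A :: "'a set"
  assumes "locally_compact_space (euclidean :: 'a topology)"
    and "potential_kernel \<kappa>"
    and "energy_principle \<kappa>"
    and "consistency_principle \<kappa>"
    and "domination_principle \<kappa>"
    and "inductive_limit_topology closure_of continuous_potentials \<kappa> = Cc"
  shows "\<exists>A0. K_sigma A0 \<and> A0 \<subseteq> A \<and>
    (\<forall>Q. A0 \<subseteq> Q \<and> Q \<subseteq> A \<longrightarrow>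
      (\<forall>\<mu>\<in>finite_energy \<kappa>.
         inner_balayage \<kappa> A \<mu> = inner_balayage \<kappa> Q \<mu> \<and>
         inner_balayage \<kappa> Q \<mu> = inner_balayage \<kappa> A0 \<mu>)) \<and>
    (\<forall>B\<in>sets borel. A0 \<subseteq> B \<and> B \<subseteq> A \<longrightarrow>
      (\<forall>\<mu>\<in>finite_energy \<kappa>.
         outer_balayage_exists \<kappa> B \<mu> \<and> outer_balayage_exists \<kappa> A0 \<mu> \<and>
         inner_balayage \<kappa> A \<mu> = outer_balayage \<kappa> B \<mu> \<and>
         outer_balayage \<kappa> B \<mu> = outer_balayage \<kappa> A0 \<mu>))"
proof -
  interpret kernel_space "TYPE('a)" \<kappa>
    by unfold_locales (use assms in auto)
  show ?thesis by (rule balayage_on_K_sigma)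
qed

end
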